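(* The decision problem $\mathsf{PAST}$ (given a $\mathsf{pGCL}$ program $P$, decide whether $P\in\mathsf{PAST}$) is $\Pi^1_1$-complete.
   Context: pGCL. Fix a countable set $\mathrm{Var}$ of variables taking rational values. Programs are generated by the grammar $P ::= \bot \mid v:=e \mid P;P \mid P\oplus_p P \mid P\,[\!]\,P \mid \mathtt{while}(b)\{P\}$, where $v\in\mathrm{Var}$, $e,p$ are arithmetical expressions and $b$ is a boolean expression over $\mathrm{Var}$, and $\bot$ is the empty program ($\oplus_p$ is probabilistic choice, $[\!]$ is binary nondeterministic choice). A valuation is $\eta:\mathrm{Var}\to\mathbb{Q}$, and $[\![e]\!]_\eta$ is the value of $e$ under $\eta$. A scheduler is a total function $f:\{L_n,R_n,L_p,R_p\}^*\to\{L_n,R_n\}$; $\mathbb{F}$ is the set of schedulers. An execution state is a tuple $(P,\eta,a,w)$ with $P$ a program, $\eta$ a valuation, $a\in\mathbb{Q}\cap(0,1]$ and $w\in\{L_n,R_n,L_p,R_p\}^*$; a program state is a pair $(P,\eta)$; states whose program is $\bot$ are terminal. For $f\in\mathbb{F}$, $\to_f$ is the smallest relation on execution states such that: $(v:=e,\eta,a,w)\to_f(\bot,\eta[v\mapsto[\![e]\!]_\eta],a,w)$; if $(P_1,\eta,a,w)\to_f(P_1',\eta',a',w')$ then $(P_1;P_2,\eta,a,w)\to_f(P_1';P_2,\eta',a',w')$; $(\bot;P_2,\eta,a,w)\to_f(P_2,\eta,a,w)$; $(P_1\oplus_pP_2,\eta,a,w)\to_f(P_2,\eta,a,wR_p)$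 if $[\![p]\!]_\eta\le 0$, $\to_f(P_1,\eta,a,wL_p)$ if $[\![p]\!]_\eta\ge1$, and if $0<[\![p]\!]_\eta<1$ both $\to_f(P_1,\eta,a\cdot[\![p]\!]_\eta,wL_p)$ and $\to_f(P_2,\eta,a\cdot(1-[\![p]\!]_\eta),wR_p)$; $(P_1[\!]P_2,\eta,a,w)\to_f(P_1,\eta,a,wL_n)$ if $f(w)=L_n$ and $\to_f(P_2,\eta,a,wR_n)$ if $f(w)=R_n$; $(\mathtt{while}(b)\{P\},\eta,a,w)\to_f(P;\mathtt{while}(b)\{P\},\eta,a,w)$ if $[\![b]\!]_\eta$ is true and $\to_f(\bot,\eta,a,w)$ otherwise. $\to_f^n$ ($n\ge1$) is the $n$-fold composition of $\to_f$. For a program state $\sigma=(P,\eta)$ put $\sigma_e=(P,\eta,1,\varepsilon)$. The initial state of a program $P$ is $\sigma_P=(P,\eta_0)$ where $\eta_0$ maps every variable to $0$. $\mathrm{Prob}((P,\eta,a,w))=a$. For $k\in\mathbb{N}$, $T_{\le k}(\sigma,f)$ is the set of terminal execution states $\tau$ with $\sigma_e\to_f^n\tau$ for some $n\le k$, and $\mathrm{ExpRuntime}(\sigma,f)=\sum_{k\in\mathbb{N}}\big(1-\sum_{\tau\in T_{\le k}(\sigma,f)}\mathrm{Prob}(\tau)\big)\in[0,\infty]$. $\mathsf{PAST}$ is the set of programs $P$ such that for every scheduler $f\in\mathbb{F}$ there is $n\in\mathbb{N}$ with $\mathrm{ExpRuntime}(\sigma_P,f)<n$. Programs are identified with natural numbers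 via a fixed effective encoding; $\Pi^1_1$ is the lightface co-analytic class, and completeness is with respect to recursive many-one reductions. *)

theory Defs
  imports Complex_Main "HOL-Library.Nat_Bijection" "HOL-Library.Extended_Nonnegative_Real"
begin

fun primrec_op :: "(nat list \<Rightarrow> nat) \<Rightarrow> (nat list \<Rightarrow> nat) \<Rightarrow> nat \<Rightarrow> nat list \<Rightarrow> nat" where
  "primrec_op g h 0 ys = g ys"
| "primrec_op g h (Suc k) ys = h (k # primrec_op g h k ys # ys)"

inductive total_rec :: "nat \<Rightarrow> (nat list \<Rightarrow> nat) \<Rightarrow> bool" where
  rec_zero: "total_rec n (\<lambda>_. 0)"
| rec_succ: "total_rec 1 (\<lambda>xs. Suc (hd xs))"
| rec_proj: "i < n \<Longrightarrow> total_rec n (\<lambda>xs. xs ! i)"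
| rec_comp: "total_rec m g \<Longrightarrow> length fs = m \<Longrightarrow> (\<forall>i<m. total_rec n (fs ! i)) \<Longrightarrow>
     total_rec n (\<lambda>xs. g (map (\<lambda>f. f xs) fs))"
| rec_prim: "total_rec n g \<Longrightarrow> total_rec (n + 2) h \<Longrightarrow>
     total_rec (Suc n) (\<lambda>xs. primrec_op g h (hd xs) (tl xs))"
| rec_mu: "total_rec (Suc n) g \<Longrightarrow> (\<forall>ys. length ys = n \<longrightarrow> (\<exists>k. g (k # ys) = 0)) \<Longrightarrow>
     total_rec n (\<lambda>ys. LEAST k. g (k # ys) = 0)"

definition recursive_fun :: "(nat \<Rightarrow> nat) \<Rightarrow> bool" where
  "recursive_fun f \<longleftrightarrow> (\<exists>g. total_rec 1 g \<and> (\<forall>x. g [x] = f x))"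

definition recursive_rel2 :: "(nat \<Rightarrow> nat \<Rightarrow> bool) \<Rightarrow> bool" where
  "recursive_rel2 R \<longleftrightarrow> (\<exists>g. total_rec 2 g \<and> (\<forall>x y. R x y \<longleftrightarrow> g [x, y] = 0))"

text \<open>Lightface \<Pi>^1_1 (Kleene normal form): A = {n. \<forall>f. \<exists>m. R n <f 0, ..., f (m-1)>}
  with R recursive, finite sequences coded by list_encode.\<close>
definition Pi11 :: "nat set \<Rightarrow> bool" where
  "Pi11 A \<longleftrightarrow> (\<exists>R. recursive_rel2 R \<and>
     (\<forall>n. n \<in> A \<longleftrightarrow> (\<forall>f :: nat \<Rightarrow> nat. \<exists>m. R n (list_encode (map f [0..<m])))))"

definition many_one_reducible :: "nat set \<Rightarrow> nat set \<Rightarrow> bool" where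
  "many_one_reducible B A \<longleftrightarrow> (\<exists>g. recursive_fun g \<and> (\<forall>n. n \<in> B \<longleftrightarrow> g n \<in> A))"

definition Pi11_complete :: "nat set \<Rightarrow> bool" where
  "Pi11_complete A \<longleftrightarrow> Pi11 A \<and> (\<forall>B. Pi11 B \<longrightarrow> many_one_reducible B A)"

type_synonym var = nat
type_synonym valuation = "var \<Rightarrow> rat"

datatype aexp = AConst rat | AVar var | AAdd aexp aexp | ASub aexp aexp
  | AMul aexp aexp | ADiv aexp aexp

datatype bexp = BTrue | BFalse | BLess aexp aexp | BLeq aexp aexp | BEq aexp aexp
  | BNot bexp | BAnd bexp bexp | BOr bexp bexp

datatype prog = Bot | Assign var aexp | Seq prog prog | PChoice prog aexp prog
  | NChoice prog prog | While bexp prog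

fun aval :: "aexp \<Rightarrow> valuation \<Rightarrow> rat" where
  "aval (AConst q) \<eta> = q"
| "aval (AVar v) \<eta> = \<eta> v"
| "aval (AAdd a b) \<eta> = aval a \<eta> + aval b \<eta>"
| "aval (ASub a b) \<eta> = aval a \<eta> - aval b \<eta>"
| "aval (AMul a b) \<eta> = aval a \<eta> * aval b \<eta>"
| "aval (ADiv a b) \<eta> = aval a \<eta> / aval b \<eta>"

fun bval :: "bexp \<Rightarrow> valuation \<Rightarrow> bool" where
  "bval BTrue \<eta> = True"
| "bval BFalse \<eta> = False"
| "bval (BLess a b) \<eta> = (aval a \<eta> < aval b \<eta>)"
| "bval (BLeq a b) \<eta> = (aval a \<eta> \<le> aval b \<eta>)"
| "bval (BEq a b) \<eta> = (aval a \<eta> = aval b \<eta>)"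
| "bval (BNot b) \<eta> = (\<not> bval b \<eta>)"
| "bval (BAnd b c) \<eta> = (bval b \<eta> \<and> bval c \<eta>)"
| "bval (BOr b c) \<eta> = (bval b \<eta> \<or> bval c \<eta>)"

datatype dir = Ln | Rn | Lp | Rp

type_synonym scheduler = "dir list \<Rightarrow> dir"

definition schedulers :: "scheduler set" where
  "schedulers = {f. \<forall>w. f w \<in> {Ln, Rn}}"

type_synonym exstate = "prog \<times> valuation \<times> rat \<times> dir list"

inductive step :: "scheduler \<Rightarrow> exstate \<Rightarrow> exstate \<Rightarrow> bool" for f where
  st_assign: "step f (Assign v e, \<eta>, a, w) (Bot, \<eta>(v := aval e \<eta>), a, w)"
| st_seq: "step f (P1, \<eta>, a, w) (P1', \<eta>', a', w') \<Longrightarrow>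
     step f (Seq P1 P2, \<eta>, a, w) (Seq P1' P2, \<eta>', a', w')"
| st_seq_bot: "step f (Seq Bot P2, \<eta>, a, w) (P2, \<eta>, a, w)"
| st_p_le0: "aval p \<eta> \<le> 0 \<Longrightarrow> step f (PChoice P1 p P2, \<eta>, a, w) (P2, \<eta>, a, w @ [Rp])"
| st_p_ge1: "aval p \<eta> \<ge> 1 \<Longrightarrow> step f (PChoice P1 p P2, \<eta>, a, w) (P1, \<eta>, a, w @ [Lp])"
| st_p_left: "0 < aval p \<eta> \<Longrightarrow> aval p \<eta> < 1 \<Longrightarrow>
     step f (PChoice P1 p P2, \<eta>, a, w) (P1, \<eta>, a * aval p \<eta>, w @ [Lp])"
| st_p_right: "0 < aval p \<eta> \<Longrightarrow> aval p \<eta> < 1 \<Longrightarrow>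
     step f (PChoice P1 p P2, \<eta>, a, w) (P2, \<eta>, a * (1 - aval p \<eta>), w @ [Rp])"
| st_n_left: "f w = Ln \<Longrightarrow> step f (NChoice P1 P2, \<eta>, a, w) (P1, \<eta>, a, w @ [Ln])"
| st_n_right: "f w = Rn \<Longrightarrow> step f (NChoice P1 P2, \<eta>, a, w) (P2, \<eta>, a, w @ [Rn])"
| st_while_true: "bval b \<eta> \<Longrightarrow> step f (While b P, \<eta>, a, w) (Seq P (While b P), \<eta>, a, w)"
| st_while_false: "\<not> bval b \<eta> \<Longrightarrow> step f (While b P, \<eta>, a, w) (Bot, \<eta>, a, w)"

definition ex_init :: "prog \<times> valuation \<Rightarrow> exstate" where
  "ex_init \<sigma> = (fst \<sigma>, snd \<sigma>, 1, [])"

definition terminal :: "exstate \<Rightarrow> bool" where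
  "terminal \<tau> \<longleftrightarrow> fst \<tau> = Bot"

definition Prob :: "exstate \<Rightarrow> rat" where
  "Prob \<tau> = fst (snd (snd \<tau>))"

definition T_le :: "nat \<Rightarrow> prog \<times> valuation \<Rightarrow> scheduler \<Rightarrow> exstate set" where
  "T_le k \<sigma> f = {\<tau>. terminal \<tau> \<and> (\<exists>n. 1 \<le> n \<and> n \<le> k \<and> (step f ^^ n) (ex_init \<sigma>) \<tau>)}"

definition ExpRuntime :: "prog \<times> valuation \<Rightarrow> scheduler \<Rightarrow> ennreal" where
  "ExpRuntime \<sigma> f = (\<Sum>k. ennreal (1 - real_of_rat (\<Sum>\<tau>\<in>T_le k \<sigma> f. Prob \<tau>)))"

definition init_state :: "prog \<Rightarrow> prog \<times> valuation" where
  "init_state P = (P, (\<lambda>_. 0))"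

definition PAST :: "prog set" where
  "PAST = {P. \<forall>f\<in>schedulers. \<exists>n::nat. ExpRuntime (init_state P) f < of_nat n}"

definition enc_rat :: "rat \<Rightarrow> nat" where
  "enc_rat q = prod_encode (int_encode (fst (quotient_of q)), nat (snd (quotient_of q)))"

fun enc_aexp :: "aexp \<Rightarrow> nat" where
  "enc_aexp (AConst q) = prod_encode (0, enc_rat q)"
| "enc_aexp (AVar v) = prod_encode (1, v)"
| "enc_aexp (AAdd a b) = prod_encode (2, prod_encode (enc_aexp a, enc_aexp b))"
| "enc_aexp (ASub a b) = prod_encode (3, prod_encode (enc_aexp a, enc_aexp b))"
| "enc_aexp (AMul a b) = prod_encode (4, prod_encode (enc_aexp a, enc_aexp b))"
| "enc_aexp (ADiv a b) = prod_encode (5, prod_encode (enc_aexp a, enc_aexp b))"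

fun enc_bexp :: "bexp \<Rightarrow> nat" where
  "enc_bexp BTrue = prod_encode (0, 0)"
| "enc_bexp BFalse = prod_encode (1, 0)"
| "enc_bexp (BLess a b) = prod_encode (2, prod_encode (enc_aexp a, enc_aexp b))"
| "enc_bexp (BLeq a b) = prod_encode (3, prod_encode (enc_aexp a, enc_aexp b))"
| "enc_bexp (BEq a b) = prod_encode (4, prod_encode (enc_aexp a, enc_aexp b))"
| "enc_bexp (BNot b) = prod_encode (5, enc_bexp b)"
| "enc_bexp (BAnd b c) = prod_encode (6, prod_encode (enc_bexp b, enc_bexp c))"
| "enc_bexp (BOr b c) = prod_encode (7, prod_encode (enc_bexp b, enc_bexp c))"

fun enc_prog :: "prog \<Rightarrow> nat" where
  "enc_prog Bot = prod_encode (0, 0)"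
| "enc_prog (Assign v e) = prod_encode (1, prod_encode (v, enc_aexp e))"
| "enc_prog (Seq P Q) = prod_encode (2, prod_encode (enc_prog P, enc_prog Q))"
| "enc_prog (PChoice P p Q) = prod_encode (3, prod_encode (enc_prog P, prod_encode (enc_aexp p, enc_prog Q)))"
| "enc_prog (NChoice P Q) = prod_encode (4, prod_encode (enc_prog P, enc_prog Q))"
| "enc_prog (While b P) = prod_encode (5, prod_encode (enc_bexp b, enc_prog P))"

definition PAST_codes :: "nat set" where
  "PAST_codes = enc_prog ` PAST"

end

theory Submission
  imports Defs
begin

text \<open>
  Splitting a step into its (at most two) outcomes, the partial sums of the expected runtime obey
  the recursion \<open>V 0 s = 0\<close>, \<open>V (k + 1) s = 1 + p * V k s\<^sub>l + (1 - p) * V k s\<^sub>r\<close>, and \<open>P\<close> is in \<open>PAST\<close>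
  iff for every scheduler these numbers are bounded.

  Membership: quantify universally over an oracle that contains a scheduler, a Skolem function
  \<open>K\<close> choosing for every bound \<open>N\<close> a horizon \<open>K N\<close>, and tables for all auxiliary functions (validity of
  codes, redexes, expression values, the tree of configurations and \<open>V\<close>). Either some entry of a
  table violates its local defining equation, or \<open>V (K N) \<le> N\<close> for some \<open>N\<close>; both are witnessed by a
  finite part of the oracle.

  Hardness: a recursive predicate is compiled to a deterministic program. For a set given by
  \<open>R n\<close> and the prefixes of \<open>\<phi>\<close>, the program guesses \<open>\<phi> 0, \<phi> 1, \<dots>\<close> in unary by nondeterminism and
  stops as soon as \<open>R\<close> holds. Every increment of a guess is accompanied by a coin flip that aborts
  the run, so that guessing forever is cheap; after each completed value the program idles for
  \<open>2 ^ i\<close> steps, where \<open>i\<close> is the number of flips survived, so that each value contributes at least 1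
  to the expected runtime and an infinite sequence without \<open>R\<close> makes it infinite.
\<close>

section \<open>Expected runtime as a recursively defined cost\<close>

text \<open>In \<open>PAST\<close> the bound may depend on the scheduler: for every \<open>f\<close>
  there is \<open>N\<close> such that for all \<open>k\<close> the truncated cost is at most
  \<open>N\<close>. The normal form has no room for the quantifier over \<open>k\<close>. Refuting
  every \<open>N\<close> amounts to a function \<open>K\<close> of refuting horizons; quantified
  universally next to \<open>f\<close>, it leaves a single existential number quantifier, over
  \<open>N\<close>. For hardness the obstacle is that binary nondeterminism cannot select an
  arbitrary number without admitting an infinite run; the coin flips give that run finite expected
  length. Since an aborted run leaves the loop after one further step, a scheduler matters only
  along the surviving branch, where it describes a single sequence. The sequence is kept reversed
  because adding an entry is then one pairing, a polynomial expression, whereas appending at the end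
  would need a program of its own.\<close>

type_synonym pstate = "prog \<times> valuation \<times> dir list"

text \<open>A step acts at the end of the left spine of \<open>Seq\<close>. Splitting a program
  there into redex and context replaces the recursive rule for \<open>Seq\<close> by one case
  analysis, which the oracle tables can imitate.\<close>

fun redex :: "prog \<Rightarrow> prog" where
  "redex (Seq P Q) = (if P = Bot then Seq P Q else redex P)"
| "redex P = P"

fun plug :: "prog \<Rightarrow> prog \<Rightarrow> prog" where
  "plug (Seq P Q) X = (if P = Bot then X else Seq (plug P X) Q)"
| "plug P X = X"

fun contract :: "scheduler \<Rightarrow> bool \<Rightarrow> prog \<Rightarrow> valuation \<Rightarrow> dir list \<Rightarrow> pstate" where
  "contract f l Bot \<eta> w = (Bot, \<eta>, w)"
| "contract f l (Assign v e) \<eta> w = (Bot, \<eta>(v := aval e \<eta>), w)"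
| "contract f l (Seq P Q) \<eta> w = (Q, \<eta>, w)"
| "contract f l (PChoice P p Q) \<eta> w = (if l then (P, \<eta>, w @ [Lp]) else (Q, \<eta>, w @ [Rp]))"
| "contract f l (NChoice P Q) \<eta> w = (if f w = Ln then (P, \<eta>, w @ [Ln]) else (Q, \<eta>, w @ [Rn]))"
| "contract f l (While b P) \<eta> w = (if bval b \<eta> then Seq P (While b P) else Bot, \<eta>, w)"

fun succ :: "scheduler \<Rightarrow> bool \<Rightarrow> pstate \<Rightarrow> pstate" where
  "succ f l (P, \<eta>, w) = (case contract f l (redex P) \<eta> w of (X, \<eta>', w') \<Rightarrow> (plug P X, \<eta>', w'))"

fun lprob_redex :: "prog \<Rightarrow> valuation \<Rightarrow> rat" where
  "lprob_redex (PChoice P p Q) \<eta> = max 0 (min 1 (aval p \<eta>))"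
| "lprob_redex _ \<eta> = 1"

text \<open>Every nonterminal state gets two successors; unless the redex is a genuine probabilistic choice,
  one of them has probability 0.\<close>

definition lprob :: "prog \<Rightarrow> valuation \<Rightarrow> rat" where
  "lprob P \<eta> = lprob_redex (redex P) \<eta>"

text \<open>The probability of not having terminated after \<open>j\<close> steps; for programs
  other than \<open>Bot\<close> these are the summands of \<open>ExpRuntime\<close>.\<close>

fun live :: "scheduler \<Rightarrow> nat \<Rightarrow> pstate \<Rightarrow> rat" where
  "live f 0 (P, \<eta>, w) = of_bool (P \<noteq> Bot)"
| "live f (Suc j) (P, \<eta>, w) = (if P = Bot then 0 else
     lprob P \<eta> * live f j (succ f True (P, \<eta>, w))
     + (1 - lprob P \<eta>) * live f j (succ f False (P, \<eta>, w)))"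

text \<open>The expected number of steps among the first \<open>k\<close>. Truncation keeps the
  values rational and the recursion local, so tables and time bounds deal with equations on
  \<open>rat\<close> instead of infinite sums.\<close>

fun cost :: "scheduler \<Rightarrow> nat \<Rightarrow> pstate \<Rightarrow> rat" where
  "cost f 0 s = 0"
| "cost f (Suc k) (P, \<eta>, w) = (if P = Bot then 0 else 1 +
     lprob P \<eta> * cost f k (succ f True (P, \<eta>, w))
     + (1 - lprob P \<eta>) * cost f k (succ f False (P, \<eta>, w)))"

lemma lprob_bounds: "0 \<le> lprob P \<eta>" "lprob P \<eta> \<le> 1"
  by (cases "redex P"; simp add: lprob_def)+

lemma lprob_Seq: "P \<noteq> Bot \<Longrightarrow> lprob (Seq P Q) \<eta> = lprob P \<eta>"
  by (simp add: lprob_def)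

lemma lprob_Seq_Bot [simp]: "lprob (Seq Bot Q) \<eta> = 1"
  by (simp add: lprob_def)

lemma live_Bot [simp]: "live f j (Bot, \<eta>, w) = 0"
  by (cases j) auto

lemma cost_eq_sum_live: "cost f k s = (\<Sum>j<k. live f j s)"
proof (induction k arbitrary: s)
  case (Suc k)
  obtain P \<eta> w where s: "s = (P, \<eta>, w)" by (cases s)
  show ?case
  proof (cases "P = Bot")
    case True
    then show ?thesis by (simp add: s)
  next
    case False
    have "(\<Sum>j<Suc k. live f j s) = live f 0 s + (\<Sum>j<k. live f (Suc j) s)"
      by (rule sum.lessThan_Suc_shift)
    also have "\<dots> = cost f (Suc k) s"
      using False by (simp add: s Suc.IH sum.distrib sum_distrib_left del: succ.simps)
    finally show ?thesis by simp
  qed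
qed simp

lemma live_bounds: "0 \<le> live f j s \<and> live f j s \<le> 1"
proof (induction j arbitrary: s)
  case 0
  then show ?case by (cases s) auto
next
  case (Suc j)
  obtain P \<eta> w where s: "s = (P, \<eta>, w)" by (cases s)
  let ?a = "live f j (succ f True s)" and ?b = "live f j (succ f False s)" and ?p = "lprob P \<eta>"
  have p: "0 \<le> ?p" "?p \<le> 1" by (rule lprob_bounds)+
  have "0 \<le> ?p * ?a" "0 \<le> (1 - ?p) * ?b" using p Suc by simp_all
  moreover have "?p * ?a + (1 - ?p) * ?b \<le> 1"
    using Suc p by (intro convex_bound_le) auto
  ultimately show ?case by (simp add: s del: succ.simps)
qed

lemma step_Seq_iff:
  "step f (Seq P Q, \<eta>, a, w) \<tau> \<longleftrightarrow> (P = Bot \<and> \<tau> = (Q, \<eta>, a, w)) \<or>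
     (\<exists>P' \<eta>' a' w'. step f (P, \<eta>, a, w) (P', \<eta>', a', w') \<and> \<tau> = (Seq P' Q, \<eta>', a', w'))"
  by (auto elim: step.cases intro: step.intros)

lemma step_Bot [simp]: "\<not> step f (Bot, \<eta>, a, w) \<tau>"
  by (auto elim: step.cases)

fun weighted :: "rat \<Rightarrow> pstate \<Rightarrow> exstate" where
  "weighted a (P, \<eta>, w) = (P, \<eta>, a, w)"

text \<open>Clamping the probability to the unit interval merges the four rules for
  \<open>PChoice\<close>; the strict inequalities discard successors of weight 0. The hypothesis on
  \<open>f\<close> enters at \<open>NChoice\<close>: for a value other than \<open>Ln\<close> and
  \<open>Rn\<close> no rule applies, while \<open>contract\<close> would go right.\<close>

lemma step_iff:
  assumes "f \<in> schedulers"
  shows "step f (P, \<eta>, a, w) \<tau> \<longleftrightarrow> P \<noteq> Bot \<and>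
     (lprob P \<eta> > 0 \<and> \<tau> = weighted (a * lprob P \<eta>) (succ f True (P, \<eta>, w)) \<or>
      lprob P \<eta> < 1 \<and> \<tau> = weighted (a * (1 - lprob P \<eta>)) (succ f False (P, \<eta>, w)))"
proof (induction P arbitrary: \<tau>)
  case Bot
  then show ?case by simp
next
  case (Assign v e)
  then show ?case by (auto simp: lprob_def elim: step.cases intro: step.intros)
next
  case (Seq P Q)
  show ?case
  proof (cases "P = Bot")
    case True
    then show ?thesis by (auto simp: step_Seq_iff)
  next
    case False
    then show ?thesis
      by (auto simp: step_Seq_iff Seq.IH(1) lprob_Seq split: prod.splits)
  qed
next
  case (PChoice P p Q)
  consider "aval p \<eta> \<le> 0" | "0 < aval p \<eta>" "aval p \<eta> < 1" | "1 \<le> aval p \<eta>" by linarith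
  then show ?case
    by cases (auto simp: lprob_def max_def min_def elim: step.cases intro: step.intros)
next
  case (NChoice P Q)
  have "f w = Ln \<or> f w = Rn" using assms by (auto simp: schedulers_def)
  then show ?case
    by (auto simp: lprob_def elim: step.cases intro: step.intros)
next
  case (While b P)
  then show ?case
    by (auto simp: lprob_def elim: step.cases intro: step.intros)
qed

text \<open>Unlike \<open>T_le\<close> it admits zero steps and an arbitrary initial weight, so that
  the first step can be split off in an induction.\<close>

definition term_in :: "scheduler \<Rightarrow> nat \<Rightarrow> rat \<Rightarrow> pstate \<Rightarrow> exstate set" where
  "term_in f j a s = {\<tau>. terminal \<tau> \<and> (\<exists>n\<le>j. (step f ^^ n) (weighted a s) \<tau>)}"

lemma relpowp_Bot: "(step f ^^ n) (Bot, \<eta>, a, w) \<tau> \<longleftrightarrow> n = 0 \<and> \<tau> = (Bot, \<eta>, a, w)"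
  by (cases n) (auto dest!: relpowp_Suc_D2 simp del: relpowp.simps(2))

lemma term_in_Bot: "term_in f j a (Bot, \<eta>, w) = {(Bot, \<eta>, a, w)}"
  by (auto simp: term_in_def terminal_def relpowp_Bot)

lemma term_in_Suc:
  fixes P \<eta> defines "p \<equiv> lprob P \<eta>"
  assumes "f \<in> schedulers" "P \<noteq> Bot"
  shows "term_in f (Suc j) a (P, \<eta>, w) =
     (if p > 0 then term_in f j (a * p) (succ f True (P, \<eta>, w)) else {}) \<union>
     (if p < 1 then term_in f j (a * (1 - p)) (succ f False (P, \<eta>, w)) else {})"
    (is "?L = ?R")
proof (intro equalityI subsetI)
  fix \<tau> assume "\<tau> \<in> ?L"
  then obtain n where n: "terminal \<tau>" "n \<le> Suc j" "(step f ^^ n) (P, \<eta>, a, w) \<tau>"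
    by (auto simp: term_in_def)
  with assms(3) obtain m where m: "n = Suc m" by (cases n) (auto simp: terminal_def)
  then obtain \<sigma> where "step f (P, \<eta>, a, w) \<sigma>" "(step f ^^ m) \<sigma> \<tau>"
    using n(3) relpowp_Suc_D2 by meson
  then show "\<tau> \<in> ?R"
    using n m unfolding step_iff[OF assms(2)] p_def by (auto simp: term_in_def simp del: succ.simps)
next
  fix \<tau> assume "\<tau> \<in> ?R"
  then consider "p > 0" "\<tau> \<in> term_in f j (a * p) (succ f True (P, \<eta>, w))"
    | "p < 1" "\<tau> \<in> term_in f j (a * (1 - p)) (succ f False (P, \<eta>, w))"
    by (auto split: if_splits)
  then have "\<exists>\<sigma>. step f (P, \<eta>, a, w) \<sigma> \<and> terminal \<tau> \<and> (\<exists>n\<le>j. (step f ^^ n) \<sigma> \<tau>)"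
    using assms(3) unfolding step_iff[OF assms(2)] p_def term_in_def
    by cases blast+
  then obtain \<sigma> n where "terminal \<tau>" "Suc n \<le> Suc j" "(step f ^^ Suc n) (P, \<eta>, a, w) \<tau>"
    by (meson relpowp_Suc_I2 Suc_le_mono)
  then show "\<tau> \<in> ?L"
    unfolding term_in_def weighted.simps by blast
qed

fun history :: "exstate \<Rightarrow> dir list" where
  "history (P, \<eta>, a, w) = w"

lemma succ_history: "\<exists>u. snd (snd (succ f l (P, \<eta>, w))) = w @ u"
  by (cases "redex P") auto

lemma succ_history_choice:
  "lprob P \<eta> \<noteq> 1 \<Longrightarrow> snd (snd (succ f l (P, \<eta>, w))) = w @ [if l then Lp else Rp]"
  by (cases "redex P") (auto simp: lprob_def)

text \<open>Histories only grow, so the letter recorded at a genuine probabilistic choice separates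
  the terminal states of the two branches for good.\<close>

lemma term_in_history:
  assumes "f \<in> schedulers" "\<tau> \<in> term_in f j a s"
  shows "\<exists>u. history \<tau> = snd (snd s) @ u"
  using assms(2)
proof (induction j arbitrary: a s)
  case 0
  then show ?case by (cases s) (auto simp: term_in_def)
next
  case (Suc j)
  obtain P \<eta> w where s: "s = (P, \<eta>, w)" by (cases s)
  show ?case
  proof (cases "P = Bot")
    case True
    then show ?thesis using Suc.prems by (auto simp: s term_in_Bot)
  next
    case False
    then obtain l b where "\<tau> \<in> term_in f j b (succ f l s)"
      using Suc.prems by (auto simp: s term_in_Suc[OF assms(1)] simp del: succ.simps split: if_splits)
    from Suc.IH[OF this] succ_history[of f l P \<eta> w] show ?thesis by (auto simp: s simp del: succ.simps)
  qed
qed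

text \<open>As \<open>T_le\<close> is a set, a terminal state reached along two branches would be
  counted once; the recorded histories rule this out. Finiteness is carried along because a sum over
  an infinite set is 0 by convention.\<close>

lemma term_in_mass:
  assumes "f \<in> schedulers"
  shows "finite (term_in f j a s) \<and> (\<Sum>\<tau>\<in>term_in f j a s. Prob \<tau>) = a * (1 - live f j s)"
proof (induction j arbitrary: a s)
  case 0
  obtain P \<eta> w where s: "s = (P, \<eta>, w)" by (cases s)
  have "term_in f 0 a s = (if P = Bot then {(P, \<eta>, a, w)} else {})"
    by (auto simp: term_in_def s terminal_def)
  then show ?case by (auto simp: s Prob_def)
next
  case (Suc j)
  obtain P \<eta> w where s: "s = (P, \<eta>, w)" by (cases s)
  show ?case
  proof (cases "P = Bot")
    case True
    then show ?thesis by (simp add: s term_in_Bot Prob_def)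
  next
    case False
    let ?p = "lprob P \<eta>"
    let ?A = "term_in f j (a * ?p) (succ f True s)"
    let ?B = "term_in f j (a * (1 - ?p)) (succ f False s)"
    have fin: "finite ?A" "finite ?B"
      and sums: "sum Prob ?A = a * ?p * (1 - live f j (succ f True s))"
        "sum Prob ?B = a * (1 - ?p) * (1 - live f j (succ f False s))"
      using Suc.IH by auto
    have T: "term_in f (Suc j) a s = (if ?p > 0 then ?A else {}) \<union> (if ?p < 1 then ?B else {})"
      unfolding s by (rule term_in_Suc[OF assms False])
    consider "?p = 0" | "?p = 1" | "0 < ?p" "?p < 1"
      using lprob_bounds[of P \<eta>] by linarith
    then show ?thesis
    proof cases
      case 3
      have "?A \<inter> ?B = {}"
      proof (rule ccontr)
        assume "?A \<inter> ?B \<noteq> {}"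
        then obtain \<tau> where "\<tau> \<in> ?A" "\<tau> \<in> ?B" by blast
        from this[THEN term_in_history[OF assms]] 3 show False
          by (auto simp: s succ_history_choice simp del: succ.simps)
      qed
      then show ?thesis using 3 False fin sums T
        by (simp add: sum.union_disjoint s del: succ.simps) (simp add: algebra_simps)
    qed (use False fin sums T in \<open>auto simp: s simp del: succ.simps\<close>)
  qed
qed

lemma T_le_eq: "P \<noteq> Bot \<Longrightarrow> T_le k (P, \<eta>) f = term_in f k 1 (P, \<eta>, [])"
  unfolding T_le_def term_in_def ex_init_def
  by (auto simp: terminal_def Suc_le_eq) (metis fst_conv gr0I relpowp_0_E)

lemma ExpRuntime_eq:
  assumes "f \<in> schedulers" "P \<noteq> Bot"
  shows "ExpRuntime (P, \<eta>) f = (\<Sum>k. ennreal (real_of_rat (live f k (P, \<eta>, []))))"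
  using term_in_mass[OF assms(1)] by (simp add: ExpRuntime_def T_le_eq[OF assms(2)] of_rat_diff)

text \<open>The truncated costs are the partial sums of the runtime, which is therefore their
  supremum.\<close>

lemma ExpRuntime_finite_iff:
  assumes "f \<in> schedulers" "P \<noteq> Bot"
  shows "(\<exists>n::nat. ExpRuntime (P, \<eta>) f < of_nat n) \<longleftrightarrow>
    (\<exists>N::nat. \<forall>k. cost f k (P, \<eta>, []) \<le> of_nat N)"
proof -
  let ?l = "\<lambda>k. real_of_rat (live f k (P, \<eta>, []))"
  have part: "(\<Sum>j<k. ennreal (?l j)) = ennreal (real_of_rat (cost f k (P, \<eta>, [])))" for k
    by (subst sum_ennreal) (auto simp: live_bounds cost_eq_sum_live of_rat_sum)
  have sup: "ExpRuntime (P, \<eta>) f = (SUP k. ennreal (real_of_rat (cost f k (P, \<eta>, []))))"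
    unfolding ExpRuntime_eq[OF assms] by (subst suminf_eq_SUP) (simp_all only: part)
  have iff: "ennreal (real_of_rat (cost f k (P, \<eta>, []))) \<le> of_nat N \<longleftrightarrow> cost f k (P, \<eta>, []) \<le> of_nat N" for k N
    by (metis ennreal_le_iff ennreal_of_nat_eq_real_of_nat of_nat_0_le_iff of_rat_less_eq of_rat_of_nat_eq)
  show ?thesis
  proof
    assume "\<exists>n::nat. ExpRuntime (P, \<eta>) f < of_nat n"
    then obtain n :: nat where "ExpRuntime (P, \<eta>) f \<le> of_nat n" by (meson less_imp_le)
    then show "\<exists>N::nat. \<forall>k. cost f k (P, \<eta>, []) \<le> of_nat N"
      unfolding sup SUP_le_iff iff by blast
  next
    assume "\<exists>N::nat. \<forall>k. cost f k (P, \<eta>, []) \<le> of_nat N"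
    then obtain N :: nat where "ExpRuntime (P, \<eta>) f \<le> of_nat N"
      unfolding sup SUP_le_iff iff by blast
    also have "\<dots> < of_nat (Suc N)"
      by (metis ennreal_less_iff ennreal_of_nat_eq_real_of_nat lessI of_nat_0_le_iff of_nat_less_iff)
    finally show "\<exists>n::nat. ExpRuntime (P, \<eta>) f < of_nat n" by blast
  qed
qed

text \<open>Terminal states count only after at least one step and \<open>Bot\<close> has no step,
  so every summand of its runtime is 1.\<close>

lemma Bot_not_PAST: "Bot \<notin> PAST"
proof
  assume "Bot \<in> PAST"
  moreover have "(\<lambda>_. Ln) \<in> schedulers" by (simp add: schedulers_def)
  ultimately obtain n :: nat where "ExpRuntime (init_state Bot) (\<lambda>_. Ln) < of_nat n"
    by (auto simp: PAST_def)
  moreover have "T_le k (init_state Bot) f = {}" for k f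
    by (auto simp: T_le_def init_state_def ex_init_def relpowp_Bot)
  then have "ExpRuntime (init_state Bot) (\<lambda>_. Ln) = (\<Sum>k. 1)"
    by (simp add: ExpRuntime_def)
  moreover have "(\<Sum>k. 1::ennreal) = top" 
    by (simp add: suminf_eq_SUP flip: of_nat_sum) (auto intro: ennreal_Ex_less_of_nat)
  ultimately show False by simp
qed

lemma PAST_iff:
  "P \<in> PAST \<longleftrightarrow> P \<noteq> Bot \<and>
    (\<forall>f\<in>schedulers. \<exists>N::nat. \<forall>k. cost f k (P, \<lambda>_. 0, []) \<le> of_nat N)"
  using Bot_not_PAST by (cases "P = Bot") (auto simp: PAST_def init_state_def ExpRuntime_finite_iff)

section \<open>Total recursive functions and recursive functionals\<close>

text \<open>\<open>total_rec\<close> fixes a function on lists of every length. Comparing only lists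
  of length \<open>n\<close> frees later proofs from the values its constructors happen to take
  elsewhere.\<close>

definition trec :: "nat \<Rightarrow> (nat list \<Rightarrow> nat) \<Rightarrow> bool" where
  "trec n F \<longleftrightarrow> (\<exists>g. total_rec n g \<and> (\<forall>xs. length xs = n \<longrightarrow> g xs = F xs))"

definition rec1 :: "(nat \<Rightarrow> nat) \<Rightarrow> bool" where
  "rec1 f \<longleftrightarrow> trec 1 (\<lambda>xs. f (xs ! 0))"

definition rec2 :: "(nat \<Rightarrow> nat \<Rightarrow> nat) \<Rightarrow> bool" where
  "rec2 f \<longleftrightarrow> trec 2 (\<lambda>xs. f (xs ! 0) (xs ! 1))"

definition rec3 :: "(nat \<Rightarrow> nat \<Rightarrow> nat \<Rightarrow> nat) \<Rightarrow> bool" where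
  "rec3 f \<longleftrightarrow> trec 3 (\<lambda>xs. f (xs ! 0) (xs ! 1) (xs ! 2))"

lemma trec_proj: "i < n \<Longrightarrow> trec n (\<lambda>xs. xs ! i)"
  unfolding trec_def using rec_proj by blast

lemma trec_zero: "trec n (\<lambda>xs. 0)"
  unfolding trec_def using rec_zero by blast

lemma trec_comp:
  assumes "trec m G" "length Fs = m" "\<And>i. i < m \<Longrightarrow> trec n (Fs ! i)"
  shows "trec n (\<lambda>xs. G (map (\<lambda>F. F xs) Fs))"
proof -
  obtain g where g: "total_rec m g" "\<And>xs. length xs = m \<Longrightarrow> g xs = G xs"
    using assms(1) by (auto simp: trec_def)
  have "\<forall>i\<in>{..<m}. \<exists>f. total_rec n f \<and> (\<forall>xs. length xs = n \<longrightarrow> f xs = (Fs ! i) xs)"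
    using assms(3) by (auto simp: trec_def)
  then obtain f where f: "\<And>i. i < m \<Longrightarrow> total_rec n (f i)"
    "\<And>i xs. i < m \<Longrightarrow> length xs = n \<Longrightarrow> f i xs = (Fs ! i) xs"
    by (auto dest!: bchoice)
  let ?g = "\<lambda>xs. g (map (\<lambda>F. F xs) (map f [0..<m]))"
  have "total_rec n ?g"
    by (rule rec_comp[OF g(1)]) (auto simp: f)
  moreover have "?g xs = G (map (\<lambda>F. F xs) Fs)" if "length xs = n" for xs
  proof -
    have "map (\<lambda>F. F xs) (map f [0..<m]) = map (\<lambda>F. F xs) Fs"
      using assms(2) by (auto intro!: nth_equalityI simp: f that)
    then show ?thesis using assms(2) by (simp add: g(2))
  qed
  ultimately show ?thesis
    unfolding trec_def by blast
qed

lemma trec_rec1: "rec1 f \<Longrightarrow> trec n A \<Longrightarrow> trec n (\<lambda>xs. f (A xs))"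
  unfolding rec1_def by (drule trec_comp[where Fs = "[A]" and n = n]) auto

lemma trec_rec2: "rec2 f \<Longrightarrow> trec n A \<Longrightarrow> trec n B \<Longrightarrow> trec n (\<lambda>xs. f (A xs) (B xs))"
  unfolding rec2_def
  by (drule trec_comp[where Fs = "[A, B]" and n = n]) (auto simp: less_2_cases_iff)

lemma trec_rec3:
  "rec3 f \<Longrightarrow> trec n A \<Longrightarrow> trec n B \<Longrightarrow> trec n C \<Longrightarrow> trec n (\<lambda>xs. f (A xs) (B xs) (C xs))"
  unfolding rec3_def
  by (drule trec_comp[where Fs = "[A, B, C]" and n = n])
     (auto simp: numeral_3_eq_3 less_Suc_eq numeral_2_eq_2)

lemma rec1_Suc: "rec1 Suc"
  unfolding rec1_def trec_def
  by (rule exI[of _ "\<lambda>xs. Suc (hd xs)"]) (auto simp: rec_succ[simplified] length_Suc_conv)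

lemma trec_Suc: "trec n A \<Longrightarrow> trec n (\<lambda>xs. Suc (A xs))"
  by (rule trec_rec1[OF rec1_Suc])

lemma trec_const: "trec n (\<lambda>xs. k)"
  by (induction k) (auto intro: trec_zero trec_Suc)

lemma trec_primrec:
  assumes "trec n G" "trec (n + 2) H"
    and "\<And>ys. length ys = n \<Longrightarrow> F (0 # ys) = G ys"
    and "\<And>k ys. length ys = n \<Longrightarrow> F (Suc k # ys) = H (k # F (k # ys) # ys)"
  shows "trec (Suc n) F"
proof -
  obtain g where g: "total_rec n g" "\<And>xs. length xs = n \<Longrightarrow> g xs = G xs"
    using assms(1) by (auto simp: trec_def)
  obtain h where h: "total_rec (n + 2) h" "\<And>xs. length xs = n + 2 \<Longrightarrow> h xs = H xs"
    using assms(2) by (auto simp: trec_def)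
  have "primrec_op g h k ys = F (k # ys)" if "length ys = n" for k ys
    using that by (induction k) (auto simp: g h assms(3,4))
  then have "\<forall>xs. length xs = Suc n \<longrightarrow> primrec_op g h (hd xs) (tl xs) = F xs"
    by (auto simp: length_Suc_conv)
  then show ?thesis unfolding trec_def using rec_prim[OF g(1) h(1)] by blast
qed

lemma rec1_primrec:
  assumes "rec2 h" "\<And>k. F (Suc k) = h k (F k)"
  shows "rec1 F"
  unfolding rec1_def One_nat_def
  by (rule trec_primrec[where G = "\<lambda>_. F 0" and H = "\<lambda>xs. h (xs ! 0) (xs ! 1)"])
     (use assms in \<open>auto intro: trec_const simp: rec2_def numeral_2_eq_2\<close>)

lemma rec2_primrec:
  assumes "rec1 g" "rec3 h" "\<And>y. F 0 y = g y" "\<And>k y. F (Suc k) y = h k (F k y) y"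
  shows "rec2 F"
  unfolding rec2_def Suc_1[symmetric]
  by (rule trec_primrec[where G = "\<lambda>xs. g (xs ! 0)" and H = "\<lambda>xs. h (xs ! 0) (xs ! 1) (xs ! 2)"])
     (use assms in \<open>auto simp: rec1_def rec3_def numeral_3_eq_3 numeral_2_eq_2\<close>)

lemma rec3_primrec:
  assumes "rec2 g" "trec 4 (\<lambda>xs. h (xs ! 0) (xs ! 1) (xs ! 2) (xs ! 3))"
    and "\<And>y z. F 0 y z = g y z" "\<And>k y z. F (Suc k) y z = h k (F k y z) y z"
  shows "rec3 F"
  unfolding rec3_def numeral_3_eq_3
  by (rule trec_primrec[where G = "\<lambda>xs. g (xs ! 0) (xs ! 1)" and
        H = "\<lambda>xs. h (xs ! 0) (xs ! 1) (xs ! 2) (xs ! 3)"])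
     (use assms in \<open>auto simp: rec2_def numeral_3_eq_3 numeral_2_eq_2 eval_nat_numeral\<close>)

lemma rec1_mu:
  assumes "rec2 g" "\<And>y. \<exists>k. g k y = 0"
  shows "rec1 (\<lambda>y. LEAST k. g k y = 0)"
proof -
  obtain q where q: "total_rec 2 q" "\<And>xs. length xs = 2 \<Longrightarrow> q xs = g (xs ! 0) (xs ! 1)"
    using assms(1) by (auto simp: rec2_def trec_def)
  have eq: "q (k # xs) = g k (xs ! 0)" if "length xs = 1" for k xs
    using that by (simp add: q(2))
  have "total_rec 1 (\<lambda>xs. LEAST k. q (k # xs) = 0)"
    by (rule rec_mu) (use q(1) assms(2) in \<open>auto simp: eq numeral_2_eq_2\<close>)
  then show ?thesis unfolding rec1_def trec_def by (intro exI conjI) (auto simp: eq)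
qed

lemma rec1I: "trec 1 (\<lambda>xs. f (xs ! 0)) \<Longrightarrow> rec1 f"
  by (simp add: rec1_def)

lemma rec2I: "trec 2 (\<lambda>xs. f (xs ! 0) (xs ! 1)) \<Longrightarrow> rec2 f"
  by (simp add: rec2_def)

lemma rec3I: "trec 3 (\<lambda>xs. f (xs ! 0) (xs ! 1) (xs ! 2)) \<Longrightarrow> rec3 f"
  by (simp add: rec3_def)

lemmas trec_basic = trec_proj trec_const trec_Suc

lemma rec2_add: "rec2 (+)"
  by (rule rec2_primrec[where g = "\<lambda>y. y" and h = "\<lambda>k r y. Suc r"])
     (auto intro!: rec1I rec3I trec_basic)

lemmas trec_add = trec_rec2[OF rec2_add]

lemma rec2_mult: "rec2 (*)"
  by (rule rec2_primrec[where g = "\<lambda>y. 0" and h = "\<lambda>k r y. y + r"])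
     (auto intro!: rec1I rec3I trec_basic trec_add)

lemmas trec_mult = trec_rec2[OF rec2_mult]

lemma rec1_pred: "rec1 (\<lambda>x. x - Suc 0)"
  by (rule rec1_primrec[where h = "\<lambda>k r. k"]) (auto intro!: rec2I trec_basic)

lemma rec2_minus: "rec2 (-)"
proof -
  \<comment> \<open>The recursion runs on the subtrahend, so the arguments have to be swapped
    afterwards.\<close>
  have "rec2 (\<lambda>k y. y - k)"
    by (rule rec2_primrec[where g = "\<lambda>y. y" and h = "\<lambda>k r y. r - Suc 0"])
       (auto intro!: rec1I rec3I trec_basic trec_rec1[OF rec1_pred])
  note this' = trec_rec2[OF this]
  show ?thesis
    by (intro rec2I this' trec_basic) auto
qed

lemmas trec_minus = trec_rec2[OF rec2_minus]

lemma rec3_if: "rec3 (\<lambda>c a b. if c = 0 then a else b)"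
  by (rule rec3_primrec[where g = "\<lambda>a b. a" and h = "\<lambda>k r a b. b"])
     (auto intro!: rec2I trec_basic)

lemmas trec_if = trec_rec3[OF rec3_if]

lemma rec1_triangle: "rec1 triangle"
  by (rule rec1_primrec[where h = "\<lambda>k r. r + Suc k"]) (auto intro!: rec2I trec_basic trec_add)

lemmas trec_triangle = trec_rec1[OF rec1_triangle]

lemma trec_prod_encode: "trec n A \<Longrightarrow> trec n B \<Longrightarrow> trec n (\<lambda>xs. prod_encode (A xs, B xs))"
  unfolding prod_encode_def by (auto intro!: trec_add trec_triangle)

definition pfst :: "nat \<Rightarrow> nat" where
  "pfst z = fst (prod_decode z)"

definition psnd :: "nat \<Rightarrow> nat" where
  "psnd z = snd (prod_decode z)"

lemma pfst_prod_encode [simp]: "pfst (prod_encode (a, b)) = a"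
  by (simp add: pfst_def)

lemma psnd_prod_encode [simp]: "psnd (prod_encode (a, b)) = b"
  by (simp add: psnd_def)

lemma prod_encode_pfst_psnd [simp]: "prod_encode (pfst z, psnd z) = z"
  by (simp add: pfst_def psnd_def)

lemma triangle_mono: "a \<le> b \<Longrightarrow> triangle a \<le> triangle b"
  by (rule lift_Suc_mono_le) auto

text \<open>The pairing is \<open>z = triangle (a + b) + a\<close>, so \<open>a + b\<close> is the
  least \<open>k\<close> with \<open>z < triangle (k + 1)\<close>, found by minimization; both
  components follow by subtraction.\<close>

lemma rec1_pfst: "rec1 pfst" and rec1_psnd: "rec1 psnd"
proof -
  define r where "r z = (LEAST k. Suc z - triangle (Suc k) = 0)" for z
  have ex: "\<exists>k. Suc z - triangle (Suc k) = 0" for z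
    by (rule exI[of _ z]) simp
  have "rec1 r"
    unfolding r_def
    by (rule rec1_mu[OF _ ex]) (intro rec2I trec_minus trec_basic trec_triangle; simp)
  note r' = trec_rec1[OF this]
  have r: "r (prod_encode (a, b)) = a + b" for a b
    unfolding r_def
  proof (rule Least_equality)
    show "Suc (prod_encode (a, b)) - triangle (Suc (a + b)) = 0"
      by (simp add: prod_encode_def)
    fix k assume "Suc (prod_encode (a, b)) - triangle (Suc k) = 0"
    then have "triangle (a + b) < triangle (Suc k)"
      by (simp add: prod_encode_def)
    then show "a + b \<le> k"
      using triangle_mono[of "Suc k" "a + b"] by linarith
  qed
  have pfst_eq: "pfst = (\<lambda>z. z - triangle (r z))"
  proof
    show "pfst z = z - triangle (r z)" for z
    proof -
      obtain a b where z: "z = prod_encode (a, b)" by (metis prod_encode_pfst_psnd)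
      show ?thesis unfolding z r pfst_prod_encode by (simp add: prod_encode_def)
    qed
  qed
  show pf: "rec1 pfst"
    unfolding pfst_eq by (intro rec1I trec_minus trec_triangle r' trec_proj; simp)
  have psnd_eq: "psnd = (\<lambda>z. r z - pfst z)"
  proof
    show "psnd z = r z - pfst z" for z
    proof -
      obtain a b where z: "z = prod_encode (a, b)" by (metis prod_encode_pfst_psnd)
      show ?thesis unfolding z r by simp
    qed
  qed
  show "rec1 psnd"
    unfolding psnd_eq by (intro rec1I trec_minus r' trec_rec1[OF pf] trec_proj; simp)
qed

lemmas trec_pfst = trec_rec1[OF rec1_pfst]
lemmas trec_psnd = trec_rec1[OF rec1_psnd]

lemmas trec_intros = trec_basic trec_add trec_mult trec_minus trec_if trec_prod_encode
  trec_pfst trec_psnd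

section \<open>Recursive operations on coded lists\<close>

fun drop_code :: "nat \<Rightarrow> nat \<Rightarrow> nat" where
  "drop_code 0 s = s"
| "drop_code (Suc i) s = psnd (drop_code i s - 1)"

lemma rec2_drop_code: "rec2 drop_code"
  by (rule rec2_primrec[where g = "\<lambda>s. s" and h = "\<lambda>k r s. psnd (r - 1)"])
     (auto intro!: rec1I rec3I trec_intros)

text \<open>Makes 0, the code of the empty list, its own tail, so that dropping beyond the end stays
  at 0.\<close>

lemma psnd_0: "psnd 0 = 0"
  using psnd_prod_encode[of 0 0] unfolding prod_encode_def by simp

lemma drop_code_list_encode: "drop_code i (list_encode xs) = list_encode (drop i xs)"
proof (induction i)
  case (Suc i)
  have "psnd (list_encode ys - 1) = list_encode (tl ys)" for ys
    by (cases ys) (simp_all add: psnd_0)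
  then show ?case by (simp add: Suc drop_Suc tl_drop)
qed simp

text \<open>The entry is returned with its successor taken, and 0 means out of range: this is the
  answer format that \<open>crec\<close> prescribes for oracle prefixes.\<close>

definition nth_code :: "nat \<Rightarrow> nat \<Rightarrow> nat" where
  "nth_code i s = (if drop_code i s = 0 then 0 else Suc (pfst (drop_code i s - 1)))"

lemma rec2_nth_code: "rec2 nth_code"
  unfolding nth_code_def
  by (intro rec2I trec_intros trec_rec2[OF rec2_drop_code]) auto

lemma list_encode_eq_0_iff: "list_encode xs = 0 \<longleftrightarrow> xs = []"
  by (cases xs) auto

lemma nth_code_list_encode:
  "nth_code i (list_encode xs) = (if i < length xs then Suc (xs ! i) else 0)"
proof (cases "i < length xs")
  case True
  then have "drop i xs = xs ! i # drop (Suc i) xs" by (simp add: Cons_nth_drop_Suc)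
  then show ?thesis using True by (simp add: nth_code_def drop_code_list_encode)
qed (simp add: nth_code_def drop_code_list_encode)

fun count_code :: "nat \<Rightarrow> nat \<Rightarrow> nat" where
  "count_code 0 s = 0"
| "count_code (Suc i) s = count_code i s + (if drop_code i s = 0 then 0 else 1)"

text \<open>A list is never longer than its code, so inspecting the first \<open>s\<close> positions
  finds all entries.\<close>

definition length_code :: "nat \<Rightarrow> nat" where
  "length_code s = count_code s s"

lemma rec1_length_code: "rec1 length_code"
proof -
  have "rec2 count_code"
    by (rule rec2_primrec[where g = "\<lambda>s. 0" and
          h = "\<lambda>k r s. r + (if drop_code k s = 0 then 0 else 1)"])
       (auto intro!: rec1I rec3I trec_intros trec_rec2[OF rec2_drop_code])
  note this' = trec_rec2[OF this]
  show ?thesis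
    unfolding length_code_def by (intro rec1I this' trec_intros) auto
qed

lemma length_le_list_encode: "length xs \<le> list_encode xs"
proof (induction xs)
  case (Cons x xs)
  have "list_encode xs \<le> prod_encode (x, list_encode xs)" by (rule le_prod_encode_2)
  then show ?case using Cons by simp
qed simp

lemma length_code_list_encode: "length_code (list_encode xs) = length xs"
proof -
  have "count_code k (list_encode xs) = min k (length xs)" for k
    by (induction k) (auto simp: drop_code_list_encode list_encode_eq_0_iff)
  then show ?thesis
    using length_le_list_encode[of xs] by (simp add: length_code_def min_def)
qed

definition prefix_code :: "(nat \<Rightarrow> nat) \<Rightarrow> nat \<Rightarrow> nat" where
  "prefix_code h m = list_encode (map h [0..<m])"

text \<open>Recursive functionals: \<open>q\<close> is evaluated on finite prefixes of the oracle, answers 0 while the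
  prefix is too short and the successor of the value once it is long enough.\<close>

definition crec :: "(nat \<Rightarrow> (nat \<Rightarrow> nat) \<Rightarrow> nat) \<Rightarrow> bool" where
  "crec F \<longleftrightarrow> (\<exists>q. rec2 q \<and>
     (\<forall>c h m. q c (prefix_code h m) = 0 \<or> q c (prefix_code h m) = Suc (F c h)) \<and>
     (\<forall>c h. \<forall>\<^sub>F m in sequentially. q c (prefix_code h m) \<noteq> 0))"

lemma crec_rec3:
  assumes "rec3 g" "crec A" "crec B" "crec C"
  shows "crec (\<lambda>c h. g (A c h) (B c h) (C c h))"
proof -
  obtain q1 where 1: "rec2 q1"
    "\<And>c h m. q1 c (prefix_code h m) = 0 \<or> q1 c (prefix_code h m) = Suc (A c h)"
    "\<And>c h. \<forall>\<^sub>F m in sequentially. q1 c (prefix_code h m) \<noteq> 0"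
    using assms(2) unfolding crec_def by blast
  obtain q2 where 2: "rec2 q2"
    "\<And>c h m. q2 c (prefix_code h m) = 0 \<or> q2 c (prefix_code h m) = Suc (B c h)"
    "\<And>c h. \<forall>\<^sub>F m in sequentially. q2 c (prefix_code h m) \<noteq> 0"
    using assms(3) unfolding crec_def by blast
  obtain q3 where 3: "rec2 q3"
    "\<And>c h m. q3 c (prefix_code h m) = 0 \<or> q3 c (prefix_code h m) = Suc (C c h)"
    "\<And>c h. \<forall>\<^sub>F m in sequentially. q3 c (prefix_code h m) \<noteq> 0"
    using assms(4) unfolding crec_def by blast
  let ?q = "\<lambda>c s. if q1 c s * q2 c s * q3 c s = 0 then 0
    else Suc (g (q1 c s - 1) (q2 c s - 1) (q3 c s - 1))"
  have "rec2 ?q"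
    by (intro rec2I trec_intros trec_rec3[OF assms(1)] trec_rec2[OF 1(1)] trec_rec2[OF 2(1)]
        trec_rec2[OF 3(1)]) auto
  moreover have "?q c (prefix_code h m) = 0 \<or>
      ?q c (prefix_code h m) = Suc (g (A c h) (B c h) (C c h))" for c h m
    using 1(2)[of c h m] 2(2)[of c h m] 3(2)[of c h m] by auto
  moreover have "\<forall>\<^sub>F m in sequentially. ?q c (prefix_code h m) \<noteq> 0" for c h
    using 1(3)[of c h] 2(3)[of c h] 3(3)[of c h] by eventually_elim simp
  ultimately show ?thesis unfolding crec_def by blast
qed

lemma crec_const: "crec (\<lambda>c h. k)"
  unfolding crec_def by (rule exI[of _ "\<lambda>c s. Suc k"]) (auto intro!: rec2I trec_intros)

lemma crec_id: "crec (\<lambda>c h. c)"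
  unfolding crec_def by (rule exI[of _ "\<lambda>c s. Suc c"]) (auto intro!: rec2I trec_intros)

lemma crec_rec2:
  assumes "rec2 g" "crec A" "crec B"
  shows "crec (\<lambda>c h. g (A c h) (B c h))"
proof -
  have "rec3 (\<lambda>x y z. g x y)"
    by (intro rec3I trec_rec2[OF assms(1)] trec_proj) auto
  from crec_rec3[OF this assms(2,3) assms(3)] show ?thesis .
qed

lemma crec_rec1:
  assumes "rec1 g" "crec A"
  shows "crec (\<lambda>c h. g (A c h))"
proof -
  have "rec2 (\<lambda>x y. g x)"
    by (intro rec2I trec_rec1[OF assms(1)] trec_proj) auto
  from crec_rec2[OF this assms(2) assms(2)] show ?thesis .
qed

text \<open>The prefix first determines the argument; as soon as it is longer than that argument it
  also contains the answer.\<close>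

lemma crec_apply:
  assumes "crec A"
  shows "crec (\<lambda>c h. h (A c h))"
proof -
  obtain q where q: "rec2 q"
    "\<And>c h m. q c (prefix_code h m) = 0 \<or> q c (prefix_code h m) = Suc (A c h)"
    "\<And>c h. \<forall>\<^sub>F m in sequentially. q c (prefix_code h m) \<noteq> 0"
    using assms unfolding crec_def by blast
  let ?q = "\<lambda>c s. if q c s = 0 then 0 else nth_code (q c s - 1) s"
  have "rec2 ?q"
    by (intro rec2I trec_intros trec_rec2[OF q(1)] trec_rec2[OF rec2_nth_code]) auto
  moreover have "?q c (prefix_code h m) = 0 \<or> ?q c (prefix_code h m) = Suc (h (A c h))" for c h m
    using q(2)[of c h m] by (auto simp: prefix_code_def nth_code_list_encode)
  moreover have "\<forall>\<^sub>F m in sequentially. ?q c (prefix_code h m) \<noteq> 0" for c h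
    using q(3)[of c h] eventually_gt_at_top[of "A c h"]
  proof eventually_elim
    case (elim m)
    then show ?case
      using q(2)[of c h m] by (auto simp: prefix_code_def nth_code_list_encode)
  qed
  ultimately show ?thesis unfolding crec_def by blast
qed

lemma crec_subst:
  assumes "crec F" "crec G"
  shows "crec (\<lambda>c h. F (G c h) h)"
proof -
  obtain q1 where 1: "rec2 q1"
    "\<And>c h m. q1 c (prefix_code h m) = 0 \<or> q1 c (prefix_code h m) = Suc (F c h)"
    "\<And>c h. \<forall>\<^sub>F m in sequentially. q1 c (prefix_code h m) \<noteq> 0"
    using assms(1) unfolding crec_def by blast
  obtain q2 where 2: "rec2 q2"
    "\<And>c h m. q2 c (prefix_code h m) = 0 \<or> q2 c (prefix_code h m) = Suc (G c h)"
    "\<And>c h. \<forall>\<^sub>F m in sequentially. q2 c (prefix_code h m) \<noteq> 0"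
    using assms(2) unfolding crec_def by blast
  let ?q = "\<lambda>c s. if q2 c s = 0 then 0 else q1 (q2 c s - 1) s"
  have "rec2 ?q"
    by (intro rec2I trec_intros trec_rec2[OF 1(1)] trec_rec2[OF 2(1)]) auto
  moreover have "?q c (prefix_code h m) = 0 \<or> ?q c (prefix_code h m) = Suc (F (G c h) h)" for c h m
    using 2(2)[of c h m] 1(2)[of "G c h" h m] by auto
  moreover have "\<forall>\<^sub>F m in sequentially. ?q c (prefix_code h m) \<noteq> 0" for c h
    using 2(3)[of c h] 1(3)[of "G c h" h]
  proof eventually_elim
    case (elim m)
    then show ?case using 2(2)[of c h m] by auto
  qed
  ultimately show ?thesis unfolding crec_def by blast
qed

lemma rec2_prod_encode: "rec2 (\<lambda>a b. prod_encode (a, b))"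
  by (intro rec2I trec_intros) auto

lemmas crec_pair = crec_rec2[OF rec2_prod_encode]
lemmas crec_pfst = crec_rec1[OF rec1_pfst]
lemmas crec_psnd = crec_rec1[OF rec1_psnd]
lemmas crec_add = crec_rec2[OF rec2_add]
lemmas crec_mult = crec_rec2[OF rec2_mult]
lemmas crec_minus = crec_rec2[OF rec2_minus]
lemmas crec_Suc = crec_rec1[OF rec1_Suc]

section \<open>Decidable and open predicates of an oracle\<close>

definition cpred :: "(nat \<Rightarrow> (nat \<Rightarrow> nat) \<Rightarrow> bool) \<Rightarrow> bool" where
  "cpred P \<longleftrightarrow> crec (\<lambda>c h. of_bool (P c h))"

lemma cpred_not: "cpred P \<Longrightarrow> cpred (\<lambda>c h. \<not> P c h)"
proof -
  assume "cpred P"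
  then have "crec (\<lambda>c h. 1 - of_bool (P c h))"
    unfolding cpred_def by (intro crec_minus crec_const)
  moreover have "1 - of_bool p = (of_bool (\<not> p) :: nat)" for p by simp
  ultimately show ?thesis by (simp only: cpred_def)
qed

lemma cpred_conj: "cpred P \<Longrightarrow> cpred Q \<Longrightarrow> cpred (\<lambda>c h. P c h \<and> Q c h)"
  unfolding cpred_def of_bool_conj by (rule crec_mult)

lemma cpred_disj: "cpred P \<Longrightarrow> cpred Q \<Longrightarrow> cpred (\<lambda>c h. P c h \<or> Q c h)"
  using cpred_not[OF cpred_conj[OF cpred_not cpred_not, of P Q]] by simp

lemma cpred_imp: "cpred P \<Longrightarrow> cpred Q \<Longrightarrow> cpred (\<lambda>c h. P c h \<longrightarrow> Q c h)"
  using cpred_disj[OF cpred_not, of P Q] by simp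

lemma cpred_less: "crec A \<Longrightarrow> crec B \<Longrightarrow> cpred (\<lambda>c h. A c h < B c h)"
proof -
  assume "crec A" "crec B"
  then have "crec (\<lambda>c h. 1 - (1 - (B c h - A c h)))"
    by (intro crec_minus crec_const)
  moreover have "1 - (1 - (b - a)) = of_bool (a < b)" for a b :: nat by auto
  ultimately show ?thesis by (simp add: cpred_def del: diff_diff_cancel diff_is_0_eq)
qed

lemma cpred_le: "crec A \<Longrightarrow> crec B \<Longrightarrow> cpred (\<lambda>c h. A c h \<le> B c h)"
  using cpred_not[OF cpred_less, of B A] by (simp add: not_less)

lemma cpred_eq: "crec A \<Longrightarrow> crec B \<Longrightarrow> cpred (\<lambda>c h. A c h = B c h)"
  using cpred_conj[OF cpred_le cpred_le, of A B B A] by (simp only: order.eq_iff)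

lemma crec_if: "cpred P \<Longrightarrow> crec A \<Longrightarrow> crec B \<Longrightarrow> crec (\<lambda>c h. if P c h then A c h else B c h)"
proof -
  assume "cpred P" "crec A" "crec B"
  then have "crec (\<lambda>c h. if of_bool (P c h) = (0::nat) then B c h else A c h)"
    unfolding cpred_def by (intro crec_rec3[OF rec3_if])
  moreover have "(if of_bool p = (0::nat) then b else a) = (if p then a else b)" for p and a b :: nat
    by simp
  ultimately show ?thesis by (simp only:)
qed

lemma cpred_subst: "cpred P \<Longrightarrow> crec G \<Longrightarrow> cpred (\<lambda>c h. P (G c h) h)"
  unfolding cpred_def by (rule crec_subst)

text \<open>The number quantifier is absorbed into the length of the prefix in \<open>Pi11I\<close> below.\<close>

definition open_rel :: "(nat \<Rightarrow> (nat \<Rightarrow> nat) \<Rightarrow> bool) \<Rightarrow> bool" where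
  "open_rel P \<longleftrightarrow> (\<exists>M. cpred M \<and> (\<forall>c h. P c h \<longleftrightarrow> (\<exists>x. M (prod_encode (c, x)) h)))"

lemma open_rel_cpred: "cpred P \<Longrightarrow> open_rel P"
  unfolding open_rel_def
  by (rule exI[of _ "\<lambda>c h. P (pfst c) h"]) (auto intro!: cpred_subst crec_pfst crec_id)

lemma open_rel_conj:
  assumes "open_rel P" "open_rel Q"
  shows "open_rel (\<lambda>c h. P c h \<and> Q c h)"
proof -
  obtain M where M: "cpred M" "\<And>c h. P c h \<longleftrightarrow> (\<exists>x. M (prod_encode (c, x)) h)"
    using assms(1) by (auto simp: open_rel_def)
  obtain N where N: "cpred N" "\<And>c h. Q c h \<longleftrightarrow> (\<exists>x. N (prod_encode (c, x)) h)"
    using assms(2) by (auto simp: open_rel_def)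
  let ?K = "\<lambda>c h. M (prod_encode (pfst c, pfst (psnd c))) h \<and> N (prod_encode (pfst c, psnd (psnd c))) h"
  have "cpred ?K"
    by (intro cpred_conj cpred_subst[OF M(1)] cpred_subst[OF N(1)] crec_pair crec_pfst crec_psnd crec_id)
  moreover have "P c h \<and> Q c h \<longleftrightarrow> (\<exists>x. ?K (prod_encode (c, x)) h)" for c h
    unfolding M N by (auto, metis pfst_prod_encode psnd_prod_encode)
  ultimately show ?thesis unfolding open_rel_def by blast
qed

lemma open_rel_disj:
  assumes "open_rel P" "open_rel Q"
  shows "open_rel (\<lambda>c h. P c h \<or> Q c h)"
proof -
  obtain M where M: "cpred M" "\<And>c h. P c h \<longleftrightarrow> (\<exists>x. M (prod_encode (c, x)) h)"
    using assms(1) by (auto simp: open_rel_def)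
  obtain N where N: "cpred N" "\<And>c h. Q c h \<longleftrightarrow> (\<exists>x. N (prod_encode (c, x)) h)"
    using assms(2) by (auto simp: open_rel_def)
  have "P c h \<or> Q c h \<longleftrightarrow> (\<exists>x. M (prod_encode (c, x)) h \<or> N (prod_encode (c, x)) h)" for c h
    unfolding M N by auto
  moreover have "cpred (\<lambda>c h. M c h \<or> N c h)"
    using M(1) N(1) by (rule cpred_disj)
  ultimately show ?thesis unfolding open_rel_def by blast
qed

lemma open_rel_ex:
  assumes "open_rel (\<lambda>c h. P (pfst c) (psnd c) h)"
  shows "open_rel (\<lambda>c h. \<exists>y. P c y h)"
proof -
  obtain M where M: "cpred M" "\<And>c h. P (pfst c) (psnd c) h \<longleftrightarrow> (\<exists>x. M (prod_encode (c, x)) h)"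
    using assms by (auto simp: open_rel_def)
  let ?K = "\<lambda>c h. M (prod_encode (prod_encode (pfst c, pfst (psnd c)), psnd (psnd c))) h"
  have "cpred ?K"
    by (intro cpred_subst[OF M(1)] crec_pair crec_pfst crec_psnd crec_id)
  moreover have "(\<exists>y. P c y h) \<longleftrightarrow> (\<exists>x. ?K (prod_encode (c, x)) h)" for c h
    using M(2)[of "prod_encode (c, _)" h] by (auto, metis pfst_prod_encode psnd_prod_encode)
  ultimately show ?thesis unfolding open_rel_def by blast
qed

text \<open>The only witness in the normal form is the prefix length \<open>m\<close>. It is read as
  a pair: the first component is the number witness, the second is free and makes \<open>m\<close>
  as large as the evaluation requires.\<close>

lemma Pi11I:
  assumes "open_rel P" "\<And>n. n \<in> A \<longleftrightarrow> (\<forall>h. P n h)"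
  shows "Pi11 A"
proof -
  obtain M where M: "cpred M" "\<And>c h. P c h \<longleftrightarrow> (\<exists>x. M (prod_encode (c, x)) h)"
    using assms(1) by (auto simp: open_rel_def)
  obtain q where q: "rec2 q"
    "\<And>c h m. q c (prefix_code h m) = 0 \<or> q c (prefix_code h m) = Suc (of_bool (M c h))"
    "\<And>c h. \<forall>\<^sub>F m in sequentially. q c (prefix_code h m) \<noteq> 0"
    using M(1) unfolding cpred_def crec_def by blast
  \<comment> \<open>Zero iff the answer is at least 2, that is, iff the prefix suffices and the
    matrix is true.\<close>
  let ?g = "\<lambda>n s. 2 - q (prod_encode (n, pfst (length_code s))) s"
  have "rec2 ?g"
    by (intro rec2I trec_intros trec_rec2[OF q(1)] trec_rec1[OF rec1_length_code]) auto
  then obtain r where r: "total_rec 2 r" "\<And>x y. r [x, y] = ?g x y"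
    unfolding rec2_def trec_def by fastforce
  have "recursive_rel2 (\<lambda>n s. ?g n s = 0)"
    unfolding recursive_rel2_def using r by auto
  moreover have "P n h \<longleftrightarrow> (\<exists>m. ?g n (list_encode (map h [0..<m])) = 0)" for n h
  proof
    assume "P n h"
    then obtain x where x: "M (prod_encode (n, x)) h" by (auto simp: M)
    obtain m0 where m0: "\<And>m. m \<ge> m0 \<Longrightarrow> q (prod_encode (n, x)) (prefix_code h m) \<noteq> 0"
      using q(3) unfolding eventually_sequentially by blast
    let ?m = "prod_encode (x, m0)"
    have "q (prod_encode (n, x)) (prefix_code h ?m) = 2"
      using m0[of ?m] q(2)[of "prod_encode (n, x)" h ?m] x by (simp add: le_prod_encode_2)
    then show "\<exists>m. ?g n (list_encode (map h [0..<m])) = 0"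
      by (intro exI[of _ ?m]) (simp add: length_code_list_encode prefix_code_def)
  next
    assume "\<exists>m. ?g n (list_encode (map h [0..<m])) = 0"
    then obtain m where "q (prod_encode (n, pfst m)) (prefix_code h m) \<ge> 2"
      by (auto simp: length_code_list_encode prefix_code_def)
    then have "M (prod_encode (n, pfst m)) h"
      using q(2)[of "prod_encode (n, pfst m)" h m] by (cases "M (prod_encode (n, pfst m)) h") auto
    then show "P n h" by (auto simp: M)
  qed
  ultimately show ?thesis unfolding Pi11_def using assms(2) by blast
qed

section \<open>Recursive rational-valued functionals\<close>

definition rat_of_code :: "nat \<Rightarrow> rat" where
  "rat_of_code x = (of_nat (pfst x) - of_nat (pfst (psnd x))) / of_nat (Suc (psnd (psnd x)))"

lemma rat_of_code_surj: "\<exists>x. rat_of_code x = q"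
proof -
  obtain a b where q: "q = Fract a b" "b > 0" by (cases q)
  then have "q = (of_nat (nat a) - of_nat (nat (- a))) / of_nat (Suc (nat b - 1))"
    by (cases "a \<ge> 0") (auto simp: Fract_of_int_quotient)
  then show ?thesis
    by (intro exI[of _ "prod_encode (nat a, prod_encode (nat (- a), nat b - 1))"])
       (simp add: rat_of_code_def)
qed

definition code_rat :: "rat \<Rightarrow> nat" where
  "code_rat q = (SOME x. rat_of_code x = q)"

lemma rat_of_code_code_rat [simp]: "rat_of_code (code_rat q) = q"
  unfolding code_rat_def by (rule someI_ex) (rule rat_of_code_surj)

text \<open>A difference of naturals over a successor handles signs without integers and excludes
  zero denominators. Fractions need not be reduced, so no gcd has to be computed.\<close>

definition crat :: "(nat \<Rightarrow> (nat \<Rightarrow> nat) \<Rightarrow> rat) \<Rightarrow> bool" where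
  "crat Q \<longleftrightarrow> (\<exists>A B D. crec A \<and> crec B \<and> crec D \<and>
     (\<forall>c h. Q c h = (of_nat (A c h) - of_nat (B c h)) / of_nat (Suc (D c h))))"

lemma cratI:
  "crec A \<Longrightarrow> crec B \<Longrightarrow> crec D \<Longrightarrow>
    (\<And>c h. Q c h = (of_nat (A c h) - of_nat (B c h)) / of_nat (Suc (D c h))) \<Longrightarrow> crat Q"
  unfolding crat_def by blast

lemma crat_of_nat: "crec A \<Longrightarrow> crat (\<lambda>c h. of_nat (A c h))"
  unfolding crat_def
  by (rule exI[of _ A], rule exI[of _ "\<lambda>c h. 0"], rule exI[of _ "\<lambda>c h. 0"])
     (auto intro: crec_const)

lemma crat_0: "crat (\<lambda>c h. 0)" and crat_1: "crat (\<lambda>c h. 1)"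
  using crat_of_nat[OF crec_const, of 0] crat_of_nat[OF crec_const, of 1] by simp_all

lemma crat_code: "crec A \<Longrightarrow> crat (\<lambda>c h. rat_of_code (A c h))"
  by (rule cratI[OF _ _ _ rat_of_code_def]) (intro crec_pfst crec_psnd; assumption)+

lemma crat_add:
  assumes "crat P" "crat Q" shows "crat (\<lambda>c h. P c h + Q c h)"
proof -
  obtain A B D where 1: "crec A" "crec B" "crec D"
    "\<And>c h. P c h = (of_nat (A c h) - of_nat (B c h)) / of_nat (Suc (D c h))"
    using assms(1) unfolding crat_def by blast
  obtain A' B' D' where 2: "crec A'" "crec B'" "crec D'"
    "\<And>c h. Q c h = (of_nat (A' c h) - of_nat (B' c h)) / of_nat (Suc (D' c h))"
    using assms(2) unfolding crat_def by blast
  have "P c h + Q c h =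
     (of_nat (A c h * Suc (D' c h) + A' c h * Suc (D c h))
      - of_nat (B c h * Suc (D' c h) + B' c h * Suc (D c h)))
      / of_nat (Suc (D c h * D' c h + D c h + D' c h))" for c h
    unfolding 1(4) 2(4) by (subst add_frac_eq) (simp_all add: algebra_simps del: of_nat_Suc, simp add: algebra_simps)
  note eq = this
  show ?thesis
    by (rule cratI[OF _ _ _ eq]) (intro 1 2 crec_add crec_mult crec_Suc)+
qed

lemma crat_mult:
  assumes "crat P" "crat Q" shows "crat (\<lambda>c h. P c h * Q c h)"
proof -
  obtain A B D where 1: "crec A" "crec B" "crec D"
    "\<And>c h. P c h = (of_nat (A c h) - of_nat (B c h)) / of_nat (Suc (D c h))"
    using assms(1) unfolding crat_def by blast
  obtain A' B' D' where 2: "crec A'" "crec B'" "crec D'"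
    "\<And>c h. Q c h = (of_nat (A' c h) - of_nat (B' c h)) / of_nat (Suc (D' c h))"
    using assms(2) unfolding crat_def by blast
  have "P c h * Q c h =
     (of_nat (A c h * A' c h + B c h * B' c h) - of_nat (A c h * B' c h + B c h * A' c h))
      / of_nat (Suc (D c h * D' c h + D c h + D' c h))" for c h
    unfolding 1(4) 2(4) by (simp add: algebra_simps)
  note eq = this
  show ?thesis
    by (rule cratI[OF _ _ _ eq]) (intro 1 2 crec_add crec_mult crec_Suc)+
qed

lemma crat_minus:
  assumes "crat P" "crat Q" shows "crat (\<lambda>c h. P c h - Q c h)"
proof -
  obtain A B D where 2: "crec A" "crec B" "crec D"
    "\<And>c h. Q c h = (of_nat (A c h) - of_nat (B c h)) / of_nat (Suc (D c h))"
    using assms(2) unfolding crat_def by blast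
  have "crat (\<lambda>c h. - Q c h)"
    unfolding crat_def using 2
    by (intro exI[of _ B] exI[of _ A] exI[of _ D]) (auto simp: minus_divide_left)
  from crat_add[OF assms(1) this] show ?thesis by simp
qed

lemma cpred_rat_le_0:
  assumes "crat Q" shows "cpred (\<lambda>c h. Q c h \<le> 0)"
proof -
  obtain A B D where 2: "crec A" "crec B" "crec D"
    "\<And>c h. Q c h = (of_nat (A c h) - of_nat (B c h)) / of_nat (Suc (D c h))"
    using assms unfolding crat_def by blast
  have "Q c h \<le> 0 \<longleftrightarrow> A c h \<le> B c h" for c h
    unfolding 2(4) by (simp add: divide_le_0_iff del: of_nat_Suc)
  with cpred_le[OF 2(1,2)] show ?thesis by simp
qed

lemma cpred_rat_le: "crat P \<Longrightarrow> crat Q \<Longrightarrow> cpred (\<lambda>c h. P c h \<le> Q c h)"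
  using cpred_rat_le_0[OF crat_minus, of P Q] by simp

lemma cpred_rat_less: "crat P \<Longrightarrow> crat Q \<Longrightarrow> cpred (\<lambda>c h. P c h < Q c h)"
  using cpred_not[OF cpred_rat_le, of Q P] by (simp add: not_le)

lemma cpred_rat_eq: "crat P \<Longrightarrow> crat Q \<Longrightarrow> cpred (\<lambda>c h. P c h = Q c h)"
  using cpred_conj[OF cpred_rat_le cpred_rat_le, of P Q Q P] by (simp only: order.eq_iff)

lemma crat_if:
  assumes "cpred R" "crat P" "crat Q" shows "crat (\<lambda>c h. if R c h then P c h else Q c h)"
proof -
  have "crat (\<lambda>c h. of_nat (of_bool (R c h)) * P c h + of_nat (of_bool (\<not> R c h)) * Q c h)"
    using assms cpred_not[OF assms(1)] unfolding cpred_def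
    by (intro crat_add crat_mult crat_of_nat)
  moreover have "(of_nat (of_bool r) * p + of_nat (of_bool (\<not> r)) * q :: rat) = (if r then p else q)" for r p q
    by simp
  ultimately show ?thesis by simp
qed

section \<open>Encodings\<close>

text \<open>With a nonzero first component \<open>a\<close> the code
  \<open>triangle (a + b) + a\<close> exceeds \<open>b\<close>. All constructors with subterms carry
  nonzero tags, so this makes recursion on codes well-founded.\<close>

lemma psnd_less: "pfst c \<noteq> 0 \<Longrightarrow> psnd c < c"
proof -
  assume "pfst c \<noteq> 0"
  moreover obtain a b where c: "c = prod_encode (a, b)" by (metis prod_encode_pfst_psnd)
  moreover have "k \<le> triangle k" for k by (cases k) auto
  then have "a + b \<le> triangle (a + b)" .
  then have "a \<noteq> 0 \<Longrightarrow> b < prod_encode (a, b)" by (simp add: prod_encode_def)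
  ultimately show ?thesis by simp
qed

lemma pfst_le: "pfst c \<le> c" and psnd_le: "psnd c \<le> c"
  using le_prod_encode_1[of "pfst c" "psnd c"] le_prod_encode_2[of "psnd c" "pfst c"] by simp_all

lemma pfst_psnd_less: "pfst c \<noteq> 0 \<Longrightarrow> pfst (psnd c) < c"
  and psnd_psnd_less: "pfst c \<noteq> 0 \<Longrightarrow> psnd (psnd c) < c"
  and psnd_psnd_psnd_less: "pfst c \<noteq> 0 \<Longrightarrow> psnd (psnd (psnd c)) < c"
  using psnd_less[of c] pfst_le[of "psnd c"] psnd_le[of "psnd c"] psnd_le[of "psnd (psnd c)"]
  by linarith+

definition dec_rat :: "nat \<Rightarrow> rat" where
  "dec_rat x = of_int (int_decode (pfst x)) / of_nat (psnd x)"

lemma dec_rat_enc_rat [simp]: "dec_rat (enc_rat q) = q"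
proof -
  obtain a b where ab: "quotient_of q = (a, b)" by (cases "quotient_of q")
  then have "b > 0" by (rule quotient_of_denom_pos)
  then have "dec_rat (enc_rat q) = of_int a / of_int b" by (simp add: dec_rat_def enc_rat_def ab)
  with quotient_of_div[OF ab] show ?thesis by simp
qed

function dec_aexp :: "nat \<Rightarrow> aexp" where
  "dec_aexp c = (let x = psnd c; l = pfst x; r = psnd x in
     if pfst c = 0 then AConst (dec_rat x)
     else if pfst c = 1 then AVar x
     else if pfst c = 2 then AAdd (dec_aexp l) (dec_aexp r)
     else if pfst c = 3 then ASub (dec_aexp l) (dec_aexp r)
     else if pfst c = 4 then AMul (dec_aexp l) (dec_aexp r)
     else if pfst c = 5 then ADiv (dec_aexp l) (dec_aexp r)
     else AConst 0)"
  by auto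
termination
  by (relation "measure id") (auto simp: pfst_psnd_less psnd_psnd_less)

declare dec_aexp.simps [simp del]

lemma dec_aexp_prod_encode [simp]:
  "dec_aexp (prod_encode (0, x)) = AConst (dec_rat x)"
  "dec_aexp (prod_encode (Suc 0, x)) = AVar x"
  "dec_aexp (prod_encode (2, prod_encode (l, r))) = AAdd (dec_aexp l) (dec_aexp r)"
  "dec_aexp (prod_encode (3, prod_encode (l, r))) = ASub (dec_aexp l) (dec_aexp r)"
  "dec_aexp (prod_encode (4, prod_encode (l, r))) = AMul (dec_aexp l) (dec_aexp r)"
  "dec_aexp (prod_encode (5, prod_encode (l, r))) = ADiv (dec_aexp l) (dec_aexp r)"
  by (subst dec_aexp.simps; simp add: Let_def)+

lemma dec_aexp_enc_aexp [simp]: "dec_aexp (enc_aexp e) = e"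
  by (induction e) simp_all

function dec_bexp :: "nat \<Rightarrow> bexp" where
  "dec_bexp c = (let x = psnd c; l = pfst x; r = psnd x in
     if pfst c = 0 then BTrue
     else if pfst c = 1 then BFalse
     else if pfst c = 2 then BLess (dec_aexp l) (dec_aexp r)
     else if pfst c = 3 then BLeq (dec_aexp l) (dec_aexp r)
     else if pfst c = 4 then BEq (dec_aexp l) (dec_aexp r)
     else if pfst c = 5 then BNot (dec_bexp x)
     else if pfst c = 6 then BAnd (dec_bexp l) (dec_bexp r)
     else if pfst c = 7 then BOr (dec_bexp l) (dec_bexp r)
     else BTrue)"
  by auto
termination
  by (relation "measure id") (auto simp: pfst_psnd_less psnd_psnd_less psnd_less)

declare dec_bexp.simps [simp del]

lemma dec_bexp_prod_encode [simp]:
  "dec_bexp (prod_encode (0, x)) = BTrue"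
  "dec_bexp (prod_encode (Suc 0, x)) = BFalse"
  "dec_bexp (prod_encode (2, prod_encode (l, r))) = BLess (dec_aexp l) (dec_aexp r)"
  "dec_bexp (prod_encode (3, prod_encode (l, r))) = BLeq (dec_aexp l) (dec_aexp r)"
  "dec_bexp (prod_encode (4, prod_encode (l, r))) = BEq (dec_aexp l) (dec_aexp r)"
  "dec_bexp (prod_encode (5, x)) = BNot (dec_bexp x)"
  "dec_bexp (prod_encode (6, prod_encode (l, r))) = BAnd (dec_bexp l) (dec_bexp r)"
  "dec_bexp (prod_encode (7, prod_encode (l, r))) = BOr (dec_bexp l) (dec_bexp r)"
  by (subst dec_bexp.simps; simp add: Let_def)+

lemma dec_bexp_enc_bexp [simp]: "dec_bexp (enc_bexp e) = e"
  by (induction e) simp_all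

function dec_prog :: "nat \<Rightarrow> prog" where
  "dec_prog c = (let x = psnd c; l = pfst x; r = psnd x in
     if pfst c = 0 then Bot
     else if pfst c = 1 then Assign l (dec_aexp r)
     else if pfst c = 2 then Seq (dec_prog l) (dec_prog r)
     else if pfst c = 3 then PChoice (dec_prog l) (dec_aexp (pfst r)) (dec_prog (psnd r))
     else if pfst c = 4 then NChoice (dec_prog l) (dec_prog r)
     else if pfst c = 5 then While (dec_bexp l) (dec_prog r)
     else Bot)"
  by auto
termination
  by (relation "measure id") (auto simp: pfst_psnd_less psnd_psnd_less psnd_psnd_psnd_less)

declare dec_prog.simps [simp del]

lemma dec_prog_prod_encode [simp]:
  "dec_prog (prod_encode (0, x)) = Bot"
  "dec_prog (prod_encode (Suc 0, prod_encode (v, e))) = Assign v (dec_aexp e)"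
  "dec_prog (prod_encode (2, prod_encode (l, r))) = Seq (dec_prog l) (dec_prog r)"
  "dec_prog (prod_encode (3, prod_encode (l, prod_encode (p, r)))) =
     PChoice (dec_prog l) (dec_aexp p) (dec_prog r)"
  "dec_prog (prod_encode (4, prod_encode (l, r))) = NChoice (dec_prog l) (dec_prog r)"
  "dec_prog (prod_encode (5, prod_encode (b, r))) = While (dec_bexp b) (dec_prog r)"
  by (subst dec_prog.simps; simp add: Let_def)+

lemma dec_prog_enc_prog [simp]: "dec_prog (enc_prog P) = P"
  by (induction P) simp_all

lemma enc_prog_inj: "enc_prog P = enc_prog Q \<longleftrightarrow> P = Q"
  by (metis dec_prog_enc_prog)

lemma enc_prog_mem_PAST_codes: "enc_prog P \<in> PAST_codes \<longleftrightarrow> P \<in> PAST"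
  by (auto simp: PAST_codes_def enc_prog_inj)

fun rev_code_upto :: "nat \<Rightarrow> nat \<Rightarrow> nat" where
  "rev_code_upto 0 s = 0"
| "rev_code_upto (Suc i) s = (if drop_code i s = 0 then rev_code_upto i s
     else Suc (prod_encode (pfst (drop_code i s - 1), rev_code_upto i s)))"

text \<open>The program of the hardness part stores its sequence reversed; the compiled predicate
  undoes this.\<close>

definition rev_code :: "nat \<Rightarrow> nat" where
  "rev_code s = rev_code_upto s s"

lemma rec1_rev_code: "rec1 rev_code"
proof -
  have "rec2 rev_code_upto"
    by (rule rec2_primrec[where g = "\<lambda>s. 0" and h = "\<lambda>k r s. if drop_code k s = 0 then r
          else Suc (prod_encode (pfst (drop_code k s - 1), r))"])
       (auto intro!: rec1I rec3I trec_intros trec_rec2[OF rec2_drop_code])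
  note this' = trec_rec2[OF this]
  show ?thesis
    unfolding rev_code_def by (intro rec1I this' trec_intros) auto
qed

lemma rev_code_list_encode: "rev_code (list_encode xs) = list_encode (rev xs)"
proof -
  have "rev_code_upto i (list_encode xs) = list_encode (rev (take i xs))" for i
  proof (induction i)
    case (Suc i)
    show ?case
    proof (cases "i < length xs")
      case True
      then have "drop i xs = xs ! i # drop (Suc i) xs" by (simp add: Cons_nth_drop_Suc)
      with True Suc show ?thesis
        by (simp add: drop_code_list_encode take_Suc_conv_app_nth)
    qed (use Suc in \<open>simp add: drop_code_list_encode\<close>)
  qed simp
  then show ?thesis using length_le_list_encode[of xs] by (simp add: rev_code_def)
qed

section \<open>Membership in the analytical hierarchy\<close>

lemma cpred_iff: "cpred P \<Longrightarrow> cpred Q \<Longrightarrow> cpred (\<lambda>c h. P c h \<longleftrightarrow> Q c h)"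
  using cpred_conj[OF cpred_imp cpred_imp, of P Q Q P] by (simp only: iff_conv_conj_imp)

lemma rec1_mod2: "rec1 (\<lambda>i. i mod 2)"
  by (rule rec1_primrec[where h = "\<lambda>k r. 1 - r"]) (intro rec2I trec_intros, simp, simp add: mod_Suc)

lemma rec1_div2: "rec1 (\<lambda>i. i div 2)"
proof (rule rec1_primrec[where h = "\<lambda>k r. r + k mod 2"])
  show "rec2 (\<lambda>k r. r + k mod 2)"
    by (intro rec2I trec_intros trec_rec1[OF rec1_mod2]) auto
qed presburger

lemma crat_divide_nat:
  assumes "crat Q" "crec D" shows "crat (\<lambda>c h. Q c h / of_nat (D c h))"
proof -
  obtain A B E where 2: "crec A" "crec B" "crec E"
    "\<And>c h. Q c h = (of_nat (A c h) - of_nat (B c h)) / of_nat (Suc (E c h))"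
    using assms(1) unfolding crat_def by blast
  \<comment> \<open>The denominator is rewritten as a successor, which is right for nonzero
    \<open>D\<close>; the zero case is then set to 0, the value of division by zero.\<close>
  have "crat (\<lambda>c h. (of_nat (A c h) - of_nat (B c h)) / of_nat (Suc (Suc (E c h) * D c h - 1)))"
    by (rule cratI[OF 2(1,2) _ refl]) (intro crec_minus crec_mult crec_Suc crec_const 2 assms)
  from crat_if[OF cpred_eq[OF assms(2) crec_const[of 0]] crat_0 this]
  show ?thesis
  proof (rule back_subst[where P = crat], intro ext)
    fix c h
    show "(if D c h = 0 then 0 else (of_nat (A c h) - of_nat (B c h)) /
        of_nat (Suc (Suc (E c h) * D c h - 1))) = Q c h / of_nat (D c h)"
    proof (cases "D c h = 0")
      case False
      then have "Suc (Suc (E c h) * D c h - 1) = Suc (E c h) * D c h" by simp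
      then show ?thesis using False by (simp only: 2(4) of_nat_mult divide_divide_eq_left if_False)
    qed simp
  qed
qed

lemma crat_dec_rat:
  assumes "crec A" shows "crat (\<lambda>c h. dec_rat (A c h))"
proof -
  let ?i = "\<lambda>c h. pfst (A c h)"
  have i: "crec ?i" by (rule crec_pfst[OF assms])
  have "crat (\<lambda>c h. if ?i c h mod 2 = 0 then of_nat (?i c h div 2) else 0 - of_nat (Suc (?i c h div 2)))"
    by (intro crat_if cpred_eq crat_minus crat_0 crat_of_nat crec_Suc crec_const
        crec_rec1[OF rec1_mod2] crec_rec1[OF rec1_div2] i)
  moreover have "(if k mod 2 = 0 then of_nat (k div 2) else 0 - of_nat (Suc (k div 2))) =
      rat_of_int (int_decode k)" for k
    by (auto simp: int_decode_def sum_decode_def even_iff_mod_2_eq_zero)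
  ultimately have "crat (\<lambda>c h. of_int (int_decode (?i c h)))" by simp
  then show ?thesis
    unfolding dec_rat_def by (intro crat_divide_nat crec_psnd assms)
qed

text \<open>\<open>enc_rat\<close> stores the normalized fraction, whose denominator divides that of
  any other fraction with the same value. Hence it is characterized by a minimality
  condition.\<close>

lemma dec_rat_denominator:
  assumes "0 < psnd s" "dec_rat s = q"
  shows "psnd (enc_rat q) \<le> psnd s"
proof -
  obtain a b where ab: "quotient_of q = (a, b)" by (cases "quotient_of q")
  then have b: "b > 0" and cop: "coprime a b"
    by (auto intro: quotient_of_denom_pos quotient_of_coprime)
  define i d where "i = int_decode (pfst s)" and "d = int (psnd s)"
  have "of_int i / of_int d = (of_int a / of_int b :: rat)"
    using assms(2) quotient_of_div[OF ab] by (simp add: dec_rat_def i_def d_def)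
  then have "rat_of_int (i * b) = of_int (a * d)"
    using b assms(1) by (simp add: frac_eq_eq d_def)
  then have "a * d = i * b" unfolding of_int_eq_iff by simp
  then have "b dvd d" using cop by (metis coprime_commute coprime_dvd_mult_right_iff dvd_triv_right)
  then have "b \<le> d" using assms(1) by (intro zdvd_imp_le) (simp_all add: d_def)
  then show ?thesis using b by (simp add: enc_rat_def ab d_def)
qed

lemma psnd_enc_rat_pos: "0 < psnd (enc_rat q)"
  using quotient_of_denom_pos'[of q] by (simp add: enc_rat_def)

lemma enc_rat_unique:
  assumes "0 < psnd s" "dec_rat s = q" "psnd s \<le> psnd (enc_rat q)"
  shows "s = enc_rat q"
proof -
  have d: "psnd s = psnd (enc_rat q)"
    using dec_rat_denominator[OF assms(1,2)] assms(3) by simp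
  have "dec_rat s = dec_rat (enc_rat q)" using assms(2) by simp
  then have "int_decode (pfst s) = int_decode (pfst (enc_rat q))"
    using assms(1) d unfolding dec_rat_def by simp
  then have "pfst s = pfst (enc_rat q)" by (metis int_decode_inverse)
  with d show ?thesis by (metis prod_encode_pfst_psnd)
qed

text \<open>Closed conditions absorb universal number quantifiers, as needed to say that a table is
  correct everywhere.\<close>

definition closed_rel :: "(nat \<Rightarrow> (nat \<Rightarrow> nat) \<Rightarrow> bool) \<Rightarrow> bool" where
  "closed_rel P \<longleftrightarrow> open_rel (\<lambda>c h. \<not> P c h)"

lemma closed_rel_cpred: "cpred P \<Longrightarrow> closed_rel P"
  unfolding closed_rel_def by (intro open_rel_cpred cpred_not)

lemma closed_rel_conj: "closed_rel P \<Longrightarrow> closed_rel Q \<Longrightarrow> closed_rel (\<lambda>c h. P c h \<and> Q c h)"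
  unfolding closed_rel_def de_Morgan_conj by (rule open_rel_disj)

lemma closed_rel_all:
  "closed_rel (\<lambda>c h. P (pfst c) (psnd c) h) \<Longrightarrow> closed_rel (\<lambda>c h. \<forall>y. P c y h)"
  unfolding closed_rel_def not_all by (rule open_rel_ex)

text \<open>An oracle is read as a sequence of tables that are meant to describe the syntax of all programs
  and one run of a given program. All conditions imposed on them are local, so a wrong table is
  exposed by a finite part of the oracle, and recursively defined functions such as evaluation need
  not be shown recursive.\<close>

definition tab :: "nat \<Rightarrow> (nat \<Rightarrow> nat) \<Rightarrow> nat \<Rightarrow> nat" where
  "tab j h x = h (prod_encode (j, x))"

definition holds :: "nat \<Rightarrow> (nat \<Rightarrow> nat) \<Rightarrow> nat \<Rightarrow> bool" where
  "holds j h x \<longleftrightarrow> tab j h x \<noteq> 0"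

definition rtab :: "nat \<Rightarrow> (nat \<Rightarrow> nat) \<Rightarrow> nat \<Rightarrow> rat" where
  "rtab j h x = rat_of_code (tab j h x)"

lemma crec_tab: "crec A \<Longrightarrow> crec (\<lambda>c h. tab j h (A c h))"
  unfolding tab_def by (intro crec_apply crec_pair crec_const)

lemma cpred_holds: "crec A \<Longrightarrow> cpred (\<lambda>c h. holds j h (A c h))"
  unfolding holds_def by (intro cpred_not cpred_eq crec_tab crec_const)

lemma crat_rtab: "crec A \<Longrightarrow> crat (\<lambda>c h. rtab j h (A c h))"
  unfolding rtab_def by (intro crat_code crec_tab)

definition join_tabs :: "(nat \<Rightarrow> nat) list \<Rightarrow> nat \<Rightarrow> nat" where
  "join_tabs ts z = (ts ! pfst z) (psnd z)"

lemma tab_join_tabs [simp]: "tab j (join_tabs ts) x = (ts ! j) x"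
  by (simp add: tab_def join_tabs_def)

lemmas crec_rules = crec_tab crec_pair crec_pfst crec_psnd crec_Suc crec_add crec_mult crec_if
  crec_id crec_const
lemmas crat_rules = crat_rtab crat_dec_rat crat_0 crat_1 crat_of_nat crat_if crat_add crat_minus
  crat_mult
lemmas cpred_rules = cpred_holds cpred_imp cpred_iff cpred_conj cpred_disj cpred_not cpred_less
  cpred_le cpred_rat_less cpred_rat_le cpred_rat_eq cpred_eq

abbreviation pair :: "nat \<Rightarrow> nat \<Rightarrow> nat" where
  "pair a b \<equiv> prod_encode (a, b)"

abbreviation "Sched \<equiv> tab 0"
abbreviation "Horizon \<equiv> tab 1"
abbreviation "Reduced \<equiv> tab 2"
abbreviation "Is_aexp \<equiv> holds 3"
abbreviation "Is_bexp \<equiv> holds 4"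
abbreviation "Is_prog \<equiv> holds 5"
abbreviation "Redex \<equiv> tab 6"
abbreviation "Plug \<equiv> tab 7"
abbreviation "Prog \<equiv> tab 8"
abbreviation "Var \<equiv> rtab 9"
abbreviation "Hist \<equiv> tab 10"
abbreviation "Aval \<equiv> rtab 11"
abbreviation "Bval \<equiv> holds 12"
abbreviation "LProb \<equiv> rtab 13"
abbreviation "Cost \<equiv> rtab 14"

text \<open>Normalization is specified by minimality of the positive denominator instead of
  coprimality, which leaves only universal quantifiers over decidable relations.\<close>

definition rat_tabs :: "(nat \<Rightarrow> nat) \<Rightarrow> bool" where
  "rat_tabs h \<longleftrightarrow>
     (\<forall>r. 0 < psnd (Reduced h r) \<and> dec_rat (Reduced h r) = dec_rat r) \<and>
     (\<forall>r s. 0 < psnd s \<and> dec_rat s = dec_rat r \<longrightarrow> psnd (Reduced h r) \<le> psnd s)"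

definition aexp_tabs :: "(nat \<Rightarrow> nat) \<Rightarrow> bool" where
  "aexp_tabs h \<longleftrightarrow>
     (\<forall>x. Is_aexp h (pair 0 x) \<longleftrightarrow> Reduced h x = x) \<and>
     (\<forall>x. Is_aexp h (pair 1 x)) \<and>
     (\<forall>t l r. 2 \<le> t \<and> t \<le> 5 \<longrightarrow>
        (Is_aexp h (pair t (pair l r)) \<longleftrightarrow> Is_aexp h l \<and> Is_aexp h r)) \<and>
     (\<forall>t x. 6 \<le> t \<longrightarrow> \<not> Is_aexp h (pair t x))"

definition bexp_tabs :: "(nat \<Rightarrow> nat) \<Rightarrow> bool" where
  "bexp_tabs h \<longleftrightarrow>
     (\<forall>t x. t \<le> 1 \<longrightarrow> (Is_bexp h (pair t x) \<longleftrightarrow> x = 0)) \<and>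
     (\<forall>t l r. 2 \<le> t \<and> t \<le> 4 \<longrightarrow>
        (Is_bexp h (pair t (pair l r)) \<longleftrightarrow> Is_aexp h l \<and> Is_aexp h r)) \<and>
     (\<forall>x. Is_bexp h (pair 5 x) \<longleftrightarrow> Is_bexp h x) \<and>
     (\<forall>t l r. 6 \<le> t \<and> t \<le> 7 \<longrightarrow>
        (Is_bexp h (pair t (pair l r)) \<longleftrightarrow> Is_bexp h l \<and> Is_bexp h r)) \<and>
     (\<forall>t x. 8 \<le> t \<longrightarrow> \<not> Is_bexp h (pair t x))"

definition prog_tabs :: "(nat \<Rightarrow> nat) \<Rightarrow> bool" where
  "prog_tabs h \<longleftrightarrow>
     (\<forall>x. Is_prog h (pair 0 x) \<longleftrightarrow> x = 0) \<and>
     (\<forall>v e. Is_prog h (pair 1 (pair v e)) \<longleftrightarrow> Is_aexp h e) \<and>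
     (\<forall>l r. Is_prog h (pair 2 (pair l r)) \<longleftrightarrow> Is_prog h l \<and> Is_prog h r) \<and>
     (\<forall>l e r. Is_prog h (pair 3 (pair l (pair e r))) \<longleftrightarrow>
        Is_prog h l \<and> Is_aexp h e \<and> Is_prog h r) \<and>
     (\<forall>l r. Is_prog h (pair 4 (pair l r)) \<longleftrightarrow> Is_prog h l \<and> Is_prog h r) \<and>
     (\<forall>b r. Is_prog h (pair 5 (pair b r)) \<longleftrightarrow> Is_bexp h b \<and> Is_prog h r) \<and>
     (\<forall>t x. 6 \<le> t \<longrightarrow> \<not> Is_prog h (pair t x))"

text \<open>Restricted to valid codes because the intended tables pass through
  \<open>dec_prog\<close>, which need not preserve ill-formed codes.\<close>

definition redex_tabs :: "(nat \<Rightarrow> nat) \<Rightarrow> bool" where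
  "redex_tabs h \<longleftrightarrow>
     (\<forall>t x. Is_prog h (pair t x) \<and> t \<noteq> 2 \<longrightarrow> Redex h (pair t x) = pair t x) \<and>
     (\<forall>l r. Is_prog h (pair 2 (pair l r)) \<longrightarrow>
        Redex h (pair 2 (pair l r)) = (if l = 0 then pair 2 (pair l r) else Redex h l)) \<and>
     (\<forall>t x y. Is_prog h (pair t x) \<and> Is_prog h y \<and> t \<noteq> 2 \<longrightarrow> Plug h (pair (pair t x) y) = y) \<and>
     (\<forall>l r y. Is_prog h (pair 2 (pair l r)) \<and> Is_prog h y \<longrightarrow>
        Plug h (pair (pair 2 (pair l r)) y) =
          (if l = 0 then y else pair 2 (pair (Plug h (pair l y)) r)))"

definition aval_tabs :: "(nat \<Rightarrow> nat) \<Rightarrow> bool" where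
  "aval_tabs h \<longleftrightarrow>
     (\<forall>p r. Aval h (pair p (pair 0 r)) = dec_rat r) \<and>
     (\<forall>p v. Aval h (pair p (pair 1 v)) = Var h (pair p v)) \<and>
     (\<forall>p l r. Aval h (pair p (pair 2 (pair l r))) = Aval h (pair p l) + Aval h (pair p r)) \<and>
     (\<forall>p l r. Aval h (pair p (pair 3 (pair l r))) = Aval h (pair p l) - Aval h (pair p r)) \<and>
     (\<forall>p l r. Aval h (pair p (pair 4 (pair l r))) = Aval h (pair p l) * Aval h (pair p r))"

text \<open>Division is characterized through multiplication, for which \<open>crat\<close> has a
  closure rule; a zero divisor yields 0, as in \<open>aval\<close>.\<close>

definition adiv_tabs :: "(nat \<Rightarrow> nat) \<Rightarrow> bool" where
  "adiv_tabs h \<longleftrightarrow>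
     (\<forall>p l r. Aval h (pair p r) = 0 \<longrightarrow> Aval h (pair p (pair 5 (pair l r))) = 0) \<and>
     (\<forall>p l r. Aval h (pair p r) \<noteq> 0 \<longrightarrow>
        Aval h (pair p (pair 5 (pair l r))) * Aval h (pair p r) = Aval h (pair p l))"

definition bval_tabs :: "(nat \<Rightarrow> nat) \<Rightarrow> bool" where
  "bval_tabs h \<longleftrightarrow>
     (\<forall>p x. Bval h (pair p (pair 0 x))) \<and>
     (\<forall>p x. \<not> Bval h (pair p (pair 1 x))) \<and>
     (\<forall>p l r. Bval h (pair p (pair 2 (pair l r))) \<longleftrightarrow> Aval h (pair p l) < Aval h (pair p r)) \<and>
     (\<forall>p l r. Bval h (pair p (pair 3 (pair l r))) \<longleftrightarrow> Aval h (pair p l) \<le> Aval h (pair p r)) \<and>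
     (\<forall>p l r. Bval h (pair p (pair 4 (pair l r))) \<longleftrightarrow> Aval h (pair p l) = Aval h (pair p r)) \<and>
     (\<forall>p x. Bval h (pair p (pair 5 x)) \<longleftrightarrow> \<not> Bval h (pair p x)) \<and>
     (\<forall>p l r. Bval h (pair p (pair 6 (pair l r))) \<longleftrightarrow> Bval h (pair p l) \<and> Bval h (pair p r)) \<and>
     (\<forall>p l r. Bval h (pair p (pair 7 (pair l r))) \<longleftrightarrow> Bval h (pair p l) \<or> Bval h (pair p r))"

definition eval_tabs :: "(nat \<Rightarrow> nat) \<Rightarrow> bool" where
  "eval_tabs h \<longleftrightarrow> aval_tabs h \<and> adiv_tabs h \<and> bval_tabs h"

text \<open>The configurations reachable from the initial one are arranged in a binary tree whose node
  \<open>p\<close> has the children \<open>2 * p + 1\<close> and \<open>2 * p + 2\<close>; away from probabilistic choices the left child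
  gets probability 1 and the right child is irrelevant.\<close>

definition child_tabs :: "(nat \<Rightarrow> nat) \<Rightarrow> bool" where
  "child_tabs h \<longleftrightarrow>
     (\<forall>p q v e u. (q = 2 * p + 1 \<or> q = 2 * p + 2) \<and> Redex h (Prog h p) = pair 1 (pair v e) \<longrightarrow>
        Var h (pair q u) = (if u = v then Aval h (pair p e) else Var h (pair p u))) \<and>
     (\<forall>p q t x u. (q = 2 * p + 1 \<or> q = 2 * p + 2) \<and> Redex h (Prog h p) = pair t x \<and> t \<noteq> 1 \<longrightarrow>
        Var h (pair q u) = Var h (pair p u)) \<and>
     (\<forall>p q t x. (q = 2 * p + 1 \<or> q = 2 * p + 2) \<and> Redex h (Prog h p) = pair t x \<and> t \<noteq> 3 \<and> t \<noteq> 4 \<longrightarrow>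
        Hist h q = Hist h p) \<and>
     (\<forall>p q t x. (q = 2 * p + 1 \<or> q = 2 * p + 2) \<and> Redex h (Prog h p) = pair t x \<and> t \<le> 1 \<longrightarrow>
        Prog h q = Plug h (pair (Prog h p) 0)) \<and>
     (\<forall>p q l r. (q = 2 * p + 1 \<or> q = 2 * p + 2) \<and> Redex h (Prog h p) = pair 2 (pair l r) \<longrightarrow>
        Prog h q = Plug h (pair (Prog h p) r)) \<and>
     (\<forall>p l e r. Redex h (Prog h p) = pair 3 (pair l (pair e r)) \<longrightarrow>
        Prog h (2 * p + 1) = Plug h (pair (Prog h p) l) \<and> Hist h (2 * p + 1) = 5 * Hist h p + 3 \<and>
        Prog h (2 * p + 2) = Plug h (pair (Prog h p) r) \<and> Hist h (2 * p + 2) = 5 * Hist h p + 4) \<and>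
     (\<forall>p q l r. (q = 2 * p + 1 \<or> q = 2 * p + 2) \<and> Redex h (Prog h p) = pair 4 (pair l r) \<longrightarrow>
        Prog h q = Plug h (pair (Prog h p) (if Sched h (Hist h p) = 0 then l else r)) \<and>
        Hist h q = (if Sched h (Hist h p) = 0 then 5 * Hist h p + 1 else 5 * Hist h p + 2)) \<and>
     (\<forall>p q b r. (q = 2 * p + 1 \<or> q = 2 * p + 2) \<and> Redex h (Prog h p) = pair 5 (pair b r) \<longrightarrow>
        Prog h q = Plug h (pair (Prog h p)
          (if Bval h (pair p b) then pair 2 (pair r (pair 5 (pair b r))) else 0)))"

definition cost_tabs :: "(nat \<Rightarrow> nat) \<Rightarrow> bool" where
  "cost_tabs h \<longleftrightarrow>
     (\<forall>p l e r. Redex h (Prog h p) = pair 3 (pair l (pair e r)) \<longrightarrow>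
        LProb h p = (if Aval h (pair p e) \<le> 0 then 0 else if 1 \<le> Aval h (pair p e) then 1
          else Aval h (pair p e))) \<and>
     (\<forall>p t x. Redex h (Prog h p) = pair t x \<and> t \<noteq> 3 \<longrightarrow> LProb h p = 1) \<and>
     (\<forall>p. Cost h (pair 0 p) = 0) \<and>
     (\<forall>k p. Cost h (pair (Suc k) p) = (if Prog h p = 0 then 0
        else 1 + LProb h p * Cost h (pair k (2 * p + 1))
               + (1 - LProb h p) * Cost h (pair k (2 * p + 2))))"

definition root_tabs :: "nat \<Rightarrow> (nat \<Rightarrow> nat) \<Rightarrow> bool" where
  "root_tabs n h \<longleftrightarrow> Prog h 0 = n \<and> Hist h 0 = 0 \<and> (\<forall>v. Var h (pair 0 v) = 0)"

definition syntax_tabs :: "(nat \<Rightarrow> nat) \<Rightarrow> bool" where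
  "syntax_tabs h \<longleftrightarrow> rat_tabs h \<and> aexp_tabs h \<and> bexp_tabs h \<and> prog_tabs h \<and> redex_tabs h"

definition run_tabs :: "nat \<Rightarrow> (nat \<Rightarrow> nat) \<Rightarrow> bool" where
  "run_tabs n h \<longleftrightarrow> root_tabs n h \<and> eval_tabs h \<and> child_tabs h \<and> cost_tabs h"

text \<open>With correct syntax tables, a number that codes no program, or the code 0 of
  \<open>Bot\<close>, falsifies the matrix whatever the rest of the oracle is. This is why validity
  of \<open>n\<close> stands outside the disjunction about the run tables.\<close>

definition PAST_matrix :: "nat \<Rightarrow> (nat \<Rightarrow> nat) \<Rightarrow> bool" where
  "PAST_matrix n h \<longleftrightarrow> \<not> syntax_tabs h \<or> (Is_prog h n \<and> n \<noteq> 0 \<and>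
     (\<not> run_tabs n h \<or> (\<exists>N. Cost h (pair (Horizon h N) 0) \<le> of_nat N)))"

text \<open>Each table condition is a block of number quantifiers over a decidable matrix. The
  closure rules first split quantifiers and conjunctions and only then pass the matrix to
  \<open>cpred\<close>.\<close>

lemma closed_rel_rat_tabs: "closed_rel (\<lambda>c h. rat_tabs h)"
  unfolding rat_tabs_def
  by (rule closed_rel_all closed_rel_conj | rule closed_rel_cpred
      | rule cpred_rules crat_rules crec_rules)+

lemma closed_rel_aexp_tabs: "closed_rel (\<lambda>c h. aexp_tabs h)"
  unfolding aexp_tabs_def
  by (rule closed_rel_all closed_rel_conj | rule closed_rel_cpred
      | rule cpred_rules crat_rules crec_rules)+

lemma closed_rel_bexp_tabs: "closed_rel (\<lambda>c h. bexp_tabs h)"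
  unfolding bexp_tabs_def
  by (rule closed_rel_all closed_rel_conj | rule closed_rel_cpred
      | rule cpred_rules crat_rules crec_rules)+

lemma closed_rel_prog_tabs: "closed_rel (\<lambda>c h. prog_tabs h)"
  unfolding prog_tabs_def
  by (rule closed_rel_all closed_rel_conj | rule closed_rel_cpred
      | rule cpred_rules crat_rules crec_rules)+

lemma closed_rel_redex_tabs: "closed_rel (\<lambda>c h. redex_tabs h)"
  unfolding redex_tabs_def
  by (rule closed_rel_all closed_rel_conj | rule closed_rel_cpred
      | rule cpred_rules crat_rules crec_rules)+

lemma closed_rel_eval_tabs: "closed_rel (\<lambda>c h. eval_tabs h)"
  unfolding eval_tabs_def aval_tabs_def adiv_tabs_def bval_tabs_def
  by (rule closed_rel_all closed_rel_conj | rule closed_rel_cpred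
      | rule cpred_rules crat_rules crec_rules)+

lemma closed_rel_child_tabs: "closed_rel (\<lambda>c h. child_tabs h)"
  unfolding child_tabs_def
  by (rule closed_rel_all closed_rel_conj | rule closed_rel_cpred
      | rule cpred_rules crat_rules crec_rules)+

lemma closed_rel_cost_tabs: "closed_rel (\<lambda>c h. cost_tabs h)"
  unfolding cost_tabs_def
  by (rule closed_rel_all closed_rel_conj | rule closed_rel_cpred
      | rule cpred_rules crat_rules crec_rules)+

lemma closed_rel_root_tabs: "closed_rel root_tabs"
  unfolding root_tabs_def[abs_def]
  by (rule closed_rel_all closed_rel_conj | rule closed_rel_cpred
      | rule cpred_rules crat_rules crec_rules)+

lemma open_rel_PAST_matrix: "open_rel PAST_matrix"
proof -
  have "open_rel (\<lambda>c h. \<not> syntax_tabs h)"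
    unfolding closed_rel_def[symmetric] syntax_tabs_def
    by (intro closed_rel_conj closed_rel_rat_tabs closed_rel_aexp_tabs closed_rel_bexp_tabs
        closed_rel_prog_tabs closed_rel_redex_tabs)
  moreover have "open_rel (\<lambda>c h. \<not> run_tabs c h)"
    unfolding closed_rel_def[symmetric] run_tabs_def
    by (intro closed_rel_conj closed_rel_root_tabs closed_rel_eval_tabs closed_rel_child_tabs
        closed_rel_cost_tabs)
  moreover have "open_rel (\<lambda>c h. Is_prog h c)" "open_rel (\<lambda>c h. c \<noteq> 0)"
    by (rule open_rel_cpred, (rule cpred_rules crec_rules)+)+
  moreover have "open_rel (\<lambda>c h. \<exists>N. Cost h (pair (Horizon h N) 0) \<le> of_nat N)"
    by (rule open_rel_ex, rule open_rel_cpred, (rule cpred_rules crat_rules crec_rules)+)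
  ultimately show ?thesis
    unfolding PAST_matrix_def[abs_def] by (intro open_rel_disj open_rel_conj)
qed

section \<open>Soundness of the table conditions\<close>

lemma pair_less: "t \<noteq> 0 \<Longrightarrow> x < pair t x"
  using psnd_less[of "pair t x"] by simp

lemma pair_pair_less: "t \<noteq> 0 \<Longrightarrow> l < pair t (pair l r)" "t \<noteq> 0 \<Longrightarrow> r < pair t (pair l r)"
  using pfst_psnd_less[of "pair t (pair l r)"] psnd_psnd_less[of "pair t (pair l r)"] by simp_all

lemma pair_pair_pair_less: "t \<noteq> 0 \<Longrightarrow> r < pair t (pair l (pair e r))"
  using psnd_psnd_psnd_less[of "pair t (pair l (pair e r))"] by simp

lemma pair_cases: obtains a b where "c = pair a b"
  by (metis prod_encode_pfst_psnd)

lemma pair_eq_0_iff: "pair a b = 0 \<longleftrightarrow> a = 0 \<and> b = 0"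
proof -
  have "pair 0 0 = 0" by (simp add: prod_encode_def)
  then show ?thesis by (metis prod_encode_eq prod.inject)
qed

lemma enc_prog_eq_0_iff: "enc_prog P = 0 \<longleftrightarrow> P = Bot"
  by (cases P) (auto simp: pair_eq_0_iff)

lemma dec_prog_0: "dec_prog 0 = Bot"
  by (metis dec_prog_enc_prog enc_prog_eq_0_iff)

text \<open>As \<open>dec_aexp\<close> is a left inverse of \<open>enc_aexp\<close>, the fixed
  points of the round trip are exactly the genuine codes.\<close>

definition aexp_code :: "nat \<Rightarrow> bool" where
  "aexp_code c \<longleftrightarrow> enc_aexp (dec_aexp c) = c"

definition bexp_code :: "nat \<Rightarrow> bool" where
  "bexp_code c \<longleftrightarrow> enc_bexp (dec_bexp c) = c"

definition prog_code :: "nat \<Rightarrow> bool" where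
  "prog_code c \<longleftrightarrow> enc_prog (dec_prog c) = c"

lemma aexp_code_pair:
  "aexp_code (pair 0 x) \<longleftrightarrow> enc_rat (dec_rat x) = x"
  "aexp_code (pair (Suc 0) x)"
  "2 \<le> t \<Longrightarrow> t \<le> 5 \<Longrightarrow> aexp_code (pair t (pair l r)) \<longleftrightarrow> aexp_code l \<and> aexp_code r"
  "6 \<le> t \<Longrightarrow> \<not> aexp_code (pair t x)"
proof -
  assume "2 \<le> t" "t \<le> 5"
  then have "t = 2 \<or> t = 3 \<or> t = 4 \<or> t = 5" by linarith
  then show "aexp_code (pair t (pair l r)) \<longleftrightarrow> aexp_code l \<and> aexp_code r"
    by (auto simp: aexp_code_def)
next
  assume "6 \<le> t"
  then show "\<not> aexp_code (pair t x)"
    by (subst aexp_code_def, subst dec_aexp.simps) (simp add: Let_def)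
qed (simp_all add: aexp_code_def)

lemma bexp_code_pair:
  "t \<le> 1 \<Longrightarrow> bexp_code (pair t x) \<longleftrightarrow> x = 0"
  "2 \<le> t \<Longrightarrow> t \<le> 4 \<Longrightarrow> bexp_code (pair t (pair l r)) \<longleftrightarrow> aexp_code l \<and> aexp_code r"
  "bexp_code (pair 5 x) \<longleftrightarrow> bexp_code x"
  "6 \<le> t \<Longrightarrow> t \<le> 7 \<Longrightarrow> bexp_code (pair t (pair l r)) \<longleftrightarrow> bexp_code l \<and> bexp_code r"
  "8 \<le> t \<Longrightarrow> \<not> bexp_code (pair t x)"
proof -
  assume "t \<le> 1"
  then have "t = 0 \<or> t = 1" by linarith
  then show "bexp_code (pair t x) \<longleftrightarrow> x = 0" by (auto simp: bexp_code_def)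
next
  assume "2 \<le> t" "t \<le> 4"
  then have "t = 2 \<or> t = 3 \<or> t = 4" by linarith
  then show "bexp_code (pair t (pair l r)) \<longleftrightarrow> aexp_code l \<and> aexp_code r"
    by (auto simp: bexp_code_def aexp_code_def)
next
  assume "6 \<le> t" "t \<le> 7"
  then have "t = 6 \<or> t = 7" by linarith
  then show "bexp_code (pair t (pair l r)) \<longleftrightarrow> bexp_code l \<and> bexp_code r"
    by (auto simp: bexp_code_def)
next
  assume "8 \<le> t"
  then show "\<not> bexp_code (pair t x)"
    by (subst bexp_code_def, subst dec_bexp.simps) (simp add: Let_def)
qed (simp add: bexp_code_def)

lemma prog_code_pair:
  "prog_code (pair 0 x) \<longleftrightarrow> x = 0"
  "prog_code (pair (Suc 0) (pair v e)) \<longleftrightarrow> aexp_code e"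
  "prog_code (pair 2 (pair l r)) \<longleftrightarrow> prog_code l \<and> prog_code r"
  "prog_code (pair 3 (pair l (pair e r))) \<longleftrightarrow> prog_code l \<and> aexp_code e \<and> prog_code r"
  "prog_code (pair 4 (pair l r)) \<longleftrightarrow> prog_code l \<and> prog_code r"
  "prog_code (pair 5 (pair b r)) \<longleftrightarrow> bexp_code b \<and> prog_code r"
  "6 \<le> t \<Longrightarrow> \<not> prog_code (pair t x)"
proof -
  assume "6 \<le> t"
  then show "\<not> prog_code (pair t x)"
    by (subst prog_code_def, subst dec_prog.simps) (simp add: Let_def)
qed (auto simp: prog_code_def aexp_code_def bexp_code_def)

text \<open>The true reduced code competes in the minimality condition, so the entry has no larger
  denominator, and \<open>enc_rat_unique\<close> identifies the two.\<close>

lemma Reduced_eq: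
  assumes "rat_tabs h"
  shows "Reduced h r = enc_rat (dec_rat r)"
proof (rule enc_rat_unique)
  show "0 < psnd (Reduced h r)" "dec_rat (Reduced h r) = dec_rat r"
    using assms by (auto simp: rat_tabs_def)
  show "psnd (Reduced h r) \<le> psnd (enc_rat (dec_rat r))"
    using assms psnd_enc_rat_pos[of "dec_rat r"] unfolding rat_tabs_def by simp
qed

text \<open>The conditions trace an entry back to entries at smaller codes, so induction on the code
  shows that they determine the table.\<close>

lemma Is_aexp_iff:
  assumes "rat_tabs h" "aexp_tabs h"
  shows "Is_aexp h c \<longleftrightarrow> aexp_code c"
proof (induction c rule: less_induct)
  case (less c)
  obtain t x where c: "c = pair t x" by (rule pair_cases)
  obtain l r where x: "x = pair l r" by (rule pair_cases)
  consider "t = 0" | "t = 1" | "2 \<le> t" "t \<le> 5" | "6 \<le> t" by linarith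
  then show ?case
  proof cases
    case 1
    then show ?thesis using assms(2) Reduced_eq[OF assms(1)]
      by (simp add: aexp_tabs_def c aexp_code_pair)
  next
    case 2
    then show ?thesis using assms(2) by (simp add: aexp_tabs_def c aexp_code_pair)
  next
    case 3
    have "Is_aexp h c \<longleftrightarrow> Is_aexp h l \<and> Is_aexp h r"
      using assms(2) 3 by (simp add: aexp_tabs_def c x)
    moreover have "l < c" "r < c" using 3 pair_pair_less[of t] by (simp_all add: c x)
    ultimately show ?thesis using less.IH 3 by (simp add: c x aexp_code_pair)
  next
    case 4
    then show ?thesis using assms(2) by (simp add: aexp_tabs_def c aexp_code_pair)
  qed
qed

lemma Is_bexp_iff:
  assumes "rat_tabs h" "aexp_tabs h" "bexp_tabs h"
  shows "Is_bexp h c \<longleftrightarrow> bexp_code c"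
proof (induction c rule: less_induct)
  case (less c)
  obtain t x where c: "c = pair t x" by (rule pair_cases)
  obtain l r where x: "x = pair l r" by (rule pair_cases)
  have less: "t \<noteq> 0 \<Longrightarrow> Is_bexp h x \<longleftrightarrow> bexp_code x" "t \<noteq> 0 \<Longrightarrow> Is_bexp h l \<longleftrightarrow> bexp_code l"
    "t \<noteq> 0 \<Longrightarrow> Is_bexp h r \<longleftrightarrow> bexp_code r"
    using less.IH pair_less[of t x] pair_pair_less(1)[of t l r] pair_pair_less(2)[of t r l] by (simp_all add: c x)
  note Is_aexp_iff[OF assms(1,2), simp]
  consider "t \<le> 1" | "2 \<le> t" "t \<le> 4" | "t = 5" | "6 \<le> t" "t \<le> 7" | "8 \<le> t" by linarith
  then show ?case
  proof cases
    case 1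
    then show ?thesis using assms(3) by (simp add: bexp_tabs_def c bexp_code_pair)
  next
    case 2
    have "Is_bexp h c \<longleftrightarrow> Is_aexp h l \<and> Is_aexp h r"
      using assms(3) 2 unfolding bexp_tabs_def c x by blast
    then show ?thesis using 2 by (simp add: c x bexp_code_pair)
  next
    case 3
    then show ?thesis using assms(3) less by (simp add: bexp_tabs_def c bexp_code_pair)
  next
    case 4
    have "Is_bexp h c \<longleftrightarrow> Is_bexp h l \<and> Is_bexp h r"
      using assms(3) 4 unfolding bexp_tabs_def c x by blast
    then show ?thesis using 4 less by (simp add: c x bexp_code_pair)
  next
    case 5
    then show ?thesis using assms(3) unfolding bexp_tabs_def c by (simp add: bexp_code_pair)
  qed
qed

lemma Is_prog_iff:
  assumes "rat_tabs h" "aexp_tabs h" "bexp_tabs h" "prog_tabs h"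
  shows "Is_prog h c \<longleftrightarrow> prog_code c"
proof (induction c rule: less_induct)
  case (less c)
  obtain t x where c: "c = pair t x" by (rule pair_cases)
  obtain l r where x: "x = pair l r" by (rule pair_cases)
  obtain e s where r: "r = pair e s" by (rule pair_cases)
  have less: "t \<noteq> 0 \<Longrightarrow> Is_prog h l \<longleftrightarrow> prog_code l"
    "t \<noteq> 0 \<Longrightarrow> Is_prog h r \<longleftrightarrow> prog_code r" "t \<noteq> 0 \<Longrightarrow> Is_prog h s \<longleftrightarrow> prog_code s"
    using less.IH pair_pair_less(1)[of t l r] pair_pair_less(2)[of t r l]
      pair_pair_pair_less[of t s l e] by (simp_all add: c x r)
  note [simp] = Is_aexp_iff[OF assms(1,2)] Is_bexp_iff[OF assms(1-3)]
  consider "t = 0" | "t = 1" | "t = 2" | "t = 3" | "t = 4" | "t = 5" | "6 \<le> t" by linarith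
  then show ?case
  proof cases
    case 4
    have "Is_prog h c \<longleftrightarrow> Is_prog h l \<and> Is_aexp h e \<and> Is_prog h s"
      using assms(4) 4 unfolding prog_tabs_def c x r by blast
    then show ?thesis using 4 less by (simp add: c x r prog_code_pair)
  qed (use assms(4) less in \<open>simp_all add: prog_tabs_def c x prog_code_pair\<close>)
qed

lemma codes_enc [simp]: "aexp_code (enc_aexp e)" "bexp_code (enc_bexp b)" "prog_code (enc_prog P)"
  by (simp_all add: aexp_code_def bexp_code_def prog_code_def)

lemma Redex_enc:
  assumes "syntax_tabs h"
  shows "Redex h (enc_prog P) = enc_prog (redex P)"
proof (induction P)
  case (Seq P Q)
  have "Is_prog h (enc_prog (Seq P Q))"
    using assms Is_prog_iff[of h] by (simp add: syntax_tabs_def del: enc_prog.simps)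
  then show ?case using assms Seq
    by (auto simp: syntax_tabs_def redex_tabs_def enc_prog_eq_0_iff)
next
  case Bot
  have "Is_prog h (enc_prog Bot)"
    using assms Is_prog_iff[of h] by (simp add: syntax_tabs_def del: enc_prog.simps)
  then show ?case using assms unfolding syntax_tabs_def redex_tabs_def by auto
next
  case (Assign v e)
  have "Is_prog h (enc_prog (Assign v e))"
    using assms Is_prog_iff[of h] by (simp add: syntax_tabs_def del: enc_prog.simps)
  then show ?case using assms unfolding syntax_tabs_def redex_tabs_def by auto
next
  case (PChoice P p Q)
  have "Is_prog h (enc_prog (PChoice P p Q))"
    using assms Is_prog_iff[of h] by (simp add: syntax_tabs_def del: enc_prog.simps)
  then show ?case using assms unfolding syntax_tabs_def redex_tabs_def by auto
next
  case (NChoice P Q)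
  have "Is_prog h (enc_prog (NChoice P Q))"
    using assms Is_prog_iff[of h] by (simp add: syntax_tabs_def del: enc_prog.simps)
  then show ?case using assms unfolding syntax_tabs_def redex_tabs_def by auto
next
  case (While b P)
  have "Is_prog h (enc_prog (While b P))"
    using assms Is_prog_iff[of h] by (simp add: syntax_tabs_def del: enc_prog.simps)
  then show ?case using assms unfolding syntax_tabs_def redex_tabs_def by auto
qed

lemma Plug_enc:
  assumes "syntax_tabs h"
  shows "Plug h (pair (enc_prog P) (enc_prog X)) = enc_prog (plug P X)"
proof -
  have prog: "Is_prog h (enc_prog Q)" for Q
    using assms Is_prog_iff[of h] by (simp add: syntax_tabs_def)
  have leaf: "Plug h (pair (pair t x) (enc_prog X)) = enc_prog X"
    if "enc_prog Q = pair t x" "t \<noteq> 2" for Q t x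
    using assms that prog[of Q] prog[of X] by (simp add: syntax_tabs_def redex_tabs_def)
  have node: "Plug h (pair (enc_prog (Seq P Q)) (enc_prog X)) =
      (if P = Bot then enc_prog X else pair 2 (pair (Plug h (pair (enc_prog P) (enc_prog X))) (enc_prog Q)))"
    for P Q
    using assms prog[of "Seq P Q"] prog[of X]
    by (simp add: syntax_tabs_def redex_tabs_def enc_prog_eq_0_iff)
  show ?thesis
  proof (induction P)
    case (Seq P Q)
    show ?case by (simp only: node) (use Seq in simp)
  qed (simp_all add: leaf[OF enc_prog.simps(1)] leaf[OF enc_prog.simps(2), simplified]
      leaf[OF enc_prog.simps(4)] leaf[OF enc_prog.simps(5)] leaf[OF enc_prog.simps(6)])
qed

fun dir_code :: "dir \<Rightarrow> nat" where
  "dir_code Ln = 1" | "dir_code Rn = 2" | "dir_code Lp = 3" | "dir_code Rp = 4"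

text \<open>Base 5 with digits 1 to 4: as the digit 0 does not occur, histories of different length
  cannot collide, and recording a letter is plain arithmetic on the code.\<close>

definition hist_code :: "dir list \<Rightarrow> nat" where
  "hist_code w = foldl (\<lambda>c d. 5 * c + dir_code d) 0 w"

lemma hist_code_simps [simp]: "hist_code [] = 0" "hist_code (w @ [d]) = 5 * hist_code w + dir_code d"
  by (simp_all add: hist_code_def)

lemma dir_code_bounds: "0 < dir_code d" "dir_code d < 5"
  by (cases d; simp)+

lemma inj_hist_code: "inj hist_code"
proof (rule injI)
  show "hist_code u = hist_code w \<Longrightarrow> u = w" for u w
  proof (induction u arbitrary: w rule: rev_induct)
    case Nil
    then show ?case by (cases w rule: rev_cases) (auto simp: dir_code_bounds(1)[THEN gr_implies_not0])
  next
    case (snoc d u)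
    show ?case
    proof (cases w rule: rev_cases)
      case Nil
      then show ?thesis using snoc.prems dir_code_bounds(1)[of d] by simp
    next
      case (snoc v e)
      have eq: "5 * hist_code u + dir_code d = 5 * hist_code v + dir_code e"
        using snoc.prems snoc by simp
      have "(5 * a + dir_code x) mod 5 = dir_code x" for a x
        using dir_code_bounds(2)[of x] by simp
      then have codes: "dir_code d = dir_code e" using eq by metis
      then have "d = e" by (cases d; cases e) simp_all
      moreover have "u = v" using snoc.IH eq codes by simp
      ultimately show ?thesis using snoc by simp
    qed
  qed
qed

definition scheduler_of :: "(nat \<Rightarrow> nat) \<Rightarrow> scheduler" where
  "scheduler_of h w = (if Sched h (hist_code w) = 0 then Ln else Rn)"

lemma scheduler_of_schedulers: "scheduler_of h \<in> schedulers"
  by (simp add: schedulers_def scheduler_of_def)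

definition represents :: "(nat \<Rightarrow> nat) \<Rightarrow> nat \<Rightarrow> pstate \<Rightarrow> bool" where
  "represents h p s \<longleftrightarrow> (case s of (P, \<eta>, w) \<Rightarrow>
     Prog h p = enc_prog P \<and> Hist h p = hist_code w \<and> (\<forall>v. Var h (pair p v) = \<eta> v))"

lemma Aval_enc:
  assumes "eval_tabs h" "\<And>v. Var h (pair p v) = \<eta> v"
  shows "Aval h (pair p (enc_aexp e)) = aval e \<eta>"
proof -
  have aval: "aval_tabs h" and adiv: "adiv_tabs h"
    using assms(1) by (simp_all add: eval_tabs_def)
  note ev = aval[unfolded aval_tabs_def One_nat_def]
  show ?thesis
  proof (induction e)
    case (ADiv l r)
    show ?case
    proof (cases "aval r \<eta> = 0")
      case True
      then have "Aval h (pair p (enc_aexp r)) = 0" by (simp add: ADiv)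
      with adiv[unfolded adiv_tabs_def, THEN conjunct1] True show ?thesis by simp
    next
      case False
      then have "Aval h (pair p (enc_aexp r)) \<noteq> 0" by (simp add: ADiv)
      from adiv[unfolded adiv_tabs_def, THEN conjunct2, rule_format, OF this, of "enc_aexp l"]
      show ?thesis using False by (simp add: ADiv field_simps)
    qed
  qed (simp_all add: ev assms(2))
qed

lemma Bval_enc:
  assumes "eval_tabs h" "\<And>v. Var h (pair p v) = \<eta> v"
  shows "Bval h (pair p (enc_bexp b)) \<longleftrightarrow> bval b \<eta>"
proof -
  have "bval_tabs h" using assms(1) by (simp add: eval_tabs_def)
  note ev = this[unfolded bval_tabs_def One_nat_def]
  show ?thesis
    by (induction b) (simp_all add: ev Aval_enc[OF assms])
qed

text \<open>For redexes other than \<open>PChoice\<close> the conditions treat both children alike,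
  in accordance with \<open>succ\<close>, which looks at the branch \<open>l\<close> only at a
  \<open>PChoice\<close>.\<close>

lemma represents_succ:
  assumes "syntax_tabs h" "eval_tabs h" "child_tabs h" "represents h p s"
  shows "represents h (if l then 2 * p + 1 else 2 * p + 2) (succ (scheduler_of h) l s)"
proof -
  obtain P \<eta> w where s: "s = (P, \<eta>, w)" by (cases s)
  define q where "q = (if l then 2 * p + 1 else 2 * p + 2)"
  have q: "q = 2 * p + 1 \<or> q = 2 * p + 2" by (simp add: q_def)
  note c = assms(3)[unfolded child_tabs_def]
  note c1 = c[THEN conjunct1, rule_format] and d1 = c[THEN conjunct2]
  note c2 = d1[THEN conjunct1, rule_format] and d2 = d1[THEN conjunct2]
  note c3 = d2[THEN conjunct1, rule_format] and d3 = d2[THEN conjunct2]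
  note c4 = d3[THEN conjunct1, rule_format] and d4 = d3[THEN conjunct2]
  note c5 = d4[THEN conjunct1, rule_format] and d5 = d4[THEN conjunct2]
  note c6 = d5[THEN conjunct1, rule_format] and d6 = d5[THEN conjunct2]
  note c7 = d6[THEN conjunct1, rule_format] and c8 = d6[THEN conjunct2, rule_format]
  have rep: "Prog h p = enc_prog P" "Hist h p = hist_code w" "\<And>v. Var h (pair p v) = \<eta> v"
    using assms(4) by (auto simp: represents_def s)
  have R: "Redex h (Prog h p) = enc_prog (redex P)"
    by (simp add: rep Redex_enc[OF assms(1)])
  have var: "Var h (pair q u) = \<eta> u"
    if "Redex h (Prog h p) = pair t x" "t \<noteq> 1" for t x u
    using c2[OF conjI[OF q conjI[OF that]]] rep(3) by simp
  have hist: "Hist h q = hist_code w"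
    if "Redex h (Prog h p) = pair t x" "t \<noteq> 3" "t \<noteq> 4" for t x
    using c3[OF conjI[OF q conjI[OF that(1) conjI[OF that(2,3)]]]] rep(2) by simp
  have plug0: "Prog h q = enc_prog (plug P Bot)"
    if "Redex h (Prog h p) = pair t x" "t \<le> 1" for t x
  proof -
    have "Prog h q = Plug h (pair (Prog h p) 0)"
      by (rule c4[OF conjI[OF q conjI[OF that]]])
    then show ?thesis
      using Plug_enc[OF assms(1), of P Bot] enc_prog_eq_0_iff[of Bot] by (simp add: rep)
  qed
  note A = Aval_enc[OF assms(2), of p \<eta>, OF rep(3)]
  note B = Bval_enc[OF assms(2), of p \<eta>, OF rep(3)]
  have "represents h q (succ (scheduler_of h) l s)"
  proof (cases "redex P")
    case Bot
    then have R': "Redex h (Prog h p) = pair 0 0" using R by simp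
    show ?thesis
      using var[OF R'] hist[OF R'] plug0[OF R'] Bot by (simp add: represents_def s)
  next
    case (Assign v e)
    then have R': "Redex h (Prog h p) = pair 1 (pair v (enc_aexp e))" using R by simp
    have "Var h (pair q u) = (if u = v then Aval h (pair p (enc_aexp e)) else Var h (pair p u))" for u
      by (rule c1[OF conjI[OF q R']])
    then have "Var h (pair q u) = (\<eta>(v := aval e \<eta>)) u" for u by (simp add: A rep)
    then show ?thesis
      using hist[OF R'] plug0[OF R'] Assign by (simp add: represents_def s)
  next
    case (Seq A B)
    then have R': "Redex h (Prog h p) = pair 2 (pair (enc_prog A) (enc_prog B))" using R by simp
    have "Prog h q = Plug h (pair (Prog h p) (enc_prog B))"
      by (rule c5[OF conjI[OF q R']])
    then show ?thesis
      using var[OF R'] hist[OF R'] Seq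
      by (simp add: represents_def s rep Plug_enc[OF assms(1)])
  next
    case (PChoice A e B)
    then have R': "Redex h (Prog h p) = pair 3 (pair (enc_prog A) (pair (enc_aexp e) (enc_prog B)))"
      using R by simp
    have "Prog h (2 * p + 1) = Plug h (pair (Prog h p) (enc_prog A)) \<and>
        Hist h (2 * p + 1) = 5 * Hist h p + 3 \<and>
        Prog h (2 * p + 2) = Plug h (pair (Prog h p) (enc_prog B)) \<and>
        Hist h (2 * p + 2) = 5 * Hist h p + 4"
      by (rule c6[OF R'])
    then show ?thesis
      using var[OF R'] PChoice
      by (auto simp: represents_def s rep Plug_enc[OF assms(1)] q_def)
  next
    case (NChoice A B)
    then have R': "Redex h (Prog h p) = pair 4 (pair (enc_prog A) (enc_prog B))" using R by simp
    have "Prog h q = Plug h (pair (Prog h p) (if Sched h (Hist h p) = 0 then enc_prog A else enc_prog B)) \<and>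
        Hist h q = (if Sched h (Hist h p) = 0 then 5 * Hist h p + 1 else 5 * Hist h p + 2)"
      by (rule c7[OF conjI[OF q R']])
    then show ?thesis
      using var[OF R'] NChoice
      by (simp add: represents_def s rep Plug_enc[OF assms(1)] scheduler_of_def)
  next
    case (While b A)
    then have R': "Redex h (Prog h p) = pair 5 (pair (enc_bexp b) (enc_prog A))" using R by simp
    have "Prog h q = Plug h (pair (Prog h p) (if Bval h (pair p (enc_bexp b))
        then pair 2 (pair (enc_prog A) (pair 5 (pair (enc_bexp b) (enc_prog A)))) else 0))"
      by (rule c8[OF conjI[OF q R']])
    then have "Prog h q = Plug h (pair (Prog h p)
        (enc_prog (if bval b \<eta> then Seq A (While b A) else Bot)))"
      using enc_prog_eq_0_iff[of Bot] by (simp add: B)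
    then show ?thesis
      using var[OF R'] hist[OF R'] While
      by (simp add: represents_def s rep Plug_enc[OF assms(1)])
  qed
  then show ?thesis by (simp only: q_def)
qed

lemma LProb_eq:
  assumes "syntax_tabs h" "eval_tabs h" "cost_tabs h" "represents h p (P, \<eta>, w)"
  shows "LProb h p = lprob P \<eta>"
proof -
  have rep: "Prog h p = enc_prog P" "\<And>v. Var h (pair p v) = \<eta> v"
    using assms(4) by (auto simp: represents_def)
  have R: "Redex h (Prog h p) = enc_prog (redex P)"
    by (simp add: rep Redex_enc[OF assms(1)])
  have one: "LProb h p = 1" if "Redex h (Prog h p) = pair t x" "t \<noteq> 3" for t x
    using assms(3)[unfolded cost_tabs_def, THEN conjunct2, THEN conjunct1, rule_format] that by simp
  show ?thesis
  proof (cases "redex P")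
    case (PChoice A e B)
    then have R': "Redex h (Prog h p) = pair 3 (pair (enc_prog A) (pair (enc_aexp e) (enc_prog B)))"
      using R by simp
    have "LProb h p = (if Aval h (pair p (enc_aexp e)) \<le> 0 then 0
        else if 1 \<le> Aval h (pair p (enc_aexp e)) then 1 else Aval h (pair p (enc_aexp e)))"
      by (rule assms(3)[unfolded cost_tabs_def, THEN conjunct1, rule_format, OF R'])
    then show ?thesis
      using PChoice by (simp add: lprob_def Aval_enc[OF assms(2) rep(2)])
  qed (use one R in \<open>simp_all add: lprob_def\<close>)
qed

lemma Cost_eq:
  assumes "syntax_tabs h" "eval_tabs h" "child_tabs h" "cost_tabs h" "represents h p s"
  shows "Cost h (pair k p) = cost (scheduler_of h) k s"
  using assms(5)
proof (induction k arbitrary: p s)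
  case 0
  then show ?case using assms(4) by (simp add: cost_tabs_def)
next
  case (Suc k)
  obtain P \<eta> w where s: "s = (P, \<eta>, w)" by (cases s)
  have "Prog h p = enc_prog P" using Suc.prems by (simp add: represents_def s)
  moreover have "Cost h (pair k (2 * p + 1)) = cost (scheduler_of h) k (succ (scheduler_of h) True s)"
    using represents_succ[OF assms(1-3) Suc.prems, of True] by (intro Suc.IH) simp
  moreover have "Cost h (pair k (2 * p + 2)) = cost (scheduler_of h) k (succ (scheduler_of h) False s)"
    using represents_succ[OF assms(1-3) Suc.prems, of False] by (intro Suc.IH) simp
  moreover have "LProb h p = lprob P \<eta>"
    using LProb_eq[OF assms(1,2,4)] Suc.prems by (simp add: s)
  moreover have "Cost h (pair (Suc k) p) = (if Prog h p = 0 then 0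
        else 1 + LProb h p * Cost h (pair k (2 * p + 1))
               + (1 - LProb h p) * Cost h (pair k (2 * p + 2)))"
    using assms(4) unfolding cost_tabs_def by simp
  ultimately show ?case by (simp add: s enc_prog_eq_0_iff del: succ.simps)
qed

lemma PAST_imp_PAST_matrix:
  assumes "P \<in> PAST"
  shows "PAST_matrix (enc_prog P) h"
proof -
  have P: "P \<noteq> Bot" "\<And>f. f \<in> schedulers \<Longrightarrow> \<exists>N::nat. \<forall>k. cost f k (P, \<lambda>_. 0, []) \<le> of_nat N"
    using assms by (auto simp: PAST_iff)
  have "Is_prog h (enc_prog P)" if "syntax_tabs h"
    using that Is_prog_iff[of h] by (simp add: syntax_tabs_def)
  moreover have "\<exists>N. Cost h (pair (Horizon h N) 0) \<le> of_nat N"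
    if "syntax_tabs h" "run_tabs (enc_prog P) h"
  proof -
    have "represents h 0 (P, \<lambda>_. 0, [])"
      using that by (simp add: represents_def run_tabs_def root_tabs_def)
    from Cost_eq[OF that(1) _ _ _ this] that(2)
    have "Cost h (pair k 0) = cost (scheduler_of h) k (P, \<lambda>_. 0, [])" for k
      by (simp add: run_tabs_def)
    then show ?thesis using P(2)[OF scheduler_of_schedulers] by metis
  qed
  ultimately show ?thesis using P(1) by (auto simp: PAST_matrix_def enc_prog_eq_0_iff)
qed

section \<open>The intended oracle\<close>

fun node :: "scheduler \<Rightarrow> prog \<Rightarrow> nat \<Rightarrow> pstate" where
  "node f P 0 = (P, \<lambda>_. 0, [])"
| "node f P (Suc p) = succ f (even p) (node f P (p div 2))"

text \<open>With parent \<open>p div 2\<close>, node \<open>Suc p\<close> is a left child exactly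
  for even \<open>p\<close>; this inverts the numbering of the tables.\<close>

lemma node_children:
  "node f P (Suc (2 * p)) = succ f True (node f P p)"
  "node f P (Suc (Suc (2 * p))) = succ f False (node f P p)"
  by simp_all

declare node.simps(2) [simp del]

text \<open>Oracles are arbitrary functions, so these tables may use choice (\<open>inv\<close>,
  \<open>code_rat\<close>) and need not be computable. The order of the list is the numbering of the
  table abbreviations.\<close>

definition run_oracle :: "scheduler \<Rightarrow> (nat \<Rightarrow> nat) \<Rightarrow> prog \<Rightarrow> nat \<Rightarrow> nat" where
  "run_oracle f K P = join_tabs
     [\<lambda>x. if f (inv hist_code x) = Ln then 0 else 1,
      K,
      \<lambda>r. enc_rat (dec_rat r),
      \<lambda>c. of_bool (aexp_code c),
      \<lambda>c. of_bool (bexp_code c),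
      \<lambda>c. of_bool (prog_code c),
      \<lambda>c. enc_prog (redex (dec_prog c)),
      \<lambda>z. enc_prog (plug (dec_prog (pfst z)) (dec_prog (psnd z))),
      \<lambda>p. enc_prog (fst (node f P p)),
      \<lambda>z. code_rat (fst (snd (node f P (pfst z))) (psnd z)),
      \<lambda>p. hist_code (snd (snd (node f P p))),
      \<lambda>z. code_rat (aval (dec_aexp (psnd z)) (fst (snd (node f P (pfst z))))),
      \<lambda>z. of_bool (bval (dec_bexp (psnd z)) (fst (snd (node f P (pfst z))))),
      \<lambda>p. code_rat (lprob (fst (node f P p)) (fst (snd (node f P p)))),
      \<lambda>z. code_rat (cost f (pfst z) (node f P (psnd z)))]"

lemma run_oracle_tabs:
  fixes f K P defines "h \<equiv> run_oracle f K P"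
  shows "Sched h (hist_code w) = (if f w = Ln then 0 else 1)"
    and "Horizon h x = K x"
    and "Reduced h x = enc_rat (dec_rat x)"
    and "Is_aexp h x \<longleftrightarrow> aexp_code x"
    and "Is_bexp h x \<longleftrightarrow> bexp_code x"
    and "Is_prog h x \<longleftrightarrow> prog_code x"
    and "Redex h x = enc_prog (redex (dec_prog x))"
    and "Plug h (pair x y) = enc_prog (plug (dec_prog x) (dec_prog y))"
    and "Prog h x = enc_prog (fst (node f P x))"
    and "Var h (pair x y) = fst (snd (node f P x)) y"
    and "Hist h x = hist_code (snd (snd (node f P x)))"
    and "Aval h (pair x y) = aval (dec_aexp y) (fst (snd (node f P x)))"
    and "Bval h (pair x y) \<longleftrightarrow> bval (dec_bexp y) (fst (snd (node f P x)))"
    and "LProb h x = lprob (fst (node f P x)) (fst (snd (node f P x)))"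
    and "Cost h (pair x y) = cost f x (node f P y)"
  by (simp_all add: h_def run_oracle_def holds_def rtab_def inv_f_f[OF inj_hist_code])

lemma syntax_tabs_run_oracle: "syntax_tabs (run_oracle f K P)"
proof -
  have dec_Bot: "dec_prog l = Bot \<longleftrightarrow> l = 0" if "prog_code l" for l
    using that enc_prog_eq_0_iff[of "dec_prog l"] by (simp add: prog_code_def)
  have redex: "redex P = P" if "enc_prog P = pair t x" "t \<noteq> 2" for P t x
    using that by (cases P) auto
  have plug: "plug P X = X" if "enc_prog P = pair t x" "t \<noteq> 2" for P X t x
    using that by (cases P) auto
  show ?thesis
    unfolding syntax_tabs_def
  proof (intro conjI)
    show "rat_tabs (run_oracle f K P)"
      by (auto simp: rat_tabs_def run_oracle_tabs psnd_enc_rat_pos intro: dec_rat_denominator)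
    show "aexp_tabs (run_oracle f K P)"
      by (auto simp: aexp_tabs_def run_oracle_tabs aexp_code_pair)
    show "bexp_tabs (run_oracle f K P)"
      by (auto simp: bexp_tabs_def run_oracle_tabs bexp_code_pair)
    show "prog_tabs (run_oracle f K P)"
      by (auto simp: prog_tabs_def run_oracle_tabs prog_code_pair)
    show "redex_tabs (run_oracle f K P)"
      unfolding redex_tabs_def run_oracle_tabs
    proof (intro conjI allI impI)
      fix t x y
      assume "prog_code (pair t x) \<and> t \<noteq> 2"
      then show "enc_prog (redex (dec_prog (pair t x))) = pair t x"
        unfolding prog_code_def by (metis redex)
    next
      fix t x y
      assume "prog_code (pair t x) \<and> prog_code y \<and> t \<noteq> 2"
      then show "enc_prog (plug (dec_prog (pair t x)) (dec_prog y)) = y"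
        unfolding prog_code_def by (metis plug)
    next
      fix l r
      assume "prog_code (pair 2 (pair l r))"
      then have "prog_code l" "prog_code r" by (simp_all add: prog_code_pair)
      then show "enc_prog (redex (dec_prog (pair 2 (pair l r)))) =
          (if l = 0 then pair 2 (pair l r) else enc_prog (redex (dec_prog l)))"
        by (simp add: dec_Bot) (auto simp: prog_code_def)
    next
      fix l r y
      assume "prog_code (pair 2 (pair l r)) \<and> prog_code y"
      then have "prog_code l" "prog_code r" "prog_code y" by (simp_all add: prog_code_pair)
      then show "enc_prog (plug (dec_prog (pair 2 (pair l r))) (dec_prog y)) =
          (if l = 0 then y else pair 2 (pair (enc_prog (plug (dec_prog l) (dec_prog y))) r))"
        by (simp add: dec_Bot) (auto simp: prog_code_def)
    qed
  qed
qed

lemma run_tabs_run_oracle: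
  assumes "f \<in> schedulers"
  shows "run_tabs (enc_prog P) (run_oracle f K P)"
proof -
  let ?h = "run_oracle f K P"
  have Ln: "f w = Ln \<or> f w = Rn" for w using assms by (auto simp: schedulers_def)
  have child: "\<exists>l. node f P q = succ f l (node f P p)" if "q = 2 * p + 1 \<or> q = 2 * p + 2" for q p
    using that by (auto simp: node_children)
  note tabs = run_oracle_tabs
  have "root_tabs (enc_prog P) ?h"
    by (simp add: root_tabs_def tabs)
  moreover have "eval_tabs ?h"
    by (auto simp: eval_tabs_def aval_tabs_def adiv_tabs_def bval_tabs_def tabs)
  moreover have "cost_tabs ?h"
  proof -
    have choice: "lprob Q \<eta> = (if a \<le> 0 then 0 else if 1 \<le> a then 1 else a)"
      if "enc_prog (redex Q) = pair 3 (pair l (pair e r))" "a = aval (dec_aexp e) \<eta>" for Q \<eta> l e r a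
      using that by (cases "redex Q") (auto simp: lprob_def)
    have other: "lprob Q \<eta> = 1" if "enc_prog (redex Q) = pair t x" "t \<noteq> 3" for Q \<eta> t x
      using that by (cases "redex Q") (auto simp: lprob_def)
    have cost: "cost f (Suc k) (node f P p) = (if enc_prog (fst (node f P p)) = 0 then 0
        else 1 + lprob (fst (node f P p)) (fst (snd (node f P p))) * cost f k (node f P (2 * p + 1))
          + (1 - lprob (fst (node f P p)) (fst (snd (node f P p)))) * cost f k (node f P (2 * p + 2)))"
      for k p
      by (cases "node f P p") (simp add: node_children enc_prog_eq_0_iff del: succ.simps)
    show ?thesis
      unfolding cost_tabs_def tabs dec_prog_enc_prog
    proof (intro conjI allI impI, goal_cases)
      case 1
      then show ?case by (rule choice) simp
    next
      case 2
      then show ?case using other by blast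
    next
      case 3
      then show ?case by simp
    next
      case 4
      then show ?case by (rule cost)
    qed
  qed
  moreover have "child_tabs ?h"
    unfolding child_tabs_def tabs dec_prog_enc_prog
  proof (intro conjI allI impI, goal_cases)
    case (1 p q v e u)
    obtain l where l: "node f P q = succ f l (node f P p)" using child 1 by blast
    obtain Q \<eta> w where s: "node f P p = (Q, \<eta>, w)" by (cases "node f P p")
    from 1 show ?case by (cases "redex Q") (auto simp: l s)
  next
    case (2 p q t x u)
    obtain l where l: "node f P q = succ f l (node f P p)" using child 2 by blast
    obtain Q \<eta> w where s: "node f P p = (Q, \<eta>, w)" by (cases "node f P p")
    from 2 show ?case by (cases "redex Q") (auto simp: l s)
  next
    case (3 p q t x)
    obtain l where l: "node f P q = succ f l (node f P p)" using child 3 by blast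
    obtain Q \<eta> w where s: "node f P p = (Q, \<eta>, w)" by (cases "node f P p")
    from 3 show ?case by (cases "redex Q") (auto simp: l s)
  next
    case (4 p q t x)
    obtain l where l: "node f P q = succ f l (node f P p)" using child 4 by blast
    obtain Q \<eta> w where s: "node f P p = (Q, \<eta>, w)" by (cases "node f P p")
    from 4 show ?case by (cases "redex Q") (auto simp: l s dec_prog_0)
  next
    case (5 p q a b)
    obtain l where l: "node f P q = succ f l (node f P p)" using child 5 by blast
    obtain Q \<eta> w where s: "node f P p = (Q, \<eta>, w)" by (cases "node f P p")
    from 5 show ?case by (cases "redex Q") (auto simp: l s)
  next
    case (6 p a e b)
    obtain Q \<eta> w where s: "node f P p = (Q, \<eta>, w)" by (cases "node f P p")
    from 6 show ?case by (cases "redex Q") (auto simp: node_children s)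
  next
    case (7 p a e b)
    obtain Q \<eta> w where s: "node f P p = (Q, \<eta>, w)" by (cases "node f P p")
    from 7 show ?case by (cases "redex Q") (auto simp: node_children s)
  next
    case (8 p a e b)
    obtain Q \<eta> w where s: "node f P p = (Q, \<eta>, w)" by (cases "node f P p")
    from 8 show ?case by (cases "redex Q") (auto simp: node_children s)
  next
    case (9 p a e b)
    obtain Q \<eta> w where s: "node f P p = (Q, \<eta>, w)" by (cases "node f P p")
    from 9 show ?case by (cases "redex Q") (auto simp: node_children s)
  next
    case (10 p q a b)
    obtain l where l: "node f P q = succ f l (node f P p)" using child 10 by blast
    obtain Q \<eta> w where s: "node f P p = (Q, \<eta>, w)" by (cases "node f P p")
    from 10 Ln[of w] show ?case by (cases "redex Q") (auto simp: l s)
  next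
    case (11 p q a b)
    obtain l where l: "node f P q = succ f l (node f P p)" using child 11 by blast
    obtain Q \<eta> w where s: "node f P p = (Q, \<eta>, w)" by (cases "node f P p")
    from 11 Ln[of w] show ?case by (cases "redex Q") (auto simp: l s)
  next
    case (12 p q b r)
    obtain l where l: "node f P q = succ f l (node f P p)" using child 12 by blast
    obtain Q \<eta> w where s: "node f P p = (Q, \<eta>, w)" by (cases "node f P p")
    from 12 show ?case by (cases "redex Q") (auto simp: l s dec_prog_0)
  qed
  ultimately show ?thesis by (simp add: run_tabs_def)
qed

text \<open>If the cost under \<open>f\<close> exceeds every bound, let \<open>K N\<close> be a
  horizon where it exceeds \<open>N\<close>: the intended oracle with this \<open>K\<close> then
  falsifies the matrix.\<close>

lemma PAST_matrix_imp_PAST_codes: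
  assumes "\<And>h. PAST_matrix n h"
  shows "n \<in> PAST_codes"
proof -
  define P where "P = dec_prog n"
  have "Is_prog (run_oracle f K P) n" "n \<noteq> 0" for f K
    using assms[of "run_oracle f K P"] syntax_tabs_run_oracle[of f K P]
    by (auto simp: PAST_matrix_def)
  then have n: "n = enc_prog P" "P \<noteq> Bot"
    by (auto simp: run_oracle_tabs prog_code_def P_def simp flip: enc_prog_eq_0_iff)
  have "\<exists>N::nat. \<forall>k. cost f k (P, \<lambda>_. 0, []) \<le> of_nat N" if f: "f \<in> schedulers" for f
  proof (rule ccontr)
    assume "\<not> ?thesis"
    then have "\<forall>N::nat. \<exists>k. \<not> cost f k (P, \<lambda>_. 0, []) \<le> of_nat N" by blast
    then obtain K where K: "\<And>N::nat. \<not> cost f (K N) (P, \<lambda>_. 0, []) \<le> of_nat N" by metis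
    have "\<exists>N. Cost (run_oracle f K P) (pair (Horizon (run_oracle f K P) N) 0) \<le> of_nat N"
      using assms[of "run_oracle f K P"] syntax_tabs_run_oracle[of f K P]
        run_tabs_run_oracle[OF f, of P K] by (simp add: PAST_matrix_def n)
    then show False using K unfolding run_oracle_tabs node.simps by blast
  qed
  then have "P \<in> PAST" using n by (simp add: PAST_iff)
  then show ?thesis using n by (simp add: enc_prog_mem_PAST_codes)
qed

lemma Pi11_PAST_codes: "Pi11 PAST_codes"
proof (rule Pi11I[OF open_rel_PAST_matrix])
  show "n \<in> PAST_codes \<longleftrightarrow> (\<forall>h. PAST_matrix n h)" for n
    using PAST_imp_PAST_matrix PAST_matrix_imp_PAST_codes by (auto simp: PAST_codes_def)
qed

section \<open>Compiling total recursive functions\<close>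

lemma cost_mono: "k \<le> l \<Longrightarrow> cost f k s \<le> cost f l s"
  unfolding cost_eq_sum_live by (rule sum_mono2) (auto simp: live_bounds)

lemma cost_le: "cost f k s \<le> of_nat k"
proof -
  have "(\<Sum>j<k. live f j s) \<le> (\<Sum>j<k. 1)"
    by (rule sum_mono) (simp add: live_bounds)
  then show ?thesis by (simp add: cost_eq_sum_live)
qed

lemma cost_nonneg: "0 \<le> cost f k s"
  by (simp add: cost_eq_sum_live live_bounds sum_nonneg)

lemma cost_Bot [simp]: "cost f k (Bot, \<eta>, w) = 0"
  by (cases k) auto

lemma cost_Seq_Bot [simp]: "cost f (Suc k) (Seq Bot Q, \<eta>, w) = 1 + cost f k (Q, \<eta>, w)"
  by simp

lemma cost_Seq:
  "C \<noteq> Bot \<Longrightarrow> cost f (Suc k) (Seq C Q, \<eta>, w) =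
     (case contract f True (redex C) \<eta> w of (X, \<eta>1, w1) \<Rightarrow>
        1 + lprob C \<eta> * cost f k (Seq (plug C X) Q, \<eta>1, w1)) +
     (case contract f False (redex C) \<eta> w of (X, \<eta>2, w2) \<Rightarrow>
        (1 - lprob C \<eta>) * cost f k (Seq (plug C X) Q, \<eta>2, w2))"
  by (auto simp: lprob_Seq split: prod.splits)

text \<open>Both programs have the same redex until \<open>A\<close> is used up, and then both drop
  \<open>Bot\<close> in one step. Unfolded loops nest to the left, and this brings them back to the
  form of the following rules.\<close>

lemma cost_Seq_assoc:
  "cost f k (Seq (Seq A B) Q, \<eta>, w) = cost f k (Seq A (Seq B Q), \<eta>, w)"
proof (induction k arbitrary: A \<eta> w)
  case (Suc k)
  show ?case
  proof (cases "A = Bot")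
    case False
    then show ?thesis
      by (simp add: cost_Seq Suc lprob_Seq del: cost.simps split: prod.splits)
  qed (simp add: lprob_def)
qed simp

text \<open>Two steps: the assignment and the removal of the \<open>Bot\<close> that it
  leaves.\<close>

lemma cost_Seq_Assign [simp]:
  "cost f (Suc (Suc k)) (Seq (Assign v e) Q, \<eta>, w) = 2 + cost f k (Q, \<eta>(v := aval e \<eta>), w)"
  by (simp add: cost_Seq lprob_def del: cost.simps(2))

lemma cost_Seq_While [simp]:
  "cost f (Suc k) (Seq (While b C) Q, \<eta>, w) = 1 +
    cost f k (if bval b \<eta> then Seq C (Seq (While b C) Q) else Seq Bot Q, \<eta>, w)"
  by (auto simp: cost_Seq lprob_def cost_Seq_assoc simp del: cost.simps(2))

lemma cost_Seq_NChoice [simp]: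
  "cost f (Suc k) (Seq (NChoice A B) Q, \<eta>, w) = 1 +
    (if f w = Ln then cost f k (Seq A Q, \<eta>, w @ [Ln]) else cost f k (Seq B Q, \<eta>, w @ [Rn]))"
  by (auto simp: cost_Seq lprob_def simp del: cost.simps(2))

lemma cost_Seq_PChoice:
  "0 \<le> aval p \<eta> \<Longrightarrow> aval p \<eta> \<le> 1 \<Longrightarrow>
   cost f (Suc k) (Seq (PChoice A p B) Q, \<eta>, w) = 1 +
     aval p \<eta> * cost f k (Seq A Q, \<eta>, w @ [Lp]) +
     (1 - aval p \<eta>) * cost f k (Seq B Q, \<eta>, w @ [Rp])"
  by (auto simp: cost_Seq lprob_def simp del: cost.simps(2))

lemma cost_While:
  "cost f (Suc k) (While b C, \<eta>, w) = 1 +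
    cost f k (if bval b \<eta> then Seq C (While b C) else Bot, \<eta>, w)"
  by (simp add: lprob_def)

text \<open>\<open>C\<close> leads from \<open>\<eta>\<close> to \<open>\<eta>'\<close> in \<open>t\<close> deterministic steps, expressed by its effect on the cost of
  an arbitrary continuation; this makes sequencing a mere composition of equations.\<close>

definition det :: "nat \<Rightarrow> prog \<Rightarrow> valuation \<Rightarrow> valuation \<Rightarrow> bool" where
  "det t C \<eta> \<eta>' \<longleftrightarrow>
     (\<forall>f Q w k. cost f (k + t) (Seq C Q, \<eta>, w) = of_nat t + cost f k (Q, \<eta>', w))"

lemma det_Assign: "det 2 (Assign v e) \<eta> (\<eta>(v := aval e \<eta>))"
  by (simp add: det_def numeral_2_eq_2 del: cost.simps(2))

lemma det_Seq: 
  assumes "det t A \<eta> \<eta>'" "det t' B \<eta>' \<eta>''"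
  shows "det (t + t') (Seq A B) \<eta> \<eta>''"
  unfolding det_def
proof (intro allI)
  fix f Q w k
  have "cost f (k + t' + t) (Seq A (Seq B Q), \<eta>, w) = of_nat t + (of_nat t' + cost f k (Q, \<eta>'', w))"
    using assms unfolding det_def by metis
  then show "cost f (k + (t + t')) (Seq (Seq A B) Q, \<eta>, w) = of_nat (t + t') + cost f k (Q, \<eta>'', w)"
    by (simp add: cost_Seq_assoc ac_simps)
qed

lemma det_While_False: "\<not> bval b \<eta> \<Longrightarrow> det 2 (While b C) \<eta> \<eta>"
  by (simp add: det_def numeral_2_eq_2 del: cost.simps(2))

lemma det_While_True:
  assumes "bval b \<eta>" "det t C \<eta> \<eta>'" "det t' (While b C) \<eta>' \<eta>''"
  shows "det (Suc (t + t')) (While b C) \<eta> \<eta>''"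
  unfolding det_def
proof (intro allI)
  fix f Q w k
  have "cost f (k + t' + t) (Seq C (Seq (While b C) Q), \<eta>, w) =
      of_nat t + (of_nat t' + cost f k (Q, \<eta>'', w))"
    using assms(2,3) unfolding det_def by metis
  then show "cost f (k + Suc (t + t')) (Seq (While b C) Q, \<eta>, w) =
      of_nat (Suc (t + t')) + cost f k (Q, \<eta>'', w)"
    using assms(1) by (simp add: ac_simps del: cost.simps(2))
qed

text \<open>\<open>b\<close> is both the result register and a boundary: registers below it are
  preserved, those above it are scratch space with arbitrary initial contents.\<close>

definition computes :: "nat \<Rightarrow> (nat list \<Rightarrow> nat) \<Rightarrow> var list \<Rightarrow> var \<Rightarrow> prog \<Rightarrow> bool" where
  "computes n g vs b C \<longleftrightarrow> (\<forall>\<eta> xs. length xs = n \<longrightarrow> map \<eta> vs = map of_nat xs \<longrightarrow>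
     (\<exists>t \<eta>'. det t C \<eta> \<eta>' \<and> \<eta>' b = of_nat (g xs) \<and> (\<forall>v<b. \<eta>' v = \<eta> v)))"

lemma computesD:
  assumes "computes n g vs b C" "length xs = n" "map \<eta> vs = map of_nat xs"
  obtains t \<eta>' where "det t C \<eta> \<eta>'" "\<eta>' b = of_nat (g xs)" "\<And>v. v < b \<Longrightarrow> \<eta>' v = \<eta> v"
  using assms unfolding computes_def by blast

lemma computes_Assign:
  assumes "\<And>\<eta> (xs :: nat list). length xs = n \<Longrightarrow> map \<eta> vs = map of_nat xs \<Longrightarrow> aval e \<eta> = of_nat (g xs)"
  shows "computes n g vs b (Assign b e)"
  unfolding computes_def
proof (intro allI impI)
  fix \<eta> xs assume "length xs = n" "map \<eta> vs = map rat_of_nat xs"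
  with assms have "aval e \<eta> = of_nat (g xs)" by blast
  then have "(\<eta>(b := aval e \<eta>)) b = of_nat (g xs)" "\<forall>v<b. (\<eta>(b := aval e \<eta>)) v = \<eta> v"
    by auto
  with det_Assign[of b e \<eta>]
  show "\<exists>t \<eta>'. det t (Assign b e) \<eta> \<eta>' \<and> \<eta>' b = of_nat (g xs) \<and> (\<forall>v<b. \<eta>' v = \<eta> v)"
    by blast
qed

text \<open>The argument with index \<open>i\<close> is compiled with base \<open>b + i\<close>, so
  it preserves the inputs and all earlier results.\<close>

lemma computes_args:
  assumes "length fs = m"
    and "\<And>i b. i < m \<Longrightarrow> \<forall>v\<in>set vs. v < b \<Longrightarrow> \<exists>C. computes n (fs ! i) vs b C"
    and "\<forall>v\<in>set vs. v < b" "i \<le> m"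
  shows "\<exists>C. \<forall>\<eta> xs. length xs = n \<longrightarrow> map \<eta> vs = map of_nat xs \<longrightarrow>
    (\<exists>t \<eta>'. det t C \<eta> \<eta>' \<and> (\<forall>j<i. \<eta>' (b + j) = of_nat ((fs ! j) xs)) \<and> (\<forall>v<b. \<eta>' v = \<eta> v))"
  using assms(4)
proof (induction i)
  case 0
  have "det 2 (While BFalse Bot) \<eta> \<eta>" for \<eta> by (rule det_While_False) simp
  then show ?case by (intro exI[of _ "While BFalse Bot"]) auto
next
  case (Suc i)
  then obtain C where C: "\<And>\<eta> xs. length xs = n \<Longrightarrow> map \<eta> vs = map of_nat xs \<Longrightarrow>
    \<exists>t \<eta>'. det t C \<eta> \<eta>' \<and> (\<forall>j<i. \<eta>' (b + j) = of_nat ((fs ! j) xs)) \<and> (\<forall>v<b. \<eta>' v = \<eta> v)"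
    by (auto simp: Suc_le_eq less_imp_le)
  obtain D where D: "computes n (fs ! i) vs (b + i) D"
    using assms(2)[of i "b + i"] assms(3) Suc.prems by force
  show ?case
  proof (intro exI[of _ "Seq C D"] allI impI)
    fix \<eta> xs assume xs: "length xs = n" "map \<eta> vs = map rat_of_nat xs"
    then obtain t \<eta>1 where 1: "det t C \<eta> \<eta>1" "\<And>j. j < i \<Longrightarrow> \<eta>1 (b + j) = of_nat ((fs ! j) xs)"
      "\<And>v. v < b \<Longrightarrow> \<eta>1 v = \<eta> v"
      using C by blast
    have "map \<eta>1 vs = map \<eta> vs" using 1(3) assms(3) by simp
    with xs have "map \<eta>1 vs = map of_nat xs" by simp
    from computesD[OF D xs(1) this] obtain t' \<eta>2 where 2: "det t' D \<eta>1 \<eta>2"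
      "\<eta>2 (b + i) = of_nat ((fs ! i) xs)" "\<And>v. v < b + i \<Longrightarrow> \<eta>2 v = \<eta>1 v" by blast
    have "det (t + t') (Seq C D) \<eta> \<eta>2" using det_Seq 1(1) 2(1) by blast
    moreover have "\<forall>j<Suc i. \<eta>2 (b + j) = of_nat ((fs ! j) xs)"
      using 1(2) 2(2,3) by (auto simp: less_Suc_eq)
    moreover have "\<forall>v<b. \<eta>2 v = \<eta> v" using 1(3) 2(3) by simp
    ultimately show "\<exists>t \<eta>'. det t (Seq C D) \<eta> \<eta>' \<and>
        (\<forall>j<Suc i. \<eta>' (b + j) = rat_of_nat ((fs ! j) xs)) \<and> (\<forall>v<b. \<eta>' v = \<eta> v)"
      by blast
  qed
qed

lemma computes_comp:
  assumes "length fs = m"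
    and "\<And>vs b. length vs = m \<Longrightarrow> \<forall>v\<in>set vs. v < b \<Longrightarrow> \<exists>C. computes m g vs b C"
    and "\<And>i b. i < m \<Longrightarrow> \<forall>v\<in>set vs. v < b \<Longrightarrow> \<exists>C. computes n (fs ! i) vs b C"
    and "\<forall>v\<in>set vs. v < b"
  shows "\<exists>C. computes n (\<lambda>xs. g (map (\<lambda>f. f xs) fs)) vs b C"
proof -
  obtain C where C: "\<And>\<eta> xs. length xs = n \<Longrightarrow> map \<eta> vs = map of_nat xs \<Longrightarrow>
    \<exists>t \<eta>'. det t C \<eta> \<eta>' \<and> (\<forall>j<m. \<eta>' (b + j) = of_nat ((fs ! j) xs)) \<and> (\<forall>v<b. \<eta>' v = \<eta> v)"
    using computes_args[OF assms(1,3,4) order.refl] by blast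
  \<comment> \<open>The arguments occupy \<open>b\<close> to \<open>b + m - 1\<close>, so
    \<open>g\<close> works from \<open>b + m\<close> on and its value is finally copied down to
    \<open>b\<close>.\<close>
  obtain D where D: "computes m g [b..<b + m] (b + m) D"
    using assms(2)[of "[b..<b + m]" "b + m"] by auto
  have "computes n (\<lambda>xs. g (map (\<lambda>f. f xs) fs)) vs b (Seq C (Seq D (Assign b (AVar (b + m)))))"
    unfolding computes_def
  proof (intro allI impI)
    fix \<eta> xs assume xs: "length xs = n" "map \<eta> vs = map rat_of_nat xs"
    then obtain t \<eta>1 where 1: "det t C \<eta> \<eta>1" "\<And>j. j < m \<Longrightarrow> \<eta>1 (b + j) = of_nat ((fs ! j) xs)"
      "\<And>v. v < b \<Longrightarrow> \<eta>1 v = \<eta> v"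
      using C by blast
    have "map \<eta>1 [b..<b + m] = map of_nat (map (\<lambda>f. f xs) fs)"
      using assms(1) 1(2) by (auto intro!: nth_equalityI)
    from computesD[OF D _ this] assms(1) obtain t' \<eta>2 where 2: "det t' D \<eta>1 \<eta>2"
      "\<eta>2 (b + m) = of_nat (g (map (\<lambda>f. f xs) fs))" "\<And>v. v < b + m \<Longrightarrow> \<eta>2 v = \<eta>1 v"
      by auto
    have "det (t + (t' + 2)) (Seq C (Seq D (Assign b (AVar (b + m))))) \<eta>
        (\<eta>2(b := aval (AVar (b + m)) \<eta>2))"
      by (rule det_Seq[OF 1(1) det_Seq[OF 2(1) det_Assign]])
    moreover have "(\<eta>2(b := aval (AVar (b + m)) \<eta>2)) b = of_nat (g (map (\<lambda>f. f xs) fs))"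
      "\<forall>v<b. (\<eta>2(b := aval (AVar (b + m)) \<eta>2)) v = \<eta> v"
      using 1(3) 2(2,3) by auto
    ultimately show "\<exists>t \<eta>'. det t (Seq C (Seq D (Assign b (AVar (b + m))))) \<eta> \<eta>' \<and>
      \<eta>' b = rat_of_nat (g (map (\<lambda>f. f xs) fs)) \<and> (\<forall>v<b. \<eta>' v = \<eta> v)"
      by blast
  qed
  then show ?thesis by blast
qed

lemma computes_prim:
  assumes "\<And>vs b. length vs = n \<Longrightarrow> \<forall>v\<in>set vs. v < b \<Longrightarrow> \<exists>C. computes n g vs b C"
    and "\<And>vs b. length vs = n + 2 \<Longrightarrow> \<forall>v\<in>set vs. v < b \<Longrightarrow> \<exists>C. computes (n + 2) h vs b C"
    and "length vs = Suc n" "\<forall>v\<in>set vs. v < b"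
  shows "\<exists>C. computes (Suc n) (\<lambda>xs. primrec_op g h (hd xs) (tl xs)) vs b C"
proof -
  obtain u us where vs: "vs = u # us" "length us = n"
    using assms(3) by (auto simp: length_Suc_conv)
  have ub: "u < b" "\<forall>v\<in>set us. v < b" using assms(4) vs by auto
  obtain C where C: "computes n g us b C" using assms(1)[OF vs(2) ub(2)] ..
  \<comment> \<open>Register \<open>b\<close> holds the accumulated value and \<open>Suc b\<close>
    the round counter; \<open>h\<close> expects the counter first.\<close>
  obtain D where D: "computes (n + 2) h (Suc b # b # us) (b + 2) D"
    using assms(2)[of "Suc b # b # us" "b + 2"] vs(2) ub by (auto simp: less_SucI)
  define body where "body = Seq D (Seq (Assign b (AVar (b + 2)))
    (Assign (Suc b) (AAdd (AVar (Suc b)) (AConst 1))))"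
  define loop where "loop = While (BLess (AVar (Suc b)) (AVar u)) body"
  \<comment> \<open>Loop invariant after \<open>j\<close> rounds; the induction is on the number
    \<open>d\<close> of rounds left.\<close>
  have loop: "\<exists>t \<eta>'. det t loop \<eta> \<eta>' \<and> \<eta>' b = of_nat (primrec_op g h k ys) \<and> (\<forall>v<b. \<eta>' v = \<eta> v)"
    if "j + d = k" "length ys = n" "\<eta> u = of_nat k" "map \<eta> us = map of_nat ys"
      "\<eta> b = of_nat (primrec_op g h j ys)" "\<eta> (Suc b) = of_nat j" for \<eta> j k ys d
    using that
  proof (induction d arbitrary: \<eta> j)
    case 0
    then have "det 2 loop \<eta> \<eta>" unfolding loop_def by (intro det_While_False) simp
    then show ?case using 0 by auto
  next
    case (Suc d)
    have "map \<eta> (Suc b # b # us) = map of_nat (j # primrec_op g h j ys # ys)"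
      using Suc.prems by simp
    from computesD[OF D _ this] Suc.prems(2) obtain t1 \<eta>1 where 1: "det t1 D \<eta> \<eta>1"
      "\<eta>1 (b + 2) = of_nat (primrec_op g h (Suc j) ys)" "\<And>v. v < b + 2 \<Longrightarrow> \<eta>1 v = \<eta> v"
      by auto
    let ?\<eta>2 = "\<eta>1(b := aval (AVar (b + 2)) \<eta>1)"
    let ?\<eta>3 = "?\<eta>2(Suc b := aval (AAdd (AVar (Suc b)) (AConst 1)) ?\<eta>2)"
    have body: "det (t1 + (2 + 2)) body \<eta> ?\<eta>3"
      unfolding body_def by (rule det_Seq[OF 1(1) det_Seq[OF det_Assign det_Assign]])
    have keep: "?\<eta>3 v = \<eta> v" if "v < b" for v using that 1(3)[of v] by simp
    have "map ?\<eta>3 us = map \<eta> us" using keep ub(2) by (intro map_cong) auto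
    moreover have "?\<eta>3 u = \<eta> u" using keep ub(1) by blast
    moreover have "?\<eta>3 (Suc b) = of_nat (Suc j)" using 1(3)[of "Suc b"] Suc.prems by simp
    moreover have "?\<eta>3 b = of_nat (primrec_op g h (Suc j) ys)" using 1(2) by simp
    ultimately obtain t' \<eta>' where 2: "det t' loop ?\<eta>3 \<eta>'" "\<eta>' b = of_nat (primrec_op g h k ys)"
      "\<forall>v<b. \<eta>' v = ?\<eta>3 v"
      using Suc.IH[of "Suc j" ?\<eta>3] Suc.prems by (auto simp del: fun_upd_apply)
    have "bval (BLess (AVar (Suc b)) (AVar u)) \<eta>" using Suc.prems by auto
    then have "det (Suc (t1 + (2 + 2) + t')) loop \<eta> \<eta>'"
      using det_While_True body 2(1) unfolding loop_def by blast
    then show ?case using 2 keep by metis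
  qed
  have "computes (Suc n) (\<lambda>xs. primrec_op g h (hd xs) (tl xs)) vs b
      (Seq C (Seq (Assign (Suc b) (AConst 0)) loop))"
    unfolding computes_def
  proof (intro allI impI)
    fix \<eta> xs assume xs: "length xs = Suc n" "map \<eta> vs = map rat_of_nat xs"
    then obtain k ys where k: "xs = k # ys" "length ys = n" by (auto simp: length_Suc_conv)
    have e: "\<eta> u = of_nat k" "map \<eta> us = map of_nat ys" using xs(2) k vs by simp_all
    from computesD[OF C k(2) e(2)] obtain t1 \<eta>1 where 1: "det t1 C \<eta> \<eta>1"
      "\<eta>1 b = of_nat (g ys)" "\<And>v. v < b \<Longrightarrow> \<eta>1 v = \<eta> v" by blast
    let ?\<eta>2 = "\<eta>1(Suc b := aval (AConst 0) \<eta>1)"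
    have keep: "?\<eta>2 v = \<eta> v" if "v < b" for v using that 1(3)[of v] by simp
    have "map ?\<eta>2 us = map \<eta> us" using keep ub(2) by (intro map_cong) auto
    moreover have "?\<eta>2 u = \<eta> u" using keep ub(1) by blast
    moreover have "?\<eta>2 b = of_nat (primrec_op g h 0 ys)" "?\<eta>2 (Suc b) = of_nat 0"
      using 1(2) by simp_all
    ultimately obtain t' \<eta>' where 2: "det t' loop ?\<eta>2 \<eta>'" "\<eta>' b = of_nat (primrec_op g h k ys)"
      "\<forall>v<b. \<eta>' v = ?\<eta>2 v"
      using loop[of 0 k k ys ?\<eta>2] k e by (auto simp del: fun_upd_apply)
    have "det (t1 + (2 + t')) (Seq C (Seq (Assign (Suc b) (AConst 0)) loop)) \<eta> \<eta>'"
      by (rule det_Seq[OF 1(1) det_Seq[OF det_Assign 2(1)]])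
    then show "\<exists>t \<eta>'. det t (Seq C (Seq (Assign (Suc b) (AConst 0)) loop)) \<eta> \<eta>' \<and>
        \<eta>' b = rat_of_nat (primrec_op g h (hd xs) (tl xs)) \<and> (\<forall>v<b. \<eta>' v = \<eta> v)"
      using 2 keep k by (metis list.sel(1,3))
  qed
  then show ?thesis by blast
qed

lemma computes_mu:
  assumes "\<And>vs b. length vs = Suc n \<Longrightarrow> \<forall>v\<in>set vs. v < b \<Longrightarrow> \<exists>C. computes (Suc n) g vs b C"
    and "\<forall>ys. length ys = n \<longrightarrow> (\<exists>k. g (k # ys) = 0)"
    and "length vs = n" "\<forall>v\<in>set vs. v < b"
  shows "\<exists>C. computes n (\<lambda>ys. LEAST k. g (k # ys) = 0) vs b C"
proof -
  \<comment> \<open>Register \<open>b\<close> is the current candidate and the first argument of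
    \<open>g\<close>; the value to be tested goes to \<open>Suc b\<close>, once before the loop and
    again after each increment.\<close>
  obtain C where C: "computes (Suc n) g (b # vs) (Suc b) C"
    using assms(1)[of "b # vs" "Suc b"] assms(3,4) by (auto simp: less_SucI)
  define body where "body = Seq (Assign b (AAdd (AVar b) (AConst 1))) C"
  define loop where "loop = While (BNot (BEq (AVar (Suc b)) (AConst 0))) body"
  have loop: "\<exists>t \<eta>'. det t loop \<eta> \<eta>' \<and> \<eta>' b = of_nat k \<and> (\<forall>v<b. \<eta>' v = \<eta> v)"
    if "j + d = k" "length ys = n" "k = (LEAST k. g (k # ys) = 0)" "map \<eta> vs = map of_nat ys"
      "\<eta> (Suc b) = of_nat (g (j # ys))" "\<eta> b = of_nat j" for \<eta> j k ys d
    using that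
  proof (induction d arbitrary: \<eta> j)
    case 0
    \<comment> \<open>No rounds are left, so \<open>j\<close> is the least zero; that there is a
      zero is the totality assumption.\<close>
    then have "g (j # ys) = 0" using LeastI_ex[of "\<lambda>k. g (k # ys) = 0"] assms(2) by auto
    with 0 have "det 2 loop \<eta> \<eta>" unfolding loop_def by (intro det_While_False) simp
    then show ?case using 0 by auto
  next
    case (Suc d)
    have "j < k" using Suc.prems(1) by simp
    then have "g (j # ys) \<noteq> 0" using not_less_Least Suc.prems(3) by blast
    then have b: "bval (BNot (BEq (AVar (Suc b)) (AConst 0))) \<eta>" using Suc.prems by simp
    let ?\<eta>1 = "\<eta>(b := aval (AAdd (AVar b) (AConst 1)) \<eta>)"
    have "map ?\<eta>1 vs = map \<eta> vs" using assms(4) by auto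
    then have "map ?\<eta>1 (b # vs) = map of_nat (Suc j # ys)" using Suc.prems by simp
    from computesD[OF C _ this] Suc.prems(2) obtain t \<eta>2 where 2: "det t C ?\<eta>1 \<eta>2"
      "\<eta>2 (Suc b) = of_nat (g (Suc j # ys))" "\<And>v. v < Suc b \<Longrightarrow> \<eta>2 v = ?\<eta>1 v"
      by (metis length_Cons)
    have body: "det (2 + t) body \<eta> \<eta>2"
      unfolding body_def by (rule det_Seq[OF det_Assign 2(1)])
    have keep: "\<eta>2 v = \<eta> v" if "v < b" for v using that 2(3)[of v] by simp
    have "map \<eta>2 vs = map \<eta> vs" using keep assms(4) by simp
    moreover have "\<eta>2 b = of_nat (Suc j)" using 2(3)[of b] Suc.prems by simp
    ultimately obtain t' \<eta>' where 3: "det t' loop \<eta>2 \<eta>'" "\<eta>' b = of_nat k" "\<forall>v<b. \<eta>' v = \<eta>2 v"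
      using Suc.IH[of "Suc j" \<eta>2] Suc.prems 2(2) by auto
    have "det (Suc (2 + t + t')) loop \<eta> \<eta>'"
      using det_While_True b body 3(1) unfolding loop_def by blast
    then show ?case using 3 keep by metis
  qed
  have "computes n (\<lambda>ys. LEAST k. g (k # ys) = 0) vs b (Seq (Assign b (AConst 0)) (Seq C loop))"
    unfolding computes_def
  proof (intro allI impI)
    fix \<eta> ys assume ys: "length ys = n" "map \<eta> vs = map rat_of_nat ys"
    let ?\<eta>1 = "\<eta>(b := aval (AConst 0) \<eta>)"
    have "map ?\<eta>1 vs = map \<eta> vs" using assms(4) by auto
    then have "map ?\<eta>1 (b # vs) = map of_nat (0 # ys)" using ys by simp
    from computesD[OF C _ this] ys(1) obtain t \<eta>2 where 2: "det t C ?\<eta>1 \<eta>2"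
      "\<eta>2 (Suc b) = of_nat (g (0 # ys))" "\<And>v. v < Suc b \<Longrightarrow> \<eta>2 v = ?\<eta>1 v"
      by (metis length_Cons)
    have keep: "\<eta>2 v = \<eta> v" if "v < b" for v using that 2(3)[of v] by simp
    have "map \<eta>2 vs = map \<eta> vs" using keep assms(4) by simp
    moreover have "\<eta>2 b = of_nat 0" using 2(3)[of b] by simp
    ultimately obtain t' \<eta>' where 3: "det t' loop \<eta>2 \<eta>'"
      "\<eta>' b = of_nat (LEAST k. g (k # ys) = 0)" "\<forall>v<b. \<eta>' v = \<eta>2 v"
      using loop[of 0 "LEAST k. g (k # ys) = 0" "LEAST k. g (k # ys) = 0" ys \<eta>2] ys 2(2) by auto
    have "det (2 + (t + t')) (Seq (Assign b (AConst 0)) (Seq C loop)) \<eta> \<eta>'"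
      by (rule det_Seq[OF det_Assign det_Seq[OF 2(1) 3(1)]])
    then show "\<exists>t \<eta>'. det t (Seq (Assign b (AConst 0)) (Seq C loop)) \<eta> \<eta>' \<and>
        \<eta>' b = rat_of_nat (LEAST k. g (k # ys) = 0) \<and> (\<forall>v<b. \<eta>' v = \<eta> v)"
      using 3 keep by metis
  qed
  then show ?thesis by blast
qed

text \<open>Argument registers and base vary in the induction because each constituent is compiled
  above the registers already in use.\<close>

lemma total_rec_computes:
  assumes "total_rec n g" "length vs = n" "\<forall>v\<in>set vs. v < b"
  shows "\<exists>C. computes n g vs b C"
  using assms
proof (induction arbitrary: vs b)
  case (rec_zero n)
  have "computes n (\<lambda>_. 0) vs b (Assign b (AConst 0))"
    by (rule computes_Assign) simp
  then show ?case ..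
next
  case rec_succ
  then obtain v where vs: "vs = [v]" by (auto simp: length_Suc_conv)
  have "computes 1 (\<lambda>xs. Suc (hd xs)) vs b (Assign b (AAdd (AVar v) (AConst 1)))"
    by (rule computes_Assign) (auto simp: vs length_Suc_conv)
  then show ?case ..
next
  case (rec_proj i n)
  have "computes n (\<lambda>xs. xs ! i) vs b (Assign b (AVar (vs ! i)))"
    by (rule computes_Assign) (use rec_proj in \<open>auto dest: arg_cong[where f = "\<lambda>l. l ! i"]\<close>)
  then show ?case ..
next
  case (rec_comp m g fs n)
  show ?case
    by (rule computes_comp[OF rec_comp.hyps(2)]) (use rec_comp in auto)
next
  case (rec_prim n g h)
  show ?case
    by (rule computes_prim) (use rec_prim in auto)
next
  case (rec_mu n g)
  show ?case
    by (rule computes_mu) (use rec_mu in auto)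
qed

section \<open>Hardness\<close>

text \<open>The loop takes \<open>3 * c + 2\<close> steps, of which the lower bound \<open>c\<close>
  is recorded.\<close>

lemma det_delay:
  "\<eta> 5 = of_nat c \<Longrightarrow> \<exists>t\<ge>c. det t (While (BLess (AConst 0) (AVar 5))
      (Assign 5 (ASub (AVar 5) (AConst 1)))) \<eta> (\<eta>(5 := 0))"
proof (induction c arbitrary: \<eta>)
  case 0
  then have "det 2 (While (BLess (AConst 0) (AVar 5)) (Assign 5 (ASub (AVar 5) (AConst 1)))) \<eta> \<eta>"
    by (intro det_While_False) simp
  moreover have "\<eta> = \<eta>(5 := 0)" using 0 by auto
  ultimately show ?case by (metis zero_le)
next
  case (Suc c)
  let ?\<eta>1 = "\<eta>(5 := aval (ASub (AVar 5) (AConst 1)) \<eta>)"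
  have "?\<eta>1 5 = of_nat c" using Suc.prems by simp
  from Suc.IH[of ?\<eta>1, OF this] obtain t where t: "t \<ge> c" "det t (While (BLess (AConst 0) (AVar 5))
      (Assign 5 (ASub (AVar 5) (AConst 1)))) ?\<eta>1 (?\<eta>1(5 := 0))" by blast
  have "bval (BLess (AConst 0) (AVar 5)) \<eta>" using Suc.prems by simp
  from det_While_True[where t' = t, OF this det_Assign t(2)] t(1)
  have "det (Suc (2 + t)) (While (BLess (AConst 0) (AVar 5))
      (Assign 5 (ASub (AVar 5) (AConst 1)))) \<eta> (\<eta>(5 := 0))" by (simp only: fun_upd_upd)
  moreover have "Suc c \<le> Suc (2 + t)" using t(1) by simp
  ultimately show ?case by blast
qed

text \<open>Variables: 0 holds the input, 1 the code of the reversed sequence guessed so far, 2 the value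
  currently being guessed, 3 is nonzero once the run is over, 4 is the inverse of the probability
  of the run so far, 5 is a delay counter; the compiled check works in the variables from 6 on.\<close>

definition guess :: prog where
  "guess = Seq (Assign 2 (AAdd (AVar 2) (AConst 1)))
    (PChoice (Assign 4 (AMul (AVar 4) (AConst 2))) (AConst (1 / 2)) (Assign 3 (AConst 1)))"

text \<open>The polynomial for \<open>Suc (prod_encode (y, s))\<close>, the code of the list with
  \<open>y\<close> put in front, where the triangular number is written as
  \<open>d * (d + 1) / 2\<close>.\<close>

definition push_exp :: aexp where
  "push_exp = (let y = AVar 2; s = AVar 1; d = AAdd y s in
     AAdd (AAdd (ADiv (AMul d (AAdd d (AConst 1))) (AConst 2)) y) (AConst 1))"

text \<open>Division by zero yields 0, so \<open>1 - x / x\<close> is 1 if the check returned 0 and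
  0 otherwise. The check sees the sequence before the new value is pushed, hence the empty prefix is
  tested as well.\<close>

definition emit :: "prog \<Rightarrow> prog" where
  "emit C = Seq C (Seq (Assign 3 (ASub (AConst 1) (ADiv (AVar 6) (AVar 6))))
    (Seq (Assign 5 (AVar 4))
    (Seq (While (BLess (AConst 0) (AVar 5)) (Assign 5 (ASub (AVar 5) (AConst 1))))
    (Seq (Assign 1 push_exp) (Assign 2 (AConst 0))))))"

definition search :: "prog \<Rightarrow> prog" where
  "search C = While (BEq (AVar 3) (AConst 0)) (NChoice guess (emit C))"

definition search_from :: "prog \<Rightarrow> nat \<Rightarrow> prog" where
  "search_from C n = Seq (Assign 0 (AConst (of_nat n))) (Seq (Assign 4 (AConst 1)) (search C))"

text \<open>Variable 5 and the work space of the check are left open, since they are set before they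
  are read.\<close>

definition search_state :: "nat \<Rightarrow> nat \<Rightarrow> nat \<Rightarrow> nat \<Rightarrow> valuation \<Rightarrow> bool" where
  "search_state n s y c \<eta> \<longleftrightarrow> \<eta> 0 = of_nat n \<and> \<eta> 1 = of_nat s \<and> \<eta> 2 = of_nat y \<and>
     \<eta> 3 = 0 \<and> \<eta> 4 = of_nat c"

lemma aval_push_exp:
  assumes "\<eta> 1 = of_nat s" "\<eta> 2 = of_nat y"
  shows "aval push_exp \<eta> = of_nat (Suc (prod_encode (y, s)))"
proof -
  have "of_nat (triangle k) = (of_nat k * (of_nat k + 1) / 2 :: rat)" for k
    by (induction k) (auto simp: field_simps)
  then show ?thesis
    using assms by (simp add: push_exp_def prod_encode_def Let_def)
qed

lemma det_emit:
  assumes "computes 2 g [0, 1] 6 C" "search_state n s y c \<eta>"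
  shows "\<exists>t\<ge>c. \<exists>\<eta>'. det t (emit C) \<eta> \<eta>' \<and> \<eta>' 3 = of_bool (g [n, s] = 0) \<and>
    (g [n, s] \<noteq> 0 \<longrightarrow> search_state n (Suc (prod_encode (y, s))) 0 c \<eta>')"
proof -
  have "map \<eta> [0, 1] = map of_nat [n, s]" using assms(2) by (simp add: search_state_def)
  from computesD[OF assms(1) _ this] obtain t1 \<eta>1 where 1: "det t1 C \<eta> \<eta>1"
    "\<eta>1 6 = of_nat (g [n, s])" "\<And>v. v < 6 \<Longrightarrow> \<eta>1 v = \<eta> v"
    by (auto simp: numeral_2_eq_2)
  let ?\<eta>2 = "\<eta>1(3 := aval (ASub (AConst 1) (ADiv (AVar 6) (AVar 6))) \<eta>1)"
  let ?\<eta>3 = "?\<eta>2(5 := aval (AVar 4) ?\<eta>2)"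
  let ?\<eta>4 = "?\<eta>3(5 := 0)"
  let ?\<eta>5 = "?\<eta>4(1 := aval push_exp ?\<eta>4)"
  let ?\<eta>6 = "?\<eta>5(2 := aval (AConst 0) ?\<eta>5)"
  have "?\<eta>3 5 = of_nat c" using 1(3) assms(2) by (simp add: search_state_def)
  from det_delay[of ?\<eta>3 c, OF this] obtain t2 where t2: "c \<le> t2" "det t2 (While (BLess (AConst 0) (AVar 5))
      (Assign 5 (ASub (AVar 5) (AConst 1)))) ?\<eta>3 ?\<eta>4" by blast
  define \<eta>6 where "\<eta>6 = ?\<eta>6"
  have run: "det (t1 + (2 + (2 + (t2 + (2 + 2))))) (emit C) \<eta> \<eta>6"
    unfolding emit_def \<eta>6_def by (rule det_Seq[OF 1(1) det_Seq[OF det_Assign det_Seq[OF det_Assign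
      det_Seq[OF t2(2) det_Seq[OF det_Assign det_Assign]]]]])
  have over: "\<eta>6 3 = of_bool (g [n, s] = 0)" using 1(2) by (simp add: \<eta>6_def)
  have keep: "\<eta>6 0 = of_nat n" "\<eta>6 2 = 0" "\<eta>6 4 = of_nat c"
    using assms(2) 1(3) by (simp_all add: \<eta>6_def search_state_def)
  have "\<eta>6 1 = aval push_exp ?\<eta>4" by (simp add: \<eta>6_def)
  also have "\<dots> = of_nat (Suc (prod_encode (y, s)))"
    using assms(2) 1(3) by (intro aval_push_exp) (simp_all add: search_state_def)
  finally have "g [n, s] \<noteq> 0 \<longrightarrow> search_state n (Suc (prod_encode (y, s))) 0 c \<eta>6"
    using over keep by (simp add: search_state_def)
  moreover have "c \<le> t1 + (2 + (2 + (t2 + (2 + 2))))" using t2(1) by simp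
  ultimately show ?thesis using run over by blast
qed

lemma cost_search_over: "\<eta> 3 \<noteq> 0 \<Longrightarrow> cost f k (search C, \<eta>, w) \<le> 1"
  by (cases k) (simp_all add: search_def cost_While del: cost.simps(2))

lemma cost_search_emit:
  assumes "f w \<noteq> Ln" "\<eta> 3 = 0" "det t (emit C) \<eta> \<eta>'"
  shows "cost f (k + (t + 2)) (search C, \<eta>, w) = of_nat (t + 2) + cost f k (search C, \<eta>', w @ [Rn])"
proof -
  have "cost f (Suc (Suc (k + t))) (search C, \<eta>, w) = 2 +
      cost f (k + t) (Seq (emit C) (search C), \<eta>, w @ [Rn])"
    using assms(1,2) unfolding search_def by (simp add: cost_While del: cost.simps(2))
  then show ?thesis using assms(3) by (simp add: det_def)
qed

text \<open>Seven steps: loop test, nondeterministic choice, two for the increment, the flip, and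
  two for the assignment after it. Both outcomes of the flip take equally long, so they share one
  horizon \<open>k\<close>.\<close>

lemma cost_search_guess:
  assumes "f w = Ln" "search_state n s y c \<eta>"
  shows "\<exists>\<eta>' \<eta>'' w''. search_state n s (Suc y) (2 * c) \<eta>' \<and> \<eta>'' 3 \<noteq> 0 \<and>
    (\<forall>k. cost f (k + 7) (search C, \<eta>, w) = 7 + cost f k (search C, \<eta>', w @ [Ln, Lp]) / 2
      + cost f k (search C, \<eta>'', w'') / 2)"
proof -
  let ?\<eta>1 = "\<eta>(2 := \<eta> 2 + 1)"
  let ?\<eta>2 = "?\<eta>1(4 := ?\<eta>1 4 * 2)"
  let ?\<eta>3 = "?\<eta>1(3 := 1)"
  have "search_state n s (Suc y) (2 * c) ?\<eta>2" "?\<eta>3 3 \<noteq> 0"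
    using assms(2) by (auto simp: search_state_def)
  moreover
  have "cost f (k + 7) (search C, \<eta>, w) = 7 + cost f k (search C, ?\<eta>2, w @ [Ln, Lp]) / 2
      + cost f k (search C, ?\<eta>3, w @ [Ln, Rp]) / 2" for k
  proof -
    have "cost f (k + 7) (search C, \<eta>, w) = cost f (Suc (Suc (Suc (Suc (Suc (Suc (Suc k))))))) (search C, \<eta>, w)"
      by (simp add: eval_nat_numeral del: cost.simps(2))
    also have "\<dots> = 2 + cost f (Suc (Suc (Suc (Suc (Suc k))))) (Seq guess (search C), \<eta>, w @ [Ln])"
      using assms unfolding search_def by (simp add: cost_While search_state_def del: cost.simps(2))
    also have "\<dots> = 7 + cost f k (search C, ?\<eta>2, w @ [Ln, Lp]) / 2
      + cost f k (search C, ?\<eta>3, w @ [Ln, Rp]) / 2"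
      unfolding guess_def
      by (simp add: cost_Seq_assoc cost_Seq_PChoice del: cost.simps(2)) (simp add: field_simps)
    finally show ?thesis .
  qed
  ultimately show ?thesis by blast
qed

section \<open>Bounded cost if every sequence has a prefix that passes the check\<close>

definition bounded_cost :: "scheduler \<Rightarrow> pstate \<Rightarrow> bool" where
  "bounded_cost f s \<longleftrightarrow> (\<exists>N::nat. \<forall>k. cost f k s \<le> of_nat N)"

lemma bounded_costI: "(\<And>k. cost f k s \<le> of_nat N) \<Longrightarrow> bounded_cost f s"
  unfolding bounded_cost_def by blast

lemma bounded_cost_shift:
  assumes "\<And>k. cost f (k + t) s = of_nat t + cost f k s'"
  shows "bounded_cost f s \<longleftrightarrow> bounded_cost f s'"
proof
  assume "bounded_cost f s"
  then obtain N where N: "\<And>k. cost f k s \<le> of_nat N" by (auto simp: bounded_cost_def)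
  have "cost f k s' \<le> of_nat N" for k
    using N[of "k + t"] unfolding assms by (rule order.trans[rotated]) simp
  then show "bounded_cost f s'" by (rule bounded_costI)
next
  assume "bounded_cost f s'"
  then obtain N where N: "\<And>k. cost f k s' \<le> of_nat N" by (auto simp: bounded_cost_def)
  have "cost f k s \<le> of_nat (t + N)" for k
    using cost_mono[of k "k + t" f s] N[of k] unfolding assms by simp
  then show "bounded_cost f s" by (rule bounded_costI)
qed

definition guesses :: "nat \<Rightarrow> dir list" where
  "guesses i = concat (replicate i [Ln, Lp])"

lemma guesses_Suc: "guesses (Suc i) = guesses i @ [Ln, Lp]"
  by (induction i) (auto simp: guesses_def)

lemma guesses_Suc': "guesses (Suc i) = [Ln, Lp] @ guesses i"
  by (simp add: guesses_def)

text \<open>15 is the fixed point of \<open>x = 7 + x / 2 + 1 / 2\<close>: one round, the surviving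
  half, and the aborted half, which costs at most 1.\<close>

lemma cost_search_guess_forever:
  assumes "\<And>i. f (w @ guesses i) = Ln" "search_state n s y c \<eta>"
  shows "cost f k (search C, \<eta>, w) \<le> 15"
  using assms
proof (induction k arbitrary: w y c \<eta> rule: less_induct)
  case (less k)
  show ?case
  proof (cases "k < 7")
    case True
    then have "rat_of_nat k \<le> of_nat 15" unfolding of_nat_le_iff by simp
    with cost_le[of f k "(search C, \<eta>, w)"] show ?thesis by simp
  next
    case False
    then obtain j where k: "k = j + 7" by (metis add.commute le_Suc_ex not_less)
    have "f w = Ln" using less.prems(1)[of 0] by (simp add: guesses_def)
    from cost_search_guess[of f w, OF this less.prems(2), of C] obtain \<eta>' \<eta>'' w'' where
      1: "search_state n s (Suc y) (2 * c) \<eta>'" "\<eta>'' 3 \<noteq> 0"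
      "cost f k (search C, \<eta>, w) = 7 + cost f j (search C, \<eta>', w @ [Ln, Lp]) / 2
      + cost f j (search C, \<eta>'', w'') / 2"
      unfolding k by blast
    have "f ((w @ [Ln, Lp]) @ guesses i) = Ln" for i
      using less.prems(1)[of "Suc i"] by (simp add: guesses_Suc')
    then have "cost f j (search C, \<eta>', w @ [Ln, Lp]) \<le> 15"
      using less.IH[of j "w @ [Ln, Lp]"] 1(1) k by simp
    with cost_search_over[of \<eta>'' f j C w''] 1(2,3) show ?thesis by simp
  qed
qed

text \<open>An aborted branch costs at most 1, so unbounded cost passes to the surviving branch.
  Guessing forever would cost at most 15, so some value is completed; the emission takes finitely
  many steps and preserves unboundedness, which excludes a successful check.\<close>

lemma unbounded_search_emits:
  assumes "computes 2 g [0, 1] 6 C" "search_state n s 0 c \<eta>"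
    "\<not> bounded_cost f (search C, \<eta>, w)"
  shows "\<exists>y c' \<eta>' w'. g [n, s] \<noteq> 0 \<and> search_state n (Suc (prod_encode (y, s))) 0 c' \<eta>' \<and>
    \<not> bounded_cost f (search C, \<eta>', w')"
proof -
  have guessing: "\<exists>c \<eta>. search_state n s i c \<eta> \<and> \<not> bounded_cost f (search C, \<eta>, w @ guesses i)"
    if "\<forall>j<i. f (w @ guesses j) = Ln" for i
    using that
  proof (induction i)
    case 0
    then show ?case using assms by (auto simp: guesses_def)
  next
    case (Suc i)
    then obtain c \<eta> where 1: "search_state n s i c \<eta>"
      "\<not> bounded_cost f (search C, \<eta>, w @ guesses i)" by auto
    have "f (w @ guesses i) = Ln" using Suc.prems by simp
    from cost_search_guess[of f "w @ guesses i" n s i c \<eta> C, OF this 1(1)] obtain \<eta>' \<eta>'' w'' where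
      2: "search_state n s (Suc i) (2 * c) \<eta>'" "\<eta>'' 3 \<noteq> 0"
      "\<And>k. cost f (k + 7) (search C, \<eta>, w @ guesses i) =
        7 + cost f k (search C, \<eta>', w @ guesses (Suc i)) / 2 + cost f k (search C, \<eta>'', w'') / 2"
      unfolding guesses_Suc by auto
    have "\<not> bounded_cost f (search C, \<eta>', w @ guesses (Suc i))"
    proof
      assume "bounded_cost f (search C, \<eta>', w @ guesses (Suc i))"
      then obtain N where N: "\<And>k. cost f k (search C, \<eta>', w @ guesses (Suc i)) \<le> of_nat N"
        by (auto simp: bounded_cost_def)
      have "cost f k (search C, \<eta>, w @ guesses i) \<le> of_nat (8 + N)" for k
      proof -
        have "cost f k (search C, \<eta>, w @ guesses i) \<le> cost f (k + 7) (search C, \<eta>, w @ guesses i)"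
          by (rule cost_mono) simp
        also have "\<dots> \<le> 7 + of_nat N / 2 + 1 / 2"
          unfolding 2(3) using N[of k] cost_search_over[of \<eta>'' f k C w''] 2(2) by simp
        also have "\<dots> \<le> of_nat (8 + N)" by simp
        finally show ?thesis .
      qed
      then have "bounded_cost f (search C, \<eta>, w @ guesses i)" by (rule bounded_costI)
      with 1(2) show False ..
    qed
    with 2(1) show ?case by blast
  qed
  have "\<exists>i. f (w @ guesses i) \<noteq> Ln"
  proof (rule ccontr)
    assume "\<not> ?thesis"
    then have "cost f k (search C, \<eta>, w) \<le> of_nat 15" for k
      using cost_search_guess_forever[OF _ assms(2), of f w k C] by simp
    then have "bounded_cost f (search C, \<eta>, w)" by (rule bounded_costI)
    with assms(3) show False ..
  qed
  then obtain i where i: "f (w @ guesses i) \<noteq> Ln" "\<forall>j<i. f (w @ guesses j) = Ln"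
    using exists_least_iff[of "\<lambda>i. f (w @ guesses i) \<noteq> Ln"] by auto
  from guessing[OF i(2)] obtain c' \<eta>' where 1: "search_state n s i c' \<eta>'"
    "\<not> bounded_cost f (search C, \<eta>', w @ guesses i)" by blast
  from det_emit[OF assms(1) 1(1)] obtain t \<eta>'' where 2: "det t (emit C) \<eta>' \<eta>''"
    "\<eta>'' 3 = of_bool (g [n, s] = 0)"
    "g [n, s] \<noteq> 0 \<longrightarrow> search_state n (Suc (prod_encode (i, s))) 0 c' \<eta>''" by blast
  have "\<eta>' 3 = 0" using 1(1) by (simp add: search_state_def)
  have unb: "\<not> bounded_cost f (search C, \<eta>'', (w @ guesses i) @ [Rn])"
    using 1(2) bounded_cost_shift[OF cost_search_emit[of f "w @ guesses i" \<eta>' t C \<eta>'', OF i(1) \<open>\<eta>' 3 = 0\<close> 2(1)]] by blast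
  have "g [n, s] \<noteq> 0"
  proof
    assume "g [n, s] = 0"
    then have "cost f k (search C, \<eta>'', (w @ guesses i) @ [Rn]) \<le> of_nat 1" for k
      using 2(2) cost_search_over[of \<eta>'' f k C] by simp
    with unb show False by (blast intro: bounded_costI)
  qed
  with 2(3) unb show ?thesis by blast
qed

text \<open>Under a fixed scheduler, unbounded cost can be followed from one completed value to the
  next; dependent choice collects these values into a sequence none of whose prefixes passes the
  check.\<close>

lemma bounded_cost_search:
  assumes "computes 2 g [0, 1] 6 C" "search_state n 0 0 c \<eta>"
    "\<And>\<phi>. \<exists>m. g [n, list_encode (rev (map \<phi> [0..<m]))] = 0"
  shows "bounded_cost f (search C, \<eta>, w)"
proof (rule ccontr)
  assume unb: "\<not> bounded_cost f (search C, \<eta>, w)"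
  define ok where "ok e \<longleftrightarrow> (case e of (xs, \<eta>, w) \<Rightarrow>
    (\<exists>c. search_state n (list_encode (rev xs)) 0 c \<eta>) \<and> \<not> bounded_cost f (search C, \<eta>, w))" for e
  define extends where "extends e e' \<longleftrightarrow> g [n, list_encode (rev (fst e))] \<noteq> 0 \<and>
    (\<exists>y. fst e' = fst e @ [y])" for e e' :: "nat list \<times> valuation \<times> dir list"
  \<comment> \<open>The clause for \<open>j = 0\<close> makes the chain start with the empty
    sequence, so that entry \<open>j\<close> has length \<open>j\<close>.\<close>
  have "\<exists>e. \<forall>j::nat. (ok (e j) \<and> (j = 0 \<longrightarrow> fst (e j) = [])) \<and> extends (e j) (e (Suc j))"
  proof (rule dependent_nat_choice)
    have "ok ([], \<eta>, w)" using assms(2) unb by (auto simp: ok_def)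
    then show "\<exists>x. ok x \<and> (0 = 0 \<longrightarrow> fst x = [])" by (intro exI[of _ "([], \<eta>, w)"]) simp
  next
    fix e and j :: nat assume "ok e \<and> (j = 0 \<longrightarrow> fst e = [])"
    then obtain xs \<eta> w c where e: "e = (xs, \<eta>, w)" "search_state n (list_encode (rev xs)) 0 c \<eta>"
      "\<not> bounded_cost f (search C, \<eta>, w)" by (cases e) (auto simp: ok_def)
    from unbounded_search_emits[OF assms(1) e(2,3)] obtain y c' \<eta>' w' where
      "g [n, list_encode (rev xs)] \<noteq> 0"
      "search_state n (list_encode (rev (xs @ [y]))) 0 c' \<eta>'"
      "\<not> bounded_cost f (search C, \<eta>', w')" by auto
    then show "\<exists>e'. (ok e' \<and> (Suc j = 0 \<longrightarrow> fst e' = [])) \<and> extends e e'"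
      using e by (intro exI[of _ "(xs @ [y], \<eta>', w')"]) (auto simp: ok_def extends_def)
  qed
  then obtain e :: "nat \<Rightarrow> _" where e: "fst (e 0) = []" "\<And>j. extends (e j) (e (Suc j))" by blast
  define \<phi> where "\<phi> j = last (fst (e (Suc j)))" for j
  have "fst (e j) = map \<phi> [0..<j]" for j
  proof (induction j)
    case (Suc j)
    from e(2)[of j] obtain y where "fst (e (Suc j)) = fst (e j) @ [y]" by (auto simp: extends_def)
    moreover from this have "y = \<phi> j" by (simp add: \<phi>_def)
    ultimately show ?case using Suc by simp
  qed (simp add: e(1))
  moreover have "g [n, list_encode (rev (fst (e j)))] \<noteq> 0" for j
    using e(2)[of j] by (simp add: extends_def)
  ultimately have "g [n, list_encode (rev (map \<phi> [0..<j]))] \<noteq> 0" for j by metis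
  then show False using assms(3)[of \<phi>] by blast
qed

section \<open>Unbounded cost from a sequence that never passes the check\<close>

fun position :: "dir list \<Rightarrow> nat \<times> nat \<Rightarrow> nat \<times> nat" where
  "position [] p = p"
| "position (Ln # w) (j, y) = position w (j, Suc y)"
| "position (Rn # w) (j, y) = position w (Suc j, 0)"
| "position (d # w) p = position w p"

lemma position_append: "position (u @ w) p = position w (position u p)"
  by (induction u p rule: position.induct) auto

text \<open>\<open>Ln\<close> and \<open>Rn\<close> record exactly the nondeterministic choices, so
  the history reveals how many values are complete and how far the current one has been
  counted.\<close>

definition follow :: "(nat \<Rightarrow> nat) \<Rightarrow> scheduler" where
  "follow \<phi> w = (case position w (0, 0) of (j, y) \<Rightarrow> if y < \<phi> j then Ln else Rn)"

lemma follow_schedulers: "follow \<phi> \<in> schedulers"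
  by (auto simp: schedulers_def follow_def split: prod.splits)

text \<open>Here \<open>c\<close> is the reciprocal of the probability of the run so far, and each
  of \<open>m\<close> further emissions delays by at least \<open>c\<close>. A guess doubles
  \<open>c\<close> and halves the weight, so \<open>m * c\<close> is preserved.\<close>

lemma cost_follow:
  assumes "computes 2 g [0, 1] 6 C" "\<And>m. g [n, list_encode (rev (map \<phi> [0..<m]))] \<noteq> 0"
    "position w (0, 0) = (j, y)" "y \<le> \<phi> j"
    "search_state n (list_encode (rev (map \<phi> [0..<j]))) y c \<eta>"
  shows "\<exists>k. of_nat (m * c) \<le> cost (follow \<phi>) k (search C, \<eta>, w)"
  using assms(3-)
proof (induction m arbitrary: w j y c \<eta>)
  case 0
  then show ?case by (simp add: cost_nonneg)
next
  case (Suc m)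
  from Suc.prems show ?case
  \<comment> \<open>The inner induction counts the increments still missing from the current value,
    the outer one the emissions.\<close>
  proof (induction "\<phi> j - y" arbitrary: w y c \<eta>)
    case 0
    then have y: "y = \<phi> j" by simp
    have R: "follow \<phi> w \<noteq> Ln" using 0 by (simp add: follow_def)
    let ?s = "list_encode (rev (map \<phi> [0..<j]))"
    from det_emit[OF assms(1) 0(4)] assms(2) obtain t \<eta>' where
      1: "c \<le> t" "det t (emit C) \<eta> \<eta>'" "search_state n (Suc (prod_encode (y, ?s))) 0 c \<eta>'" by blast
    have "Suc (prod_encode (y, ?s)) = list_encode (rev (map \<phi> [0..<Suc j]))"
      by (simp add: y)
    moreover have "position (w @ [Rn]) (0, 0) = (Suc j, 0)"
      using 0 by (simp add: position_append)
    ultimately obtain k where k: "of_nat (m * c) \<le> cost (follow \<phi>) k (search C, \<eta>', w @ [Rn])"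
      using Suc.IH[of "w @ [Rn]" "Suc j" 0 c \<eta>'] 1(3) by auto
    have "\<eta> 3 = 0" using 0 by (simp add: search_state_def)
    \<comment> \<open>The delay inside \<open>t\<close> pays for one of the \<open>Suc m\<close>
      summands, the remaining run for the others.\<close>
    have "rat_of_nat (Suc m * c) \<le> of_nat (t + 2) + of_nat (m * c)"
      using 1(1) unfolding of_nat_add[symmetric] of_nat_le_iff by simp
    also have "\<dots> \<le> of_nat (t + 2) + cost (follow \<phi>) k (search C, \<eta>', w @ [Rn])"
      using k by simp
    also have "\<dots> = cost (follow \<phi>) (k + (t + 2)) (search C, \<eta>, w)"
      using cost_search_emit[of "follow \<phi>" w \<eta> t C \<eta>' k, OF R \<open>\<eta> 3 = 0\<close> 1(2)] by simp
    finally show ?case ..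
  next
    case (Suc d)
    then have y: "y < \<phi> j" by simp
    have L: "follow \<phi> w = Ln" using Suc.prems y by (simp add: follow_def)
    from cost_search_guess[of "follow \<phi>" w, OF L Suc.prems(3), of C] obtain \<eta>' \<eta>'' w'' where
      1: "search_state n (list_encode (rev (map \<phi> [0..<j]))) (Suc y) (2 * c) \<eta>'"
      "\<And>k. cost (follow \<phi>) (k + 7) (search C, \<eta>, w) =
        7 + cost (follow \<phi>) k (search C, \<eta>', w @ [Ln, Lp]) / 2
          + cost (follow \<phi>) k (search C, \<eta>'', w'') / 2" by blast
    have "position (w @ [Ln, Lp]) (0, 0) = (j, Suc y)"
      using Suc.prems by (simp add: position_append)
    moreover have "d = \<phi> j - Suc y" "Suc y \<le> \<phi> j" using Suc.hyps(2) y by simp_all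
    ultimately obtain k where
      k: "of_nat (Suc m * (2 * c)) \<le> cost (follow \<phi>) k (search C, \<eta>', w @ [Ln, Lp])"
      using Suc.hyps(1) 1(1) by blast
    have "rat_of_nat (Suc m * c) = of_nat (Suc m * (2 * c)) / 2" by simp
    also have "\<dots> \<le> cost (follow \<phi>) k (search C, \<eta>', w @ [Ln, Lp]) / 2"
      using k by (simp only: divide_right_mono zero_le_numeral)
    also have "\<dots> \<le> cost (follow \<phi>) (k + 7) (search C, \<eta>, w)"
      unfolding 1(2) using cost_nonneg[of "follow \<phi>" k "(search C, \<eta>'', w'')"] by simp
    finally show ?case ..
  qed
qed

lemma search_from_PAST_iff:
  assumes "computes 2 g [0, 1] 6 C"
  shows "search_from C n \<in> PAST \<longleftrightarrow> (\<forall>\<phi>. \<exists>m. g [n, list_encode (rev (map \<phi> [0..<m]))] = 0)"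
proof -
  let ?\<eta> = "(\<lambda>_. 0)(0 := of_nat n, 4 := 1)"
  have init: "search_state n 0 0 1 ?\<eta>" by (simp add: search_state_def)
  \<comment> \<open>Two initial assignments of two steps each.\<close>
  have "cost f (k + 4) (search_from C n, \<lambda>_. 0, []) = of_nat 4 + cost f k (search C, ?\<eta>, [])" for f k
    by (simp add: search_from_def eval_nat_numeral del: cost.simps(2))
  from bounded_cost_shift[OF this] have iff: "search_from C n \<in> PAST \<longleftrightarrow>
      (\<forall>f\<in>schedulers. bounded_cost f (search C, ?\<eta>, []))"
    by (simp add: PAST_iff bounded_cost_def[symmetric] search_from_def)
  show ?thesis
  proof
    assume PAST: "search_from C n \<in> PAST"
    show "\<forall>\<phi>. \<exists>m. g [n, list_encode (rev (map \<phi> [0..<m]))] = 0"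
    proof (rule ccontr)
      assume "\<not> ?thesis"
      then obtain \<phi> where \<phi>: "\<And>m. g [n, list_encode (rev (map \<phi> [0..<m]))] \<noteq> 0" by auto
      have "bounded_cost (follow \<phi>) (search C, ?\<eta>, [])"
        using PAST iff follow_schedulers by blast
      then obtain N where N: "\<And>k. cost (follow \<phi>) k (search C, ?\<eta>, []) \<le> of_nat N"
        by (auto simp: bounded_cost_def)
      have "\<exists>k. of_nat (Suc N * 1) \<le> cost (follow \<phi>) k (search C, ?\<eta>, [])"
        by (rule cost_follow[OF assms \<phi>, of "[]" 0 0]) (use init in auto)
      then obtain k where "of_nat (Suc N) \<le> cost (follow \<phi>) k (search C, ?\<eta>, [])" by auto
      with N[of k] have "rat_of_nat (Suc N) \<le> of_nat N" by linarith
      then show False by simp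
    qed
  qed (use iff bounded_cost_search[OF assms init] in blast)
qed

text \<open>The input occurs only in one constant, whose code is
  \<open>prod_encode (2 * n, 1)\<close> because nonnegative integers have even codes. The reduction
  is thus built from pairing and fixed numbers.\<close>

lemma enc_search_from:
  "enc_prog (search_from C n) = prod_encode (2, prod_encode
     (prod_encode (1, prod_encode (0, prod_encode (0, prod_encode (2 * n, 1)))),
      enc_prog (Seq (Assign 4 (AConst 1)) (search C))))"
proof -
  have "quotient_of (rat_of_nat n) = (int n, 1)"
    using quotient_of_int[of "int n"] by simp
  then have "enc_rat (of_nat n) = prod_encode (2 * n, 1)"
    by (simp add: enc_rat_def int_encode_def sum_encode_def)
  then show ?thesis by (simp add: search_from_def)
qed

lemma many_one_reducible_PAST:
  assumes "Pi11 B"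
  shows "many_one_reducible B PAST_codes"
proof -
  obtain R where "recursive_rel2 R"
    and B: "\<And>n. n \<in> B \<longleftrightarrow> (\<forall>\<phi>. \<exists>m. R n (list_encode (map \<phi> [0..<m])))"
    using assms by (auto simp: Pi11_def)
  then obtain r where r: "total_rec 2 r" "\<And>x y. R x y \<longleftrightarrow> r [x, y] = 0"
    by (auto simp: recursive_rel2_def)
  have "trec 2 (\<lambda>xs. r [xs ! 0, xs ! 1])"
    unfolding trec_def using r(1)
    by (intro exI[of _ r]) (auto simp: numeral_2_eq_2 length_Suc_conv)
  then have "rec2 (\<lambda>x y. r [x, y])" by (rule rec2I)
  \<comment> \<open>The program supplies the reversed sequence, so the predicate is precomposed with
    \<open>rev_code\<close> before compilation.\<close>
  from trec_rec2[OF this trec_proj[of 0 2] trec_rec1[OF rec1_rev_code trec_proj[of 1 2]]]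
  obtain g where g: "total_rec 2 g" "\<And>n s. g [n, s] = r [n, rev_code s]"
    unfolding trec_def by fastforce
  obtain C where C: "computes 2 g [0, 1] 6 C"
    using total_rec_computes[OF g(1), of "[0, 1]" 6] by auto
  have "n \<in> B \<longleftrightarrow> enc_prog (search_from C n) \<in> PAST_codes" for n
    unfolding B enc_prog_mem_PAST_codes search_from_PAST_iff[OF C] g r(2)
    by (simp add: rev_code_list_encode)
  moreover have "rec1 (\<lambda>n. enc_prog (search_from C n))"
    unfolding enc_search_from by (intro rec1I trec_intros) auto
  then have "recursive_fun (\<lambda>n. enc_prog (search_from C n))"
    unfolding rec1_def recursive_fun_def trec_def by force
  ultimately show ?thesis unfolding many_one_reducible_def by blast
qed

theorem theorem4p2:
  shows "Pi11_complete PAST_codes"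
  unfolding Pi11_complete_def using Pi11_PAST_codes many_one_reducible_PAST by blast

end
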